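(* Let $(E,\tau,M,\rho)$ be a Lie algebroid. The Schouten-Nijenhuis bracket on $A(M,E)$ has the following properties. 1. For $f,g\in A^0(M,E)=C^\infty(M,\mathbb R)$, $[f,g]=0$. 2. For $V\in A^1(M,E)$, $q\in\mathbb Z$ and $Q\in A^q(M,E)$, $[V,Q]=\mathcal L_\rho(V)Q$. 3. For $V,W\in A^1(M,E)$, $[V,W]=\{V,W\}$, the bracket in the right hand side being the Lie algebroid bracket. 4. For all $p,q\in\mathbb Z$, $P\in A^p(M,E)$, $Q\in A^q(M,E)$, $[P,Q]=-(-1)^{(p-1)(q-1)}[Q,P]$. 5. For $p\in\mathbb Z$ and $P\in A^p(M,E)$, the map $Q\mapsto[P,Q]$ is a derivation of degree $p-1$ of the graded exterior algebra $A(M,E)$: for $q_1,q_2\in\mathbb Z$, $Q_1\in A^{q_1}(M,E)$, $Q_2\in A^{q_2}(M,E)$, $$[P,Q_1\wedge Q_2]=[P,Q_1]\wedge Q_2+(-1)^{(p-1)q_1}Q_1\wedge[P,Q_2].$$ 6. For $p,q,r\in\mathbb Z$, $P\in A^p(M,E)$, $Q\in A^q(M,E)$, $R\in A^r(M,E)$, the graded Jacobi identity holds: $$(-1)^{(p-1)(r-1)}\bigl[[P,Q],R\bigr]+(-1)^{(q-1)(p-1)}\bigl[[Q,R],P\bigr]+(-1)^{(r-1)(q-1)}\bigl[[R,P],Q\bigr]=0.$$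
   Context: A Lie algebroid $(E,\tau,M,\rho)$ is a smooth real vector bundle $\tau:E\to M$ of finite rank over a smooth manifold, with a real Lie algebra bracket $\{\ ,\ \}$ on its smooth sections and a smooth vector bundle map $\rho:E\to TM$ over $\mathrm{id}_M$ (anchor) such that $\{s_1,fs_2\}=f\{s_1,s_2\}+(\mathcal L(\rho\circ s_1)f)s_2$. $A^p(M,E)$ and $\Omega^p(M,E)$ are the spaces of smooth sections of $\bigwedge^pE$ and $\bigwedge^pE^*$ (both $C^\infty(M,\mathbb R)$ for $p=0$, $\{0\}$ for $p<0$); $A(M,E)=\bigoplus_pA^p(M,E)$, $\Omega(M,E)=\bigoplus_p\Omega^p(M,E)$, graded algebras for $\wedge$. The pairing $\langle\ ,\ \rangle$ of $\Omega^p(M,E)$ with $A^p(M,E)$ satisfies $\langle\eta,V_1\wedge\cdots\wedge V_p\rangle=\eta(V_1,\dots,V_p)$. Interior product: $i(f)\eta=f\eta$ for functions; $i(V)$ for $V\in A^1(M,E)$ inserts $V$ as first argument (and is $0$ on $\Omega^0$); $i(V_1\wedge\cdots\wedge V_p)=i(V_1)\circ\cdots\circ i(V_p)$, extended linearly. $i(P)$ has degree $-p$ for $P\in A^p(M,E)$. $d_\rho$ is the degree $1$ endomorphism of $\Omega(M,E)$ given by $\langle d_\rho f,V\rangle=\mathcal L(\rho\circ V)f$ and, for $\eta\in\Omega^p(M,E)$, $p\ge1$, $$d_\rho\eta(V_0,\dots,V_p)=\sum_{i}(-1)^i\mathcal L(\rho\circ V_i)\bigl(\eta(V_0,\dots,\widehat{V_i},\dots,V_p)\bigr)+\sum_{i<j}(-1)^{i+j}\eta(\{V_i,V_j\},V_0,\dots,\widehat{V_i},\dots,\widehat{V_j},\dots,V_p).$$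 Graded bracket: $[F,G]=F\circ G-(-1)^{d_1d_2}G\circ F$ for graded endomorphisms of degrees $d_1,d_2$. For $P\in A^p(M,E)$, $Q\in A^q(M,E)$, the Schouten-Nijenhuis bracket $[P,Q]$ is the unique element of $A^{p+q-1}(M,E)$ such that $i([P,Q])=\bigl[[i(P),d_\rho],i(Q)\bigr]$ on $\Omega(M,E)$. Lie derivative $\mathcal L_\rho(V)$, $V\in A^1(M,E)$: on functions $\mathcal L_\rho(V)f=\mathcal L(\rho\circ V)f$; on $\eta\in\Omega^p(M,E)$, $p\geq 1$, $(\mathcal L_\rho(V)\eta)(V_1,\dots,V_p)=\mathcal L_\rho(V)(\eta(V_1,\dots,V_p))-\sum_i\eta(V_1,\dots,\{V,V_i\},\dots,V_p)$; on $P\in A^p(M,E)$, $p\ge1$, $\mathcal L_\rho(V)P\in A^p(M,E)$ is determined by $\langle\eta,\mathcal L_\rho(V)P\rangle=\mathcal L_\rho(V)(\langle\eta,P\rangle)-\langle\mathcal L_\rho(V)\eta,P\rangle$ for all $\eta\in\Omega^p(M,E)$. *)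

theory Defs
  imports "HOL-Analysis.Analysis"
begin

section \<open>Smooth functions on open subsets of \<open>\<real>\<^sup>n\<close>\<close>

text \<open>
  The space \<open>\<real>\<^sup>n\<close> is the topology \<^const>\<open>Euclidean_space\<close> \<open>n\<close>, whose points are the functions
  \<open>nat \<Rightarrow> real\<close> vanishing at all indices \<open>\<ge> n\<close>. Unlike a type of class \<open>euclidean_space\<close> it
  allows \<open>n = 0\<close>, so that manifolds of dimension \<open>0\<close> (Lie algebras as Lie algebroids over a
  point) and bundles of rank \<open>0\<close> are covered.
\<close>

definition partial_deriv :: "nat \<Rightarrow> ((nat \<Rightarrow> real) \<Rightarrow> real) \<Rightarrow> (nat \<Rightarrow> real) \<Rightarrow> real" where
  "partial_deriv i f x = deriv (\<lambda>t. f (x(i := t))) (x i)"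

text \<open>All iterated partial derivatives exist and are continuous on \<open>U\<close>; used for \<open>U\<close> open in \<open>\<real>\<^sup>n\<close>.\<close>

definition smooth_on :: "nat \<Rightarrow> (nat \<Rightarrow> real) set \<Rightarrow> ((nat \<Rightarrow> real) \<Rightarrow> real) \<Rightarrow> bool" where
  "smooth_on n U f \<longleftrightarrow>
     (\<forall>is. set is \<subseteq> {..<n} \<longrightarrow>
        continuous_on U (foldr partial_deriv is f) \<and>
        (\<forall>i<n. \<forall>x\<in>U. (\<lambda>t. foldr partial_deriv is f (x(i := t))) differentiable at (x i)))"


section \<open>Smooth manifolds and their tangent bundles\<close>

text \<open>
  The underlying topological space of a manifold is a Hausdorff, second countable type \<open>'m\<close>.
  A chart is a pair \<open>(U, \<phi>)\<close>; the values of \<open>\<phi>\<close> outside \<open>U\<close> are irrelevant.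
\<close>

record 'm manifold =
  man_dim :: nat
  charts :: "('m set \<times> ('m \<Rightarrow> nat \<Rightarrow> real)) set"

definition smooth_fun_on :: "'m manifold \<Rightarrow> 'm set \<Rightarrow> ('m \<Rightarrow> real) \<Rightarrow> bool" where
  "smooth_fun_on M S f \<longleftrightarrow>
     (\<forall>(U, \<phi>) \<in> charts M. smooth_on (man_dim M) (\<phi> ` (U \<inter> S)) (\<lambda>z. f (inv_into U \<phi> z)))"

abbreviation smooth_funs :: "'m manifold \<Rightarrow> ('m \<Rightarrow> real) set" where
  "smooth_funs M \<equiv> {f. smooth_fun_on M UNIV f}"

definition smooth_manifold :: "('m :: {t2_space, second_countable_topology}) manifold \<Rightarrow> bool" where
  "smooth_manifold M \<longleftrightarrow>
     (\<Union>(U, \<phi>) \<in> charts M. U) = UNIV \<and>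
     (\<forall>(U, \<phi>) \<in> charts M.
        open U \<and> openin (Euclidean_space (man_dim M)) (\<phi> ` U) \<and>
        homeomorphic_map (top_of_set U) (subtopology (Euclidean_space (man_dim M)) (\<phi> ` U)) \<phi> \<and>
        (\<forall>j < man_dim M. smooth_fun_on M U (\<lambda>x. \<phi> x j)))"

definition smooth_near :: "('m :: topological_space) manifold \<Rightarrow> 'm \<Rightarrow> ('m \<Rightarrow> real) \<Rightarrow> bool" where
  "smooth_near M x f \<longleftrightarrow> (\<exists>S. open S \<and> x \<in> S \<and> smooth_fun_on M S f)"

text \<open>
  Tangent vectors at \<open>x\<close> are the derivations at \<open>x\<close> of the functions that are smooth near \<open>x\<close>.
  The last clause fixes the irrelevant values, so that equality of functions is equality of
  derivations. (Such a derivation depends only on the germ of \<open>f\<close>: a function vanishing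
  near \<open>x\<close> is its own product with a function that is \<open>0\<close> near \<open>x\<close> and \<open>1\<close> elsewhere.)
\<close>

definition tangent_space :: "('m :: topological_space) manifold \<Rightarrow> 'm \<Rightarrow> (('m \<Rightarrow> real) \<Rightarrow> real) set" where
  "tangent_space M x =
     {D. (\<forall>f g. smooth_near M x f \<longrightarrow> smooth_near M x g \<longrightarrow>
            D (\<lambda>y. f y + g y) = D f + D g \<and>
            D (\<lambda>y. f y * g y) = D f * g x + f x * D g) \<and>
         (\<forall>c f. smooth_near M x f \<longrightarrow> D (\<lambda>y. c * f y) = c * D f) \<and>
         (\<forall>f. \<not> smooth_near M x f \<longrightarrow> D f = 0)}"


section \<open>Smooth vector bundles\<close>

definition real_vector_space_on ::
  "'v set \<Rightarrow> ('v \<Rightarrow> 'v \<Rightarrow> 'v) \<Rightarrow> (real \<Rightarrow> 'v \<Rightarrow> 'v) \<Rightarrow> 'v \<Rightarrow> bool" where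
  "real_vector_space_on S add smul zero \<longleftrightarrow>
     zero \<in> S \<and> (\<forall>u\<in>S. \<forall>v\<in>S. add u v \<in> S) \<and> (\<forall>c. \<forall>v\<in>S. smul c v \<in> S) \<and>
     (\<forall>u\<in>S. \<forall>v\<in>S. \<forall>w\<in>S. add (add u v) w = add u (add v w)) \<and>
     (\<forall>u\<in>S. \<forall>v\<in>S. add u v = add v u) \<and>
     (\<forall>v\<in>S. add zero v = v) \<and> (\<forall>v\<in>S. \<exists>w\<in>S. add v w = zero) \<and>
     (\<forall>c. \<forall>u\<in>S. \<forall>v\<in>S. smul c (add u v) = add (smul c u) (smul c v)) \<and>
     (\<forall>b c. \<forall>v\<in>S. smul (b + c) v = add (smul b v) (smul c v)) \<and>
     (\<forall>b c. \<forall>v\<in>S. smul b (smul c v) = smul (b * c) v) \<and>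
     (\<forall>v\<in>S. smul 1 v = v)"

text \<open>
  A vector bundle is given by its total space \<open>tot\<close>, the projection \<open>proj\<close> to the base, the
  fibrewise operations, and a bundle atlas: a set of local trivializations \<open>(W, \<Phi>)\<close>, where
  \<open>e \<mapsto> (proj e, \<Phi> e)\<close> is the trivialization of the part of \<open>tot\<close> over \<open>W\<close>. The topology and the
  smooth structure of the total space are those determined by the bundle atlas.
\<close>

record ('m, 'e) vector_bundle =
  bas :: "'m manifold"
  tot :: "'e set"
  proj :: "'e \<Rightarrow> 'm"
  vadd :: "'e \<Rightarrow> 'e \<Rightarrow> 'e"
  vscale :: "real \<Rightarrow> 'e \<Rightarrow> 'e"
  vzero :: "'m \<Rightarrow> 'e"
  vb_rank :: nat
  trivs :: "('m set \<times> ('e \<Rightarrow> nat \<Rightarrow> real)) set"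

definition fibre :: "('m, 'e, 'z) vector_bundle_scheme \<Rightarrow> 'm \<Rightarrow> 'e set" where
  "fibre E x = {e \<in> tot E. proj E e = x}"

text \<open>The local frame \<open>e\<^sub>0, \<dots>, e\<^bsub>r-1\<^esub>\<close> determined by a local trivialization \<open>\<Phi>\<close>.\<close>

definition frame ::
  "('m, 'e, 'z) vector_bundle_scheme \<Rightarrow> ('e \<Rightarrow> nat \<Rightarrow> real) \<Rightarrow> nat \<Rightarrow> 'm \<Rightarrow> 'e" where
  "frame E \<Phi> k x = inv_into (fibre E x) \<Phi> (\<lambda>i. if i = k then 1 else 0)"

text \<open>
  The last clause of the following definition says that the matrix-valued transition function
  from \<open>(W, \<Phi>)\<close> to \<open>(W', \<Phi>')\<close> is smooth on \<open>W \<inter> W'\<close>; its entries are \<open>\<Phi>' (e\<^sub>k x) j\<close>.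
\<close>

definition smooth_vector_bundle ::
  "('m :: {t2_space, second_countable_topology}, 'e, 'z) vector_bundle_scheme \<Rightarrow> bool" where
  "smooth_vector_bundle E \<longleftrightarrow>
     smooth_manifold (bas E) \<and>
     (\<forall>x. real_vector_space_on (fibre E x) (vadd E) (vscale E) (vzero E x)) \<and>
     (\<Union>(W, \<Phi>) \<in> trivs E. W) = UNIV \<and>
     (\<forall>(W, \<Phi>) \<in> trivs E. open W \<and>
        (\<forall>x\<in>W. bij_betw \<Phi> (fibre E x) (topspace (Euclidean_space (vb_rank E))) \<and>
           (\<forall>u \<in> fibre E x. \<forall>v \<in> fibre E x. \<Phi> (vadd E u v) = (\<lambda>i. \<Phi> u i + \<Phi> v i)) \<and>
           (\<forall>c. \<forall>v \<in> fibre E x. \<Phi> (vscale E c v) = (\<lambda>i. c * \<Phi> v i)))) \<and>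
     (\<forall>(W, \<Phi>) \<in> trivs E. \<forall>(W', \<Phi>') \<in> trivs E. \<forall>j < vb_rank E. \<forall>k < vb_rank E.
        smooth_fun_on (bas E) (W \<inter> W') (\<lambda>x. \<Phi>' (frame E \<Phi> k x) j))"

definition sections ::
  "('m, 'e, 'z) vector_bundle_scheme \<Rightarrow> ('m \<Rightarrow> 'e) set" where
  "sections E =
     {s. (\<forall>x. s x \<in> fibre E x) \<and>
         (\<forall>(W, \<Phi>) \<in> trivs E. \<forall>j < vb_rank E. smooth_fun_on (bas E) W (\<lambda>x. \<Phi> (s x) j))}"

definition sec_add ::
  "('m, 'e, 'z) vector_bundle_scheme \<Rightarrow> ('m \<Rightarrow> 'e) \<Rightarrow> ('m \<Rightarrow> 'e) \<Rightarrow> 'm \<Rightarrow> 'e" where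
  "sec_add E s t = (\<lambda>x. vadd E (s x) (t x))"

definition sec_scale ::
  "('m, 'e, 'z) vector_bundle_scheme \<Rightarrow> ('m \<Rightarrow> real) \<Rightarrow> ('m \<Rightarrow> 'e) \<Rightarrow> 'm \<Rightarrow> 'e" where
  "sec_scale E f s = (\<lambda>x. vscale E (f x) (s x))"

text \<open>
  The trivialization of the tangent bundle over a chart \<open>(U, \<phi>)\<close> sends a tangent vector to its
  components, the values of the derivation on the coordinate functions.
\<close>

definition tangent_bundle ::
  "('m :: topological_space) manifold \<Rightarrow> ('m, 'm \<times> (('m \<Rightarrow> real) \<Rightarrow> real)) vector_bundle" where
  "tangent_bundle M =
     \<lparr> bas = M,
       tot = {(x, D). D \<in> tangent_space M x},
       proj = fst,
       vadd = (\<lambda>(x, D) (y, D'). (x, \<lambda>f. D f + D' f)),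
       vscale = (\<lambda>c (x, D). (x, \<lambda>f. c * D f)),
       vzero = (\<lambda>x. (x, \<lambda>f. 0)),
       vb_rank = man_dim M,
       trivs = (\<lambda>(U, \<phi>). (U, \<lambda>(x, D) i. if i < man_dim M then D (\<lambda>y. \<phi> y i) else 0)) ` charts M \<rparr>"

text \<open>
  Smooth vector bundle maps over the identity. In the last clause \<open>D\<close> is an open part of the
  total space of \<open>E\<close>, and \<open>\<kappa> : e \<mapsto> (\<phi> (proj e), \<Phi> e) \<in> \<real>\<^bsup>n+r\<^esup>\<close> is a chart of the
  manifold \<open>tot E\<close>, defined on \<open>D\<close>. Only the fibre coordinates of \<open>h\<close> have to be considered, as
  its base coordinates are those of \<open>proj E\<close>.
\<close>

definition smooth_bundle_map ::
  "('m, 'e, 'z) vector_bundle_scheme \<Rightarrow> ('m, 'e2, 'z2) vector_bundle_scheme \<Rightarrow> ('e \<Rightarrow> 'e2) \<Rightarrow> bool"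
  where
  "smooth_bundle_map E F h \<longleftrightarrow>
     bas F = bas E \<and>
     (\<forall>x. \<forall>v \<in> fibre E x. h v \<in> fibre F x) \<and>
     (\<forall>x. \<forall>u \<in> fibre E x. \<forall>v \<in> fibre E x. h (vadd E u v) = vadd F (h u) (h v)) \<and>
     (\<forall>x c. \<forall>v \<in> fibre E x. h (vscale E c v) = vscale F c (h v)) \<and>
     (\<forall>(U, \<phi>) \<in> charts (bas E). \<forall>(W, \<Phi>) \<in> trivs E. \<forall>(W', \<Phi>') \<in> trivs F.
        let n = man_dim (bas E);
            D = {e \<in> tot E. proj E e \<in> U \<inter> W \<inter> W'};
            \<kappa> = (\<lambda>e i. if i < n then \<phi> (proj E e) i else \<Phi> e (i - n))
        in \<forall>j < vb_rank F.
             smooth_on (n + vb_rank E) (\<kappa> ` D) (\<lambda>z. \<Phi>' (h (inv_into D \<kappa> z)) j))"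


section \<open>Lie algebroids\<close>

record ('m, 'e) lie_algebroid = "('m, 'e) vector_bundle" +
  anchor :: "'e \<Rightarrow> 'm \<times> (('m \<Rightarrow> real) \<Rightarrow> real)"
  lie_bracket :: "('m \<Rightarrow> 'e) \<Rightarrow> ('m \<Rightarrow> 'e) \<Rightarrow> 'm \<Rightarrow> 'e"

text \<open>The derivative of the function \<open>f\<close> along the vector field \<open>\<rho> \<circ> V\<close>.\<close>

definition lie_fun :: "('m, 'e) lie_algebroid \<Rightarrow> ('m \<Rightarrow> 'e) \<Rightarrow> ('m \<Rightarrow> real) \<Rightarrow> 'm \<Rightarrow> real" where
  "lie_fun L V f = (\<lambda>x. snd (anchor L (V x)) f)"

definition is_lie_algebroid ::
  "('m :: {t2_space, second_countable_topology}, 'e) lie_algebroid \<Rightarrow> bool" where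
  "is_lie_algebroid L \<longleftrightarrow>
     smooth_vector_bundle L \<and>
     smooth_bundle_map L (tangent_bundle (bas L)) (anchor L) \<and>
     (\<forall>s \<in> sections L. \<forall>t \<in> sections L. lie_bracket L s t \<in> sections L) \<and>
     (\<forall>s \<in> sections L. \<forall>t \<in> sections L. \<forall>u \<in> sections L.
        lie_bracket L (sec_add L s t) u = sec_add L (lie_bracket L s u) (lie_bracket L t u) \<and>
        lie_bracket L u (sec_add L s t) = sec_add L (lie_bracket L u s) (lie_bracket L u t)) \<and>
     (\<forall>c. \<forall>s \<in> sections L. \<forall>t \<in> sections L.
        lie_bracket L (sec_scale L (\<lambda>x. c) s) t = sec_scale L (\<lambda>x. c) (lie_bracket L s t) \<and>
        lie_bracket L s (sec_scale L (\<lambda>x. c) t) = sec_scale L (\<lambda>x. c) (lie_bracket L s t)) \<and>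
     (\<forall>s \<in> sections L. lie_bracket L s s = vzero L) \<and>
     (\<forall>s \<in> sections L. \<forall>t \<in> sections L. \<forall>u \<in> sections L.
        sec_add L (lie_bracket L s (lie_bracket L t u))
          (sec_add L (lie_bracket L t (lie_bracket L u s)) (lie_bracket L u (lie_bracket L s t)))
        = vzero L) \<and>
     (\<forall>f \<in> smooth_funs (bas L). \<forall>s \<in> sections L. \<forall>t \<in> sections L.
        lie_bracket L s (sec_scale L f t) =
          sec_add L (sec_scale L f (lie_bracket L s t)) (sec_scale L (lie_fun L s f) t))"


section \<open>Forms\<close>

text \<open>
  An element of \<open>\<And>E\<^sub>x\<^sup>*\<close> is represented by a real function \<open>a\<close> of finite lists of elements of
  \<open>E\<^sub>x\<close>, alternating and multilinear in lists of each length: the component of degree \<open>p\<close> is the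
  restriction of \<open>a\<close> to lists of length \<open>p\<close>. As \<open>E\<^sub>x\<close> has finite dimension, the components of
  degree \<open>> dim E\<^sub>x\<close> vanish, so this is the direct sum over \<open>p\<close>.
\<close>

definition alt_forms :: "('m, 'e, 'z) vector_bundle_scheme \<Rightarrow> 'm \<Rightarrow> ('e list \<Rightarrow> real) set" where
  "alt_forms E x =
     {a. (\<forall>vs. \<not> set vs \<subseteq> fibre E x \<longrightarrow> a vs = 0) \<and>
         (\<forall>us v w ws. set (us @ v # w # ws) \<subseteq> fibre E x \<longrightarrow>
            a (us @ vadd E v w # ws) = a (us @ v # ws) + a (us @ w # ws)) \<and>
         (\<forall>us c v ws. set (us @ v # ws) \<subseteq> fibre E x \<longrightarrow>
            a (us @ vscale E c v # ws) = c * a (us @ v # ws)) \<and>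
         (\<forall>us v ws zs. a (us @ v # ws @ v # zs) = 0)}"

type_synonym ('m, 'e) form = "'m \<Rightarrow> 'e list \<Rightarrow> real"

text \<open>\<open>\<Omega>(M,E)\<close>, and \<open>\<Omega>\<^sup>p(M,E)\<close> for \<open>p \<in> \<int>\<close>.\<close>

definition all_forms :: "('m, 'e, 'z) vector_bundle_scheme \<Rightarrow> ('m, 'e) form set" where
  "all_forms E =
     {\<eta>. (\<forall>x. \<eta> x \<in> alt_forms E x) \<and>
         (\<forall>(W, \<Phi>) \<in> trivs E. \<forall>is. set is \<subseteq> {..<vb_rank E} \<longrightarrow>
            smooth_fun_on (bas E) W (\<lambda>x. \<eta> x (map (\<lambda>i. frame E \<Phi> i x) is)))}"

definition forms :: "('m, 'e, 'z) vector_bundle_scheme \<Rightarrow> int \<Rightarrow> ('m, 'e) form set" where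
  "forms E p = {\<eta> \<in> all_forms E. \<forall>x vs. int (length vs) \<noteq> p \<longrightarrow> \<eta> x vs = 0}"

text \<open>The function \<open>\<eta>(V\<^sub>1, \<dots>, V\<^sub>p)\<close>.\<close>

definition eval_form :: "('m, 'e) form \<Rightarrow> ('m \<Rightarrow> 'e) list \<Rightarrow> 'm \<Rightarrow> real" where
  "eval_form \<eta> Vs = (\<lambda>x. \<eta> x (map (\<lambda>V. V x) Vs))"

text \<open>
  The list \<open>nths Vs (- {i})\<close> is \<open>Vs\<close> without the entry at position \<open>i\<close>. For \<open>Vs = [V]\<close> the
  formula reads \<open>(d\<^sub>\<rho> f)(V) = \<L>(\<rho> \<circ> V) f\<close> with \<open>f\<close> the component of degree \<open>0\<close> of \<open>\<eta>\<close>; for \<open>Vs = []\<close>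
  it says that \<open>d\<^sub>\<rho> \<eta>\<close> has no component of degree \<open>0\<close>.
\<close>

definition d_rho :: "('m, 'e) lie_algebroid \<Rightarrow> ('m, 'e) form \<Rightarrow> ('m, 'e) form" where
  "d_rho L \<eta> =
     (THE \<omega>. \<omega> \<in> all_forms L \<and>
        (\<forall>Vs. set Vs \<subseteq> sections L \<longrightarrow>
           eval_form \<omega> Vs = (\<lambda>x.
             (\<Sum>i<length Vs. (-1) ^ i * lie_fun L (Vs ! i) (eval_form \<eta> (nths Vs (- {i}))) x) +
             (\<Sum>j<length Vs. \<Sum>i<j. (-1) ^ (i + j) *
                eval_form \<eta> (lie_bracket L (Vs ! i) (Vs ! j) # nths Vs (- {i, j})) x))))"

text \<open>For \<open>Vs = []\<close> the following formula reads \<open>\<L>\<^sub>\<rho>(V) f = \<L>(\<rho> \<circ> V) f\<close>.\<close>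

definition lie_form ::
  "('m, 'e) lie_algebroid \<Rightarrow> ('m \<Rightarrow> 'e) \<Rightarrow> ('m, 'e) form \<Rightarrow> ('m, 'e) form" where
  "lie_form L V \<eta> =
     (THE \<omega>. \<omega> \<in> all_forms L \<and>
        (\<forall>Vs. set Vs \<subseteq> sections L \<longrightarrow>
           eval_form \<omega> Vs = (\<lambda>x.
             lie_fun L V (eval_form \<eta> Vs) x -
             (\<Sum>i<length Vs. eval_form \<eta> (Vs[i := lie_bracket L V (Vs ! i)]) x))))"


section \<open>Multivectors\<close>

text \<open>
  The exterior algebra \<open>\<And>E\<^sub>x\<close> is realized, by means of the pairing, inside the dual of
  \<open>\<And>E\<^sub>x\<^sup>*\<close>: the multivector \<open>v\<^sub>1 \<and> \<dots> \<and> v\<^sub>p\<close> is the functional \<open>a \<mapsto> a(v\<^sub>1, \<dots>, v\<^sub>p)\<close>, and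
  \<open>\<And>\<^sup>pE\<^sub>x\<close> is the span of these. In finite dimension this is the exterior power, since a linear
  combination of decomposable multivectors is zero iff all alternating \<open>p\<close>-forms vanish on it.
  Functionals are set to \<open>0\<close> outside \<open>alt_forms E x\<close>, so that equality has the right meaning.
\<close>

type_synonym ('m, 'e) multivector_field = "'m \<Rightarrow> ('e list \<Rightarrow> real) \<Rightarrow> real"

definition decomposable ::
  "('m, 'e, 'z) vector_bundle_scheme \<Rightarrow> 'm \<Rightarrow> 'e list \<Rightarrow> ('e list \<Rightarrow> real) \<Rightarrow> real" where
  "decomposable E x vs = (\<lambda>a. if a \<in> alt_forms E x then a vs else 0)"

text \<open>
  \<open>A\<^sup>p(M,E)\<close> for \<open>p \<in> \<int>\<close>: over the domain of each trivialization, \<open>P\<close> is a linear combination with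
  smooth coefficients of \<open>e\<^bsub>i\<^sub>1\<^esub> \<and> \<dots> \<and> e\<^bsub>i\<^sub>p\<^esub>\<close>, \<open>i\<^sub>1 < \<dots> < i\<^sub>p\<close>, the basis of \<open>\<And>\<^sup>pE\<^sub>x\<close> obtained
  from the local frame.
\<close>

definition multivector_fields ::
  "('m, 'e, 'z) vector_bundle_scheme \<Rightarrow> int \<Rightarrow> ('m, 'e) multivector_field set" where
  "multivector_fields E p =
     {P. \<forall>(W, \<Phi>) \<in> trivs E. \<exists>c :: nat list \<Rightarrow> 'm \<Rightarrow> real.
           (\<forall>I. smooth_fun_on (bas E) W (c I)) \<and>
           (\<forall>x\<in>W. P x = (\<lambda>a. \<Sum>I | sorted_wrt (<) I \<and> set I \<subseteq> {..<vb_rank E} \<and> int (length I) = p.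
              c I x * decomposable E x (map (\<lambda>i. frame E \<Phi> i x) I) a))}"

text \<open>The identifications of \<open>C\<^sup>\<infinity>(M,\<real>)\<close> with \<open>A\<^sup>0(M,E)\<close> and of the sections of \<open>E\<close> with \<open>A\<^sup>1(M,E)\<close>.\<close>

definition fun_mv ::
  "('m, 'e, 'z) vector_bundle_scheme \<Rightarrow> ('m \<Rightarrow> real) \<Rightarrow> ('m, 'e) multivector_field" where
  "fun_mv E f = (\<lambda>x a. f x * decomposable E x [] a)"

definition sec_mv ::
  "('m, 'e, 'z) vector_bundle_scheme \<Rightarrow> ('m \<Rightarrow> 'e) \<Rightarrow> ('m, 'e) multivector_field" where
  "sec_mv E V = (\<lambda>x. decomposable E x [V x])"

definition zero_mv :: "('m, 'e) multivector_field" where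
  "zero_mv = (\<lambda>x a. 0)"

definition add_mv ::
  "('m, 'e) multivector_field \<Rightarrow> ('m, 'e) multivector_field \<Rightarrow> ('m, 'e) multivector_field" where
  "add_mv P Q = (\<lambda>x a. P x a + Q x a)"

definition scale_mv :: "real \<Rightarrow> ('m, 'e) multivector_field \<Rightarrow> ('m, 'e) multivector_field" where
  "scale_mv c P = (\<lambda>x a. c * P x a)"

text \<open>
  The exterior product is the bilinear extension of the concatenation of decomposable
  multivectors; see \<open>wedge_mv_decomposable\<close> below.
\<close>

definition wedge_mv ::
  "('m, 'e, 'z) vector_bundle_scheme \<Rightarrow>
     ('m, 'e) multivector_field \<Rightarrow> ('m, 'e) multivector_field \<Rightarrow> ('m, 'e) multivector_field" where
  "wedge_mv E P Q =
     (\<lambda>x a. if a \<in> alt_forms E x then P x (\<lambda>vs. Q x (\<lambda>ws. a (vs @ ws))) else 0)"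

definition pairing :: "('m, 'e) form \<Rightarrow> ('m, 'e) multivector_field \<Rightarrow> 'm \<Rightarrow> real" where
  "pairing \<eta> P = (\<lambda>x. P x (\<eta> x))"

definition insert_vector :: "('m \<Rightarrow> 'e) \<Rightarrow> ('m, 'e) form \<Rightarrow> ('m, 'e) form" where
  "insert_vector V \<eta> = (\<lambda>x ws. \<eta> x (V x # ws))"

text \<open>
  As \<open>i(V\<^sub>1 \<and> \<dots> \<and> V\<^sub>p)\<close> is the composition \<open>i(V\<^sub>1) \<circ> \<dots> \<circ> i(V\<^sub>p)\<close>, it maps \<open>\<eta>\<close> to
  \<open>\<eta>(V\<^sub>p, \<dots>, V\<^sub>1, \<dots>)\<close>, whence the reversal; see \<open>int_prod_decomposable\<close> below.
\<close>

definition int_prod :: "('m, 'e) multivector_field \<Rightarrow> ('m, 'e) form \<Rightarrow> ('m, 'e) form" where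
  "int_prod P \<eta> = (\<lambda>x ws. P x (\<lambda>vs. \<eta> x (rev vs @ ws)))"

text \<open>
  The degree \<open>q\<close> of \<open>P\<close> is an explicit argument. On \<open>A\<^sup>0(M,E)\<close> this is the Lie derivative of the
  function \<open>f\<close> corresponding to \<open>P\<close>, obtained by pairing \<open>P\<close> with the constant form \<open>1\<close>.
\<close>

definition lie_mv ::
  "('m, 'e) lie_algebroid \<Rightarrow> int \<Rightarrow> ('m \<Rightarrow> 'e) \<Rightarrow> ('m, 'e) multivector_field \<Rightarrow> ('m, 'e) multivector_field"
  where
  "lie_mv L q V P =
     (if q = 0 then fun_mv L (lie_fun L V (pairing (\<lambda>x vs. if vs = [] then 1 else 0) P))
      else THE R. R \<in> multivector_fields L q \<and>
        (\<forall>\<eta> \<in> forms L q.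
           pairing \<eta> R = (\<lambda>x. lie_fun L V (pairing \<eta> P) x - pairing (lie_form L V \<eta>) P x)))"


section \<open>The Schouten-Nijenhuis bracket\<close>

definition graded_bracket ::
  "int \<Rightarrow> int \<Rightarrow> (('m, 'e) form \<Rightarrow> ('m, 'e) form) \<Rightarrow> (('m, 'e) form \<Rightarrow> ('m, 'e) form) \<Rightarrow>
     ('m, 'e) form \<Rightarrow> ('m, 'e) form" where
  "graded_bracket d\<^sub>1 d\<^sub>2 F G = (\<lambda>\<eta> x vs. F (G \<eta>) x vs - (-1) powi (d\<^sub>1 * d\<^sub>2) * G (F \<eta>) x vs)"

text \<open>The degrees \<open>p\<close> of \<open>P\<close> and \<open>q\<close> of \<open>Q\<close> are explicit arguments.\<close>

definition sn_bracket ::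
  "('m, 'e) lie_algebroid \<Rightarrow> int \<Rightarrow> int \<Rightarrow>
     ('m, 'e) multivector_field \<Rightarrow> ('m, 'e) multivector_field \<Rightarrow> ('m, 'e) multivector_field" where
  "sn_bracket L p q P Q =
     (THE R. R \<in> multivector_fields L (p + q - 1) \<and>
        (\<forall>\<eta> \<in> all_forms L. int_prod R \<eta> =
           graded_bracket (1 - p) (- q)
             (graded_bracket (- p) 1 (int_prod P) (d_rho L)) (int_prod Q) \<eta>))"


section \<open>Exterior and interior products of decomposable multivectors\<close>

lemma alt_forms_prefix:
  assumes "a \<in> alt_forms E x"
  shows "(\<lambda>ws. a (vs @ ws)) \<in> alt_forms E x"
proof (cases "set vs \<subseteq> fibre E x")
  case True
  from assms have 1: "\<And>vs. \<not> set vs \<subseteq> fibre E x \<Longrightarrow> a vs = 0"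
    and 2: "\<And>us v w ws. set (us @ v # w # ws) \<subseteq> fibre E x \<Longrightarrow>
      a (us @ vadd E v w # ws) = a (us @ v # ws) + a (us @ w # ws)"
    and 3: "\<And>us c v ws. set (us @ v # ws) \<subseteq> fibre E x \<Longrightarrow>
      a (us @ vscale E c v # ws) = c * a (us @ v # ws)"
    and 4: "\<And>us v ws zs. a (us @ v # ws @ v # zs) = 0"
    unfolding alt_forms_def by blast+
  show ?thesis
    unfolding alt_forms_def
    using True 1 2[of "vs @ _"] 3[of "vs @ _"] 4[of "vs @ _"] by auto
next
  case False
  then have "(\<lambda>ws. a (vs @ ws)) = (\<lambda>ws. 0)"
    using assms by (auto simp: alt_forms_def)
  then show ?thesis
    by (simp add: alt_forms_def)
qed

lemma alt_forms_rev_suffix: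
  assumes "a \<in> alt_forms E x"
  shows "(\<lambda>vs. a (rev vs @ ws)) \<in> alt_forms E x"
proof (cases "set ws \<subseteq> fibre E x")
  case True
  from assms have 1: "\<And>vs. \<not> set vs \<subseteq> fibre E x \<Longrightarrow> a vs = 0"
    and 2: "\<And>us v w ws. set (us @ v # w # ws) \<subseteq> fibre E x \<Longrightarrow>
      a (us @ vadd E v w # ws) = a (us @ v # ws) + a (us @ w # ws)"
    and 3: "\<And>us c v ws. set (us @ v # ws) \<subseteq> fibre E x \<Longrightarrow>
      a (us @ vscale E c v # ws) = c * a (us @ v # ws)"
    and 4: "\<And>us v ws zs. a (us @ v # ws @ v # zs) = 0"
    unfolding alt_forms_def by blast+
  show ?thesis
    unfolding alt_forms_def
    using True 1 2[of "rev _" _ _ "rev _ @ ws"] 3[of "rev _" _ "rev _ @ ws"]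
      4[of "rev _" _ "rev _" "rev _ @ ws"] by auto
next
  case False
  then have "(\<lambda>vs. a (rev vs @ ws)) = (\<lambda>vs. 0)"
    using assms by (auto simp: alt_forms_def)
  then show ?thesis
    by (simp add: alt_forms_def)
qed

lemma wedge_mv_decomposable:
  "wedge_mv E (\<lambda>x. decomposable E x (map (\<lambda>V. V x) Vs)) (\<lambda>x. decomposable E x (map (\<lambda>V. V x) Ws)) =
     (\<lambda>x. decomposable E x (map (\<lambda>V. V x) (Vs @ Ws)))"
proof -
  have "(\<lambda>vs. a (vs @ ws)) \<in> alt_forms E x" if "a \<in> alt_forms E x" for a ws and x
  proof (cases "set ws \<subseteq> fibre E x")
    case True
    with that show ?thesis
      by (auto simp: alt_forms_def)
  next
    case False
    with that have "(\<lambda>vs. a (vs @ ws)) = (\<lambda>vs. 0)"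
      by (auto simp: alt_forms_def)
    then show ?thesis
      by (simp add: alt_forms_def)
  qed
  then show ?thesis
    by (simp add: wedge_mv_def decomposable_def alt_forms_prefix fun_eq_iff)
qed

lemma int_prod_decomposable:
  assumes "\<eta> \<in> all_forms E"
  shows "int_prod (\<lambda>x. decomposable E x (map (\<lambda>V. V x) Vs)) \<eta> = foldr insert_vector Vs \<eta>"
proof -
  have "foldr insert_vector Vs \<eta> x ws = \<eta> x (rev (map (\<lambda>V. V x) Vs) @ ws)" for x ws
    by (induction Vs arbitrary: ws) (simp_all add: insert_vector_def)
  moreover have "\<eta> x \<in> alt_forms E x" for x
    using assms by (auto simp: all_forms_def)
  ultimately show ?thesis
    by (simp add: int_prod_def decomposable_def alt_forms_rev_suffix fun_eq_iff)
qed

end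

(*
  Everything is deduced from a characterization of interior products: an operator G on forms is
  i(R) for a (unique) multivector field R of degree m iff it is linear over the smooth functions,
  has degree -m and graded-commutes with i(V) for every section V. Cartan's identities
  [L(V), i(W)] = i({V,W}), [L(V), f] = L(V)f, [[d,f], i(V)] = L(V)f, [[d,f], g] = 0 and the graded
  Jacobi identity of commutators show that [[i(P),d],i(Q)] is of this kind, so that the bracket
  exists. Its properties are then identities between graded commutators; the graded Jacobi
  identity uses d o d = 0. An operator of positive degree that graded-commutes with all i(V)
  vanishes, which yields d o d = 0 and the other identities that no longer involve functions.
  That d is well defined follows from the recursion i(V) d = L(V) - d i(V) on lists of sections.
*)
theory Submission
  imports Defs
begin

section \<open>Calculus of smooth functions\<close>

text \<open>The operators act on global forms and are tested on global sections, whereas forms and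
  multivector fields are specified by components in local frames. Bump functions bridge the two: a
  local frame section or a local basis form becomes global after multiplication by a bump function
  b, and so does a local coefficient. Hence expansions are proved for b b V or b b \<eta>, with b =
  1 at the point of interest. Commutators with d alone are not linear over functions. The second
  commutator repairs this because [i(P), L(V)] and [i(P), [d, f]] are interior products again, and
  therefore commute with i(Q). That the anchor turns brackets into commutators is not an axiom. It
  is extracted from the Jacobi identity and the Leibniz rule by means of a section that is nonzero
  at the given point; rank 0, where there is none, is treated apart. A form carries components of
  all degrees at once. The degree of an operator is therefore a statement about vanishing
  components, and the degrees in a graded bracket are mere labels fixing signs.\<close>

primrec cont_diff :: "nat \<Rightarrow> nat \<Rightarrow> (nat \<Rightarrow> real) set \<Rightarrow> ((nat \<Rightarrow> real) \<Rightarrow> real) \<Rightarrow> bool" where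
  "cont_diff n 0 U f = continuous_on U f"
| "cont_diff n (Suc k) U f = (continuous_on U f \<and>
     (\<forall>i<n. (\<forall>x\<in>U. (\<lambda>t. f (x(i := t))) differentiable at (x i)) \<and> cont_diff n k U (partial_deriv i f)))"

lemma cont_diff_continuous: "cont_diff n k U f \<Longrightarrow> continuous_on U f"
  by (cases k) auto

lemma cont_diff_SucD: "cont_diff n (Suc k) U f \<Longrightarrow> cont_diff n k U f"
  by (induction k arbitrary: f) (auto dest: cont_diff_continuous)

text \<open>Counting the order of differentiability turns closure under products and compositions
  into an induction on k over arbitrary functions, where the index lists of \<open>smooth_on\<close>
  would demand a Leibniz formula. Since \<open>foldr\<close> applies the last index first, removing
  an index from the end of a list matches one unfolding of \<open>cont_diff\<close>.\<close>

lemma smooth_on_iff_cont_diff: "smooth_on n U f \<longleftrightarrow> (\<forall>k. cont_diff n k U f)"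
proof (intro iffI allI)
  fix k assume "smooth_on n U f"
  then show "cont_diff n k U f"
  proof (induction k arbitrary: f)
    case 0
    then have "continuous_on U (foldr partial_deriv [] f)"
      unfolding smooth_on_def by (metis empty_set empty_subsetI)
    then show ?case by simp
  next
    case (Suc k)
    have c: "continuous_on U f" and d: "\<forall>i<n. \<forall>x\<in>U. (\<lambda>t. f (x(i := t))) differentiable at (x i)"
      using Suc.prems unfolding smooth_on_def by (auto dest!: spec[of _ "[]"])
    have "smooth_on n U (partial_deriv i f)" if "i < n" for i
      unfolding smooth_on_def
    proof (intro allI impI)
      fix js assume "set js \<subseteq> {..<n}"
      then have "set (js @ [i]) \<subseteq> {..<n}" using that by auto
      with Suc.prems[unfolded smooth_on_def, rule_format, of "js @ [i]"]
      show "continuous_on U (foldr partial_deriv js (partial_deriv i f)) \<and>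
        (\<forall>ia<n. \<forall>x\<in>U. (\<lambda>t. foldr partial_deriv js (partial_deriv i f) (x(ia := t))) differentiable at (x ia))"
        by simp
    qed
    with Suc.IH c d show ?case by simp
  qed
next
  assume *: "\<forall>k. cont_diff n k U f"
  have "cont_diff n k U (foldr partial_deriv js f)"
    if "cont_diff n (k + length js) U f" "set js \<subseteq> {..<n}" for js k
    using that by (induction js arbitrary: f rule: rev_induct) auto
  with * have "cont_diff n k U (foldr partial_deriv js f)" if "set js \<subseteq> {..<n}" for js k
    using that by blast
  then show "smooth_on n U f"
    unfolding smooth_on_def by (metis cont_diff.simps(2) cont_diff_continuous)
qed

text \<open>Partial derivatives follow the lines x(i := t), which for i < n stay in the subspace
  \<open>Euclidean_space n\<close>. Relative openness of U is therefore enough for the values on U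
  to determine the derivatives at its points.\<close>

lemma openin_Euclidean_eventually:
  assumes "openin (Euclidean_space n) U" "x \<in> U" "i < n"
  shows "\<forall>\<^sub>F t in nhds (x i). x(i := t) \<in> U"
proof -
  obtain T where T: "open T" "U = T \<inter> {x. \<forall>i\<ge>n. x i = 0}"
    using assms(1) unfolding Euclidean_space_def euclidean_product_topology openin_subtopology
    by auto
  have c: "continuous_on UNIV (\<lambda>t. x(i := t))"
  proof (intro continuous_on_coordinatewise_then_product)
    show "continuous_on UNIV (\<lambda>t. (x(i := t)) j)" for j
      by (cases "j = i") (auto intro!: continuous_intros)
  qed
  then have "open ((\<lambda>t. x(i := t)) -` T)"
    using T(1) by (simp add: open_vimage)
  moreover have "x i \<in> (\<lambda>t. x(i := t)) -` T"
    using assms T by auto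
  ultimately have "\<forall>\<^sub>F t in nhds (x i). t \<in> (\<lambda>t. x(i := t)) -` T"
    by (rule eventually_nhds_in_open)
  then show ?thesis
    using assms(2,3) unfolding T(2) by (auto elim!: eventually_mono)
qed

lemma differentiable_slice_cong:
  assumes "openin (Euclidean_space n) U" "x \<in> U" "i < n" "\<And>y. y \<in> U \<Longrightarrow> f y = g y"
  shows "((\<lambda>t. f (x(i := t))) has_real_derivative D) (at (x i)) \<longleftrightarrow>
         ((\<lambda>t. g (x(i := t))) has_real_derivative D) (at (x i))"
  using openin_Euclidean_eventually[OF assms(1-3)] assms(4)
  by (intro DERIV_cong_ev) (auto elim!: eventually_mono)

lemma cont_diff_cong:
  assumes "openin (Euclidean_space n) U" "\<And>y. y \<in> U \<Longrightarrow> f y = g y" "cont_diff n k U f"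
  shows "cont_diff n k U g"
  using assms(2,3)
proof (induction k arbitrary: f g)
  case 0
  then show ?case using continuous_on_cong by (metis cont_diff.simps(1))
next
  case (Suc k)
  have s: "((\<lambda>t. f (x(i := t))) has_real_derivative D) (at (x i)) \<longleftrightarrow>
      ((\<lambda>t. g (x(i := t))) has_real_derivative D) (at (x i))" if "x \<in> U" "i < n" for x i D
    using differentiable_slice_cong[OF assms(1) that, of f g] Suc.prems(1) by blast
  have "partial_deriv i f y = partial_deriv i g y" if "y \<in> U" "i < n" for i y
    unfolding partial_deriv_def deriv_def using s[OF that] by simp
  moreover have "continuous_on U g"
    using Suc.prems continuous_on_cong by (metis cont_diff.simps(2))
  moreover have "(\<lambda>t. g (x(i := t))) differentiable at (x i)" if "x \<in> U" "i < n" for x i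
    using Suc.prems(2) s[OF that] that unfolding cont_diff.simps real_differentiable_def by blast
  moreover have "cont_diff n k U (partial_deriv i g)" if "i < n" for i
    using Suc.IH[of "partial_deriv i f" "partial_deriv i g"] Suc.prems(2) calculation(1) that by simp
  ultimately show ?case
    by simp
qed

text \<open>Any formula g for the partial derivatives that is valid on U may replace
  \<open>partial_deriv\<close>. The two are known to agree on U only, so congruence on U transfers
  the differentiability.\<close>

lemma cont_diff_SucI:
  assumes "openin (Euclidean_space n) U" "continuous_on U f"
    "\<And>i x. i < n \<Longrightarrow> x \<in> U \<Longrightarrow> ((\<lambda>t. f (x(i := t))) has_real_derivative g i x) (at (x i))"
    "\<And>i. i < n \<Longrightarrow> cont_diff n k U (g i)"
  shows "cont_diff n (Suc k) U f"
proof -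
  have "partial_deriv i f x = g i x" if "i < n" "x \<in> U" for i x
    unfolding partial_deriv_def using assms(3)[OF that] by (rule DERIV_imp_deriv)
  then have "cont_diff n k U (partial_deriv i f)" if "i < n" for i
    using assms(4)[OF that] cont_diff_cong[OF assms(1)] that by metis
  with assms show ?thesis
    by (auto simp: real_differentiable_def)
qed

lemma cont_diff_Suc_deriv:
  assumes "cont_diff n (Suc k) U f" "i < n" "x \<in> U"
  shows "((\<lambda>t. f (x(i := t))) has_real_derivative partial_deriv i f x) (at (x i))"
  using assms unfolding partial_deriv_def by (auto intro!: DERIV_deriv_iff_real_differentiable[THEN iffD2])

lemma cont_diff_const: "openin (Euclidean_space n) U \<Longrightarrow> cont_diff n k U (\<lambda>x. c)"
proof (induction k arbitrary: c)
  case (Suc k)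
  show ?case
    by (rule cont_diff_SucI[where g = "\<lambda>i x. 0"]) (use Suc in \<open>auto intro!: continuous_intros\<close>)
qed auto

lemma cont_diff_add:
  "openin (Euclidean_space n) U \<Longrightarrow> cont_diff n k U f \<Longrightarrow> cont_diff n k U g \<Longrightarrow>
    cont_diff n k U (\<lambda>x. f x + g x)"
proof (induction k arbitrary: f g)
  case (Suc k)
  show ?case
    by (rule cont_diff_SucI[where g = "\<lambda>i x. partial_deriv i f x + partial_deriv i g x"])
       (use Suc cont_diff_Suc_deriv[OF Suc.prems(2)] cont_diff_Suc_deriv[OF Suc.prems(3)]
         in \<open>auto intro!: continuous_intros derivative_eq_intros\<close>)
qed (auto intro!: continuous_intros)

lemma cont_diff_mult:
  "openin (Euclidean_space n) U \<Longrightarrow> cont_diff n k U f \<Longrightarrow> cont_diff n k U g \<Longrightarrow>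
    cont_diff n k U (\<lambda>x. f x * g x)"
proof (induction k arbitrary: f g)
  case (Suc k)
  show ?case
  proof (rule cont_diff_SucI[where g = "\<lambda>i x. partial_deriv i f x * g x + partial_deriv i g x * f x"])
    show "cont_diff n k U (\<lambda>x. partial_deriv i f x * g x + partial_deriv i g x * f x)" if "i < n" for i
      using Suc that cont_diff_SucD[OF Suc.prems(2)] cont_diff_SucD[OF Suc.prems(3)]
      by (intro cont_diff_add) auto
    show "((\<lambda>t. f (x(i := t)) * g (x(i := t))) has_real_derivative
        partial_deriv i f x * g x + partial_deriv i g x * f x) (at (x i))" if "i < n" "x \<in> U" for i x
      using DERIV_mult[OF cont_diff_Suc_deriv[OF Suc.prems(2) that] cont_diff_Suc_deriv[OF Suc.prems(3) that]]
      by (simp add: fun_upd_def)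
  qed (use Suc in \<open>auto intro!: continuous_intros\<close>)
qed (auto intro!: continuous_intros)

text \<open>The sequence H lists h and its derivatives explicitly. An induction can then run over
  all H m at once, and the flat function supplies its derivatives by formula.\<close>

definition smooth_real :: "(real \<Rightarrow> real) \<Rightarrow> bool" where
  "smooth_real h \<longleftrightarrow> (\<exists>H :: nat \<Rightarrow> real \<Rightarrow> real. H 0 = h \<and>
     (\<forall>m t. (H m has_real_derivative H (Suc m) t) (at t)))"

lemma cont_diff_compose:
  assumes "smooth_real h" "openin (Euclidean_space n) U" "cont_diff n k U f"
  shows "cont_diff n k U (\<lambda>x. h (f x))"
proof -
  obtain H where H: "H 0 = h" "\<And>m t. (H m has_real_derivative H (Suc m) t) (at t)"
    using assms(1) unfolding smooth_real_def by auto
  have c: "continuous_on S (H m)" for S m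
    by (rule continuous_on_subset[of UNIV]) (auto intro!: continuous_at_imp_continuous_on DERIV_isCont[OF H(2)])
  \<comment> \<open>Differentiating H m o f produces H (Suc m) o f, so m is generalised in the
    induction on k.\<close>
  have "cont_diff n k U (\<lambda>x. H m (f x))" for m
    using assms(3)
  proof (induction k arbitrary: m)
    case 0
    then show ?case using continuous_on_compose2[OF c[of UNIV]] by auto
  next
    case (Suc k)
    show ?case
    proof (rule cont_diff_SucI[where g = "\<lambda>i x. H (Suc m) (f x) * partial_deriv i f x"])
      show "continuous_on U (\<lambda>x. H m (f x))"
        using Suc.prems continuous_on_compose2[OF c[of UNIV]] by auto
      show "((\<lambda>t. H m (f (x(i := t)))) has_real_derivative H (Suc m) (f x) * partial_deriv i f x) (at (x i))"
        if "i < n" "x \<in> U" for i x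
        by (rule DERIV_chain2[OF _ cont_diff_Suc_deriv[OF Suc.prems that]]) (simp add: H(2))
      show "cont_diff n k U (\<lambda>x. H (Suc m) (f x) * partial_deriv i f x)" if "i < n" for i
        using Suc.prems Suc.IH[OF cont_diff_SucD[OF Suc.prems]] that assms(2)
        by (intro cont_diff_mult) auto
    qed fact
  qed
  from this[of 0] show ?thesis by (simp add: H)
qed

lemmas smooth_on_const = cont_diff_const[THEN smooth_on_iff_cont_diff[THEN iffD2, OF allI]]

lemma smooth_on_add:
  "openin (Euclidean_space n) U \<Longrightarrow> smooth_on n U f \<Longrightarrow> smooth_on n U g \<Longrightarrow> smooth_on n U (\<lambda>x. f x + g x)"
  by (simp add: smooth_on_iff_cont_diff cont_diff_add)

lemma smooth_on_mult:
  "openin (Euclidean_space n) U \<Longrightarrow> smooth_on n U f \<Longrightarrow> smooth_on n U g \<Longrightarrow> smooth_on n U (\<lambda>x. f x * g x)"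
  by (simp add: smooth_on_iff_cont_diff cont_diff_mult)

lemma smooth_on_compose:
  "smooth_real h \<Longrightarrow> openin (Euclidean_space n) U \<Longrightarrow> smooth_on n U f \<Longrightarrow> smooth_on n U (\<lambda>x. h (f x))"
  by (simp add: smooth_on_iff_cont_diff cont_diff_compose)

lemma smooth_on_cong:
  "openin (Euclidean_space n) U \<Longrightarrow> smooth_on n U f \<Longrightarrow> (\<And>y. y \<in> U \<Longrightarrow> f y = g y) \<Longrightarrow> smooth_on n U g"
  using cont_diff_cong[of n U f g] by (simp add: smooth_on_iff_cont_diff)

lemma smooth_on_subset: "smooth_on n U f \<Longrightarrow> V \<subseteq> U \<Longrightarrow> smooth_on n V f"
  unfolding smooth_on_def using continuous_on_subset by blast

lemma smooth_on_local:
  assumes "\<And>x. x \<in> U \<Longrightarrow> \<exists>V. openin (Euclidean_space n) V \<and> x \<in> V \<and> smooth_on n (U \<inter> V) f"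
    "openin (Euclidean_space n) U"
  shows "smooth_on n U f"
  unfolding smooth_on_def
proof (intro allI impI conjI ballI)
  fix js assume js: "set js \<subseteq> {..<n}"
  show "continuous_on U (foldr partial_deriv js f)"
    unfolding continuous_on_eq_continuous_within
  proof
    fix x assume x: "x \<in> U"
    then obtain V where V: "openin (Euclidean_space n) V" "x \<in> V" "smooth_on n (U \<inter> V) f"
      using assms(1) by blast
    then have c: "continuous_on (U \<inter> V) (foldr partial_deriv js f)"
      using js by (auto simp: smooth_on_def)
    obtain T where T: "open T" "V = T \<inter> {x. \<forall>i\<ge>n. x i = 0}"
      using V(1) unfolding Euclidean_space_def euclidean_product_topology openin_subtopology by auto
    \<comment> \<open>As U lies in the subspace, intersecting it with the relatively open V is the
      same as intersecting it with T, which is a neighbourhood of x in the whole function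
      space.\<close>
    have "U \<subseteq> {x. \<forall>i\<ge>n. x i = 0}"
      using openin_subset[OF assms(2)] by (simp add: topspace_Euclidean_space)
    then have "U \<inter> V = U \<inter> T" using T by auto
    with c x V(2) have "continuous (at x within (U \<inter> T)) (foldr partial_deriv js f)"
      by (metis IntI continuous_on_eq_continuous_within)
    then show "continuous (at x within U) (foldr partial_deriv js f)"
      using T V(2) at_within_nhd[of x T "U \<inter> T" U] unfolding continuous_within by auto
  qed
next
  fix js i x assume js: "set js \<subseteq> {..<n}" "i < n" and x: "x \<in> U"
  then obtain V where V: "openin (Euclidean_space n) V" "x \<in> V" "smooth_on n (U \<inter> V) f"
    using assms(1) by blast
  then show "(\<lambda>t. foldr partial_deriv js f (x(i := t))) differentiable at (x i)"
    using js x by (auto simp: smooth_on_def)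
qed

text \<open>The flat function \<open>t \<mapsto> exp (- 1/t)\<close>; its derivatives stay in the family with a polynomial factor in \<open>1/t\<close>.\<close>

definition flat_exp :: "real poly \<Rightarrow> real \<Rightarrow> real" where
  "flat_exp p t = (if t > 0 then poly p (1 / t) * exp (- (1 / t)) else 0)"

lemma poly_exp_tendsto_0: "((\<lambda>x::real. poly p x * exp (- x)) \<longlongrightarrow> 0) at_top"
proof -
  have "((\<lambda>x::real. \<Sum>i\<le>degree p. coeff p i * (x ^ i / exp x)) \<longlongrightarrow> (\<Sum>i\<le>degree p. coeff p i * 0)) at_top"
    by (intro tendsto_intros tendsto_power_div_exp_0)
  then show ?thesis
    by (simp add: poly_altdef sum_distrib_right sum_divide_distrib exp_minus field_simps)
qed

text \<open>With u = 1/t one has du/dt = -u^2, so p(u) exp(-u) has derivative u^2 (p(u) - p'(u))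
  exp(-u); the polynomial \<open>[:0, 0, 1:]\<close> is X^2. Only t = 0 needs a limit.\<close>

lemma flat_exp_deriv:
  "(flat_exp p has_real_derivative flat_exp ([:0, 0, 1:] * (p - pderiv p)) t) (at t)"
proof -
  consider "t > 0" | "t < 0" | "t = 0" by linarith
  then show ?thesis
  proof cases
    case 1
    have "((\<lambda>t. poly p (1 / t) * exp (- (1 / t))) has_real_derivative
        flat_exp ([:0, 0, 1:] * (p - pderiv p)) t) (at t)"
      using 1 by (auto intro!: derivative_eq_intros DERIV_chain2[OF poly_DERIV]
          simp: flat_exp_def field_simps power2_eq_square)
    then show ?thesis
      by (rule has_field_derivative_transform_within_open[where S = "{0<..}"])
         (use 1 in \<open>auto simp: flat_exp_def\<close>)
  next
    case 2
    have "((\<lambda>t. 0) has_real_derivative flat_exp ([:0, 0, 1:] * (p - pderiv p)) t) (at t)"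
      using 2 by (auto simp: flat_exp_def)
    then show ?thesis
      by (rule has_field_derivative_transform_within_open[where S = "{..<0}"])
         (use 2 in \<open>auto simp: flat_exp_def\<close>)
  next
    case 3
    \<comment> \<open>\<open>pCons 0 p\<close> is X p: for y > 0 the quotient
      \<open>flat_exp p y / y\<close> equals u p(u) exp(-u) with u = 1/y, and u tends to
      infinity.\<close>
    have "((\<lambda>y. poly (pCons 0 p) (inverse y) * exp (- inverse y)) \<longlongrightarrow> 0) (at_right 0)"
      by (rule filterlim_compose[OF poly_exp_tendsto_0 filterlim_inverse_at_top_right])
    then have "((\<lambda>y. flat_exp p y / y) \<longlongrightarrow> 0) (at_right 0)"
      by (rule Lim_transform_eventually)
         (auto simp: flat_exp_def eventually_at_right_less field_simps intro!: eventually_at_rightI[of 0 1])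
    moreover have "((\<lambda>y. flat_exp p y / y) \<longlongrightarrow> 0) (at_left 0)"
      by (rule Lim_transform_eventually[OF tendsto_const])
         (auto simp: flat_exp_def intro!: eventually_at_leftI[of "-1" 0])
    ultimately have "((\<lambda>y. flat_exp p y / y) \<longlongrightarrow> 0) (at 0)"
      by (simp add: filterlim_split_at)
    then show ?thesis
      using 3 by (simp add: has_field_derivative_iff flat_exp_def)
  qed
qed

lemma smooth_real_flat_exp: "smooth_real (flat_exp p)"
  unfolding smooth_real_def
  by (intro exI[of _ "\<lambda>m. flat_exp (((\<lambda>p. [:0, 0, 1:] * (p - pderiv p)) ^^ m) p)"] conjI allI)
     (use flat_exp_deriv in auto)

locale manifold =
  fixes M :: "('m :: {t2_space, second_countable_topology}) manifold"
  assumes smooth_manifold: "smooth_manifold M"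
begin

lemma charts_cover: obtains U \<phi> where "(U, \<phi>) \<in> charts M" "x \<in> U"
  using smooth_manifold unfolding smooth_manifold_def by blast

lemma chartD:
  assumes "(U, \<phi>) \<in> charts M"
  shows "open U" "openin (Euclidean_space (man_dim M)) (\<phi> ` U)"
    "homeomorphic_map (top_of_set U) (subtopology (Euclidean_space (man_dim M)) (\<phi> ` U)) \<phi>"
    "inj_on \<phi> U" "j < man_dim M \<Longrightarrow> smooth_fun_on M U (\<lambda>x. \<phi> x j)"
proof -
  show "open U" "openin (Euclidean_space (man_dim M)) (\<phi> ` U)"
    and h: "homeomorphic_map (top_of_set U) (subtopology (Euclidean_space (man_dim M)) (\<phi> ` U)) \<phi>"
    and "j < man_dim M \<Longrightarrow> smooth_fun_on M U (\<lambda>x. \<phi> x j)"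
    using smooth_manifold assms unfolding smooth_manifold_def by blast+
  show "inj_on \<phi> U"
    using homeomorphic_imp_injective_map[OF h] by simp
qed

lemma openin_chart_image:
  assumes "(U, \<phi>) \<in> charts M" "open S"
  shows "openin (Euclidean_space (man_dim M)) (\<phi> ` (U \<inter> S))"
proof -
  have "openin (subtopology (Euclidean_space (man_dim M)) (\<phi> ` U)) (\<phi> ` (U \<inter> S))"
    using homeomorphic_imp_open_map[OF chartD(3)[OF assms(1)]] assms(2)
    unfolding open_map_def by (simp add: openin_open_Int)
  then show ?thesis
    using chartD(2)[OF assms(1)] openin_trans_full by blast
qed

lemma chart_continuous_inv:
  assumes "(U, \<phi>) \<in> charts M"
  shows "continuous_on (\<phi> ` U) (inv_into U \<phi>)"
proof -
  have sub: "\<phi> ` U \<subseteq> topspace (Euclidean_space (man_dim M))"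
    using chartD(2)[OF assms] openin_subset by blast
  have *: "subtopology (Euclidean_space (man_dim M)) (\<phi> ` U) = top_of_set (\<phi> ` U)"
    using sub unfolding Euclidean_space_def euclidean_product_topology subtopology_subtopology
    by (simp add: topspace_Euclidean_space Int_absorb1)
  have "\<exists>g. homeomorphic_maps (top_of_set U) (top_of_set (\<phi> ` U)) \<phi> g"
    using chartD(3)[OF assms] by (simp add: homeomorphic_map_maps *)
  then obtain g where g: "continuous_on (\<phi> ` U) g" "\<forall>x\<in>U. g (\<phi> x) = x"
    by (auto simp: homeomorphic_maps_def)
  have "g z = inv_into U \<phi> z" if "z \<in> \<phi> ` U" for z
    using that g(2) chartD(4)[OF assms] by auto
  with g(1) show ?thesis
    using continuous_on_cong by metis
qed

lemma smooth_fun_onD: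
  "smooth_fun_on M S f \<Longrightarrow> (U, \<phi>) \<in> charts M \<Longrightarrow>
    smooth_on (man_dim M) (\<phi> ` (U \<inter> S)) (\<lambda>z. f (inv_into U \<phi> z))"
  unfolding smooth_fun_on_def by blast

lemma smooth_fun_onI:
  "(\<And>U \<phi>. (U, \<phi>) \<in> charts M \<Longrightarrow> smooth_on (man_dim M) (\<phi> ` (U \<inter> S)) (\<lambda>z. f (inv_into U \<phi> z))) \<Longrightarrow>
    smooth_fun_on M S f"
  unfolding smooth_fun_on_def by blast

lemma smooth_fun_on_const: "open S \<Longrightarrow> smooth_fun_on M S (\<lambda>x. c)"
  by (rule smooth_fun_onI, rule smooth_on_const, rule openin_chart_image)

lemma smooth_fun_on_add:
  "open S \<Longrightarrow> smooth_fun_on M S f \<Longrightarrow> smooth_fun_on M S g \<Longrightarrow> smooth_fun_on M S (\<lambda>x. f x + g x)"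
  by (rule smooth_fun_onI, rule smooth_on_add) (auto intro: openin_chart_image dest: smooth_fun_onD)

lemma smooth_fun_on_mult:
  "open S \<Longrightarrow> smooth_fun_on M S f \<Longrightarrow> smooth_fun_on M S g \<Longrightarrow> smooth_fun_on M S (\<lambda>x. f x * g x)"
  by (rule smooth_fun_onI, rule smooth_on_mult) (auto intro: openin_chart_image dest: smooth_fun_onD)

lemma smooth_fun_on_compose:
  "smooth_real h \<Longrightarrow> open S \<Longrightarrow> smooth_fun_on M S f \<Longrightarrow> smooth_fun_on M S (\<lambda>x. h (f x))"
  by (rule smooth_fun_onI, rule smooth_on_compose) (auto intro: openin_chart_image dest: smooth_fun_onD)

lemma smooth_fun_on_subset: "smooth_fun_on M S f \<Longrightarrow> T \<subseteq> S \<Longrightarrow> smooth_fun_on M T f"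
  by (rule smooth_fun_onI, rule smooth_on_subset, erule (1) smooth_fun_onD) auto

lemma smooth_fun_on_cong:
  assumes "open S" "smooth_fun_on M S f" "\<And>x. x \<in> S \<Longrightarrow> f x = g x"
  shows "smooth_fun_on M S g"
  unfolding smooth_fun_on_def
proof safe
  fix U \<phi> assume U: "(U, \<phi>) \<in> charts M"
  have "f (inv_into U \<phi> z) = g (inv_into U \<phi> z)" if "z \<in> \<phi> ` (U \<inter> S)" for z
    using that assms(3) chartD(4)[OF U] by auto
  moreover have "smooth_on (man_dim M) (\<phi> ` (U \<inter> S)) (\<lambda>z. f (inv_into U \<phi> z))"
    using assms(2) U unfolding smooth_fun_on_def by auto
  ultimately show "smooth_on (man_dim M) (\<phi> ` (U \<inter> S)) (\<lambda>z. g (inv_into U \<phi> z))"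
    using smooth_on_cong[OF openin_chart_image[OF U assms(1)]] by simp
qed

lemma smooth_fun_on_local:
  assumes "open S" "\<And>x. x \<in> S \<Longrightarrow> \<exists>T. open T \<and> x \<in> T \<and> smooth_fun_on M (S \<inter> T) f"
  shows "smooth_fun_on M S f"
  unfolding smooth_fun_on_def
proof safe
  fix U \<phi> assume U: "(U, \<phi>) \<in> charts M"
  show "smooth_on (man_dim M) (\<phi> ` (U \<inter> S)) (\<lambda>z. f (inv_into U \<phi> z))"
  proof (rule smooth_on_local[OF _ openin_chart_image[OF U assms(1)]])
    fix z assume "z \<in> \<phi> ` (U \<inter> S)"
    then obtain x where x: "x \<in> U" "x \<in> S" "z = \<phi> x" by auto
    then obtain T where T: "open T" "x \<in> T" "smooth_fun_on M (S \<inter> T) f"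
      using assms(2) by blast
    have "\<phi> ` (U \<inter> S) \<inter> \<phi> ` (U \<inter> T) = \<phi> ` (U \<inter> (S \<inter> T))"
      using inj_on_image_Int[OF chartD(4)[OF U], of "U \<inter> S" "U \<inter> T"] by (simp add: Int_ac)
    with T x U show "\<exists>V. openin (Euclidean_space (man_dim M)) V \<and> z \<in> V \<and>
        smooth_on (man_dim M) (\<phi> ` (U \<inter> S) \<inter> V) (\<lambda>z. f (inv_into U \<phi> z))"
      by (intro exI[of _ "\<phi> ` (U \<inter> T)"]) (auto simp: openin_chart_image smooth_fun_on_def)
  qed
qed

lemma smooth_fun_on_sum:
  "open S \<Longrightarrow> (\<And>i. i \<in> I \<Longrightarrow> smooth_fun_on M S (f i)) \<Longrightarrow> smooth_fun_on M S (\<lambda>x. \<Sum>i\<in>I. f i x)"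
  by (induction I rule: infinite_finite_induct) (auto intro: smooth_fun_on_add smooth_fun_on_const)

lemma smooth_fun_on_diff:
  assumes "open S" "smooth_fun_on M S f" "smooth_fun_on M S g"
  shows "smooth_fun_on M S (\<lambda>x. f x - g x)"
  using smooth_fun_on_add[OF assms(1,2) smooth_fun_on_mult[OF assms(1) smooth_fun_on_const[OF assms(1), of "-1"] assms(3)]]
  by simp

lemma chart_continuous:
  assumes "(U, \<phi>) \<in> charts M"
  shows "continuous_on U \<phi>"
proof -
  have "continuous_map (top_of_set U) (subtopology (Euclidean_space (man_dim M)) (\<phi> ` U)) \<phi>"
    using chartD(3)[OF assms] homeomorphic_imp_continuous_map by blast
  then show ?thesis
    unfolding Euclidean_space_def euclidean_product_topology subtopology_subtopology
    by (simp add: continuous_map_in_subtopology)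
qed

text \<open>The function is built in a chart from the squared distance q to the image of the point:
  w(q) equals 1 for q \<le> c/2 and is at most 0 for q \<ge> c, and the flat function f gives
  f(w(q)) / f(1). Outside the chart it is extended by 0, which is smooth since the ball q \<le> c
  corresponds to a closed set K of the manifold.\<close>

lemma bump_function:
  assumes "open W" "x\<^sub>0 \<in> W"
  obtains b N T where "smooth_fun_on M UNIV b" "open N" "N \<union> W = UNIV" "\<And>x. x \<in> N \<Longrightarrow> b x = 0"
    "open T" "x\<^sub>0 \<in> T" "\<And>x. x \<in> T \<Longrightarrow> b x = 1"
proof -
  obtain U \<phi> where U: "(U, \<phi>) \<in> charts M" "x\<^sub>0 \<in> U"
    using charts_cover by blast
  define n where "n = man_dim M"
  define z\<^sub>0 where "z\<^sub>0 = \<phi> x\<^sub>0"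
  define q where "q z = (\<Sum>i<n. (z i - z\<^sub>0 i) * (z i - z\<^sub>0 i))" for z :: "nat \<Rightarrow> real"
  have inj: "inj_on \<phi> U" and oU: "open U" using chartD[OF U(1)] by auto
  have Z: "openin (Euclidean_space n) (\<phi> ` (U \<inter> W))"
    using openin_chart_image[OF U(1) assms(1)] n_def by simp
  then obtain G where G: "open G" "\<phi> ` (U \<inter> W) = G \<inter> {x. \<forall>i\<ge>n. x i = 0}"
    unfolding Euclidean_space_def euclidean_product_topology openin_subtopology by auto
  have zZ: "z\<^sub>0 \<in> \<phi> ` (U \<inter> W)" using U assms z\<^sub>0_def by auto
  have "openin (powertop_real UNIV) G" "z\<^sub>0 \<in> G"
    using G zZ by (auto simp: euclidean_product_topology)
  from product_topology_open_contains_basis[OF this] obtain X where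
    X: "z\<^sub>0 \<in> Pi\<^sub>E UNIV X" "\<And>i. open (X i)" "Pi\<^sub>E UNIV X \<subseteq> G"
    by auto
  have "\<forall>\<^sub>F e in at_right 0. \<forall>y. \<bar>y - z\<^sub>0 i\<bar> < e \<longrightarrow> y \<in> X i" for i
  proof -
    have "z\<^sub>0 i \<in> X i" using X(1) by auto
    then obtain e where "e > 0" "\<And>y. \<bar>y - z\<^sub>0 i\<bar> < e \<Longrightarrow> y \<in> X i"
      using X(2)[of i] unfolding open_real_def open_dist dist_real_def by (metis open_dist dist_real_def X(2))
    then show ?thesis
      by (intro eventually_at_rightI[of 0 e]) auto
  qed
  then have "\<forall>\<^sub>F e in at_right 0. \<forall>i\<in>{..<n}. \<forall>y. \<bar>y - z\<^sub>0 i\<bar> < e \<longrightarrow> y \<in> X i"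
    by (intro eventually_ball_finite) auto
  then have "\<forall>\<^sub>F e in at_right (0::real). e > 0 \<and> (\<forall>i\<in>{..<n}. \<forall>y. \<bar>y - z\<^sub>0 i\<bar> < e \<longrightarrow> y \<in> X i)"
    by (intro eventually_conj eventually_at_right_less)
  then obtain e :: real where e: "e > 0" "\<And>i y. i < n \<Longrightarrow> \<bar>y - z\<^sub>0 i\<bar> < e \<Longrightarrow> y \<in> X i"
    by (fastforce dest: eventually_happens)
  \<comment> \<open>Any positive c < e^2 keeps each coordinate of the ball q \<le> c within e of the
    centre. A radius e exists because only the finitely many coordinates below n restrict it; the
    others are 0 on the subspace.\<close>
  define c where "c = e * e / 2"
  have c: "c > 0" "c < e * e" using e by (auto simp: c_def)
  have near: "\<bar>z i - z\<^sub>0 i\<bar> < e" if "q z \<le> c" "i < n" for z i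
  proof -
    have "(z i - z\<^sub>0 i) * (z i - z\<^sub>0 i) \<le> q z"
      unfolding q_def using that(2) by (intro member_le_sum) auto
    with that c have "(z i - z\<^sub>0 i)\<^sup>2 < e\<^sup>2" by (simp add: power2_eq_square)
    then show ?thesis
      using e abs_le_square_iff[of e "z i - z\<^sub>0 i"] by force
  qed
  define B where "B = {z. (\<forall>i\<ge>n. z i = 0) \<and> q z \<le> c}"
  have BZ: "B \<subseteq> \<phi> ` (U \<inter> W)"
  proof
    fix z assume z: "z \<in> B"
    have X0: "z\<^sub>0 i \<in> X i" for i using X(1) by auto
    have "z i \<in> X i" for i
      using z X0[of i] near[of z i] e(2)[of i "z i"] X(1) zZ G by (cases "i < n") (auto simp: B_def)
    then show "z \<in> \<phi> ` (U \<inter> W)"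
      unfolding G using X z by (auto simp: B_def)
  qed
  have "continuous_on UNIV q"
    unfolding q_def by (intro continuous_intros continuous_on_product_coordinates)
  then have "closed {z. q z \<le> c}"
    by (intro closed_Collect_le) auto
  \<comment> \<open>P is a product of closed intervals, with the singleton {0} from index n on,
    hence compact by Tychonoff. B is its intersection with a closed set.\<close>
  moreover define P where "P = Pi\<^sub>E UNIV (\<lambda>i. if i < n then {z\<^sub>0 i - e..z\<^sub>0 i + e} else {0})"
  have "compactin (powertop_real UNIV) P"
    unfolding P_def compactin_PiE by (auto simp: compactin_euclidean_iff)
  then have "compact P" by (simp add: euclidean_product_topology compactin_euclidean_iff)
  ultimately have "compact ({z. q z \<le> c} \<inter> P)"
    by blast
  moreover have "z i \<in> (if i < n then {z\<^sub>0 i - e..z\<^sub>0 i + e} else {0})" if "z \<in> B" for z i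
    using near[of z i] that by (auto simp: B_def abs_less_iff)
  then have "B = {z. q z \<le> c} \<inter> P"
    by (auto simp: B_def P_def PiE_iff split: if_splits)
  ultimately have "compact B" by simp
  define K where "K = inv_into U \<phi> ` B"
  have "continuous_on B (inv_into U \<phi>)"
    using chart_continuous_inv[OF U(1)] by (rule continuous_on_subset) (use BZ in blast)
  then have "compact K"
    unfolding K_def using \<open>compact B\<close> by (rule compact_continuous_image)
  \<comment> \<open>Here the Hausdorff property enters: K is closed in the whole manifold and not
    merely in the chart domain, so its complement is open and b is smooth there as a
    constant.\<close>
  then have cK: "closed K" by (rule compact_imp_closed)
  have Euc: "\<phi> x j = 0" if "x \<in> U" "j \<ge> n" for x j
    using that openin_subset[OF chartD(2)[OF U(1)]] by (auto simp: topspace_Euclidean_space n_def)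
  have K: "x \<in> K \<longleftrightarrow> x \<in> U \<and> q (\<phi> x) \<le> c" for x
  proof
    assume "x \<in> K"
    then obtain z where z: "z \<in> B" "x = inv_into U \<phi> z" by (auto simp: K_def)
    then have "z \<in> \<phi> ` U" using BZ by auto
    then show "x \<in> U \<and> q (\<phi> x) \<le> c"
      using z by (auto simp: B_def inv_into_into f_inv_into_f)
  next
    assume x: "x \<in> U \<and> q (\<phi> x) \<le> c"
    then have "\<phi> x \<in> B" using Euc by (auto simp: B_def)
    then show "x \<in> K" using x inj unfolding K_def by (metis image_eqI inv_into_f_f)
  qed
  have KW: "K \<subseteq> W"
  proof
    fix x assume x: "x \<in> K"
    then have "\<phi> x \<in> \<phi> ` (U \<inter> W)" using K BZ Euc by (auto simp: B_def)
    then show "x \<in> W" using x K inj by (auto dest: inj_onD)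
  qed
  define f where "f = flat_exp 1"
  have f: "f t = (if t > 0 then exp (- (1 / t)) else 0)" for t
    by (simp add: f_def flat_exp_def)
  have sf: "smooth_real f" unfolding f_def by (rule smooth_real_flat_exp)
  define w where "w t = 1 + (- (1 / f (c / 2))) * f (t + (- (c / 2)))" for t
  define b where "b x = (if x \<in> U then 1 / f 1 * f (w (q (\<phi> x))) else 0)" for x
  have w1: "w t = 1" if "t \<le> c / 2" for t
    using that by (simp add: w_def f)
  have w0: "w t \<le> 0" if "t \<ge> c" for t
  proof -
    have "1 / (t - c / 2) \<le> 1 / (c / 2)"
      using that c by (intro divide_left_mono) auto
    then have "f (t + (- (c / 2))) \<ge> f (c / 2)" using that c by (simp add: f)
    moreover have "f (c / 2) > 0" using c by (simp add: f)
    ultimately show ?thesis by (simp add: w_def field_simps)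
  qed
  have sq: "smooth_fun_on M U (\<lambda>x. q (\<phi> x))"
  proof -
    have *: "smooth_fun_on M U (\<lambda>x. \<phi> x i - z\<^sub>0 i)" if "i < n" for i
      using that chartD(5)[OF U(1), of i] n_def by (intro smooth_fun_on_diff oU smooth_fun_on_const) auto
    show ?thesis
      unfolding q_def using * by (intro smooth_fun_on_sum smooth_fun_on_mult oU) auto
  qed
  have *: "smooth_fun_on M U (\<lambda>x. f (q (\<phi> x) + (- (c / 2))))"
    by (rule smooth_fun_on_compose[OF sf oU smooth_fun_on_add[OF oU sq smooth_fun_on_const[OF oU]]])
  then have "smooth_fun_on M U (\<lambda>x. w (q (\<phi> x)))"
    unfolding w_def by (intro smooth_fun_on_add smooth_fun_on_mult smooth_fun_on_const oU)
  from smooth_fun_on_compose[OF sf oU this]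
  have "smooth_fun_on M U (\<lambda>x. 1 / f 1 * f (w (q (\<phi> x))))"
    by (intro smooth_fun_on_mult smooth_fun_on_const oU)
  then have bU: "smooth_fun_on M U b"
    by (rule smooth_fun_on_cong[OF oU]) (simp add: b_def)
  have b0: "b x = 0" if "x \<in> - K" for x
    using that K[of x] w0[of "q (\<phi> x)"] by (auto simp: b_def f not_le)
  have bN: "smooth_fun_on M (- K) b"
    by (rule smooth_fun_on_cong[OF _ smooth_fun_on_const[where c = 0]]) (use cK b0 in auto)
  have sb: "smooth_fun_on M UNIV b"
  proof (rule smooth_fun_on_local)
    fix x
    show "\<exists>T. open T \<and> x \<in> T \<and> smooth_fun_on M (UNIV \<inter> T) b"
      using bU bN oU cK K by (cases "x \<in> U") (auto intro: exI[of _ U] exI[of _ "- K"])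
  qed auto
  have cq: "continuous_on U (\<lambda>x. q (\<phi> x))"
    by (rule continuous_on_compose2[OF \<open>continuous_on UNIV q\<close> chart_continuous[OF U(1)]]) (rule subset_UNIV)
  have oT: "open {x \<in> U. q (\<phi> x) < c / 2}"
  proof -
    have "open ((\<lambda>x. q (\<phi> x)) -` {..<c / 2} \<inter> U)"
      by (rule continuous_on_open_vimage[OF oU, THEN iffD1, OF cq, rule_format, OF open_lessThan])
    moreover have "(\<lambda>x. q (\<phi> x)) -` {..<c / 2} \<inter> U = {x \<in> U. q (\<phi> x) < c / 2}" by blast
    ultimately show ?thesis by simp
  qed
  show ?thesis
  proof (rule that[OF sb, of "- K"])
    show "open {x \<in> U. q (\<phi> x) < c / 2}" by (rule oT)
    show "b x = 0" if "x \<in> - K" for x using that by (rule b0)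
    show "x\<^sub>0 \<in> {x \<in> U. q (\<phi> x) < c / 2}" using U c by (auto simp: q_def z\<^sub>0_def)
    show "b x = 1" if "x \<in> {x \<in> U. q (\<phi> x) < c / 2}" for x
      using that w1[of "q (\<phi> x)"] by (simp add: b_def f)
    show "open (- K)" "- K \<union> W = UNIV" using cK KW by auto
  qed
qed

text \<open>The open set \<open>N\<close> witnesses that the support of the bump function \<open>b\<close> lies in \<open>W\<close>.\<close>

definition supported_in :: "('m \<Rightarrow> real) \<Rightarrow> 'm set \<Rightarrow> bool" where
  "supported_in b W \<longleftrightarrow> smooth_fun_on M UNIV b \<and> (\<exists>N. open N \<and> N \<union> W = UNIV \<and> (\<forall>x\<in>N. b x = 0))"

lemma bump_supported:
  assumes "open W" "x\<^sub>0 \<in> W"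
  obtains b T where "supported_in b W" "open T" "x\<^sub>0 \<in> T" "\<And>x. x \<in> T \<Longrightarrow> b x = 1"
  using bump_function[OF assms] unfolding supported_in_def by metis

lemma supported_in_zero: "supported_in b W \<Longrightarrow> x \<notin> W \<Longrightarrow> b x = 0"
  unfolding supported_in_def by blast

text \<open>The open sets S \<inter> W and S \<inter> N cover S; on the first h equals b g, on the
  second it is 0. The function h is kept separate from b g because in the applications it is given
  by cases or through the fibre operations.\<close>

lemma smooth_fun_on_extend:
  assumes "supported_in b W" "open W" "open S" "smooth_fun_on M (S \<inter> W) g"
    "\<And>x. x \<in> S \<inter> W \<Longrightarrow> b x \<noteq> 0 \<Longrightarrow> h x = b x * g x" "\<And>x. x \<in> S \<Longrightarrow> b x = 0 \<Longrightarrow> h x = 0"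
  shows "smooth_fun_on M S h"
proof (rule smooth_fun_on_local[OF assms(3)])
  obtain N where N: "open N" "N \<union> W = UNIV" "\<And>x. x \<in> N \<Longrightarrow> b x = 0" and b: "smooth_fun_on M UNIV b"
    using assms(1) unfolding supported_in_def by blast
  have o: "open (S \<inter> W)" "open (S \<inter> N)" using assms N by auto
  have bg: "b x * g x = h x" if "x \<in> S \<inter> W" for x
    using assms(5,6)[of x] that by (cases "b x = 0") auto
  have 1: "smooth_fun_on M (S \<inter> W) h"
    by (rule smooth_fun_on_cong[OF o(1) smooth_fun_on_mult[OF o(1) smooth_fun_on_subset[OF b] assms(4)]])
(rule subset_UNIV, erule bg)
  have 2: "smooth_fun_on M (S \<inter> N) h"
    by (rule smooth_fun_on_cong[OF o(2) smooth_fun_on_const[OF o(2), of 0]])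
       (use assms(6) N in auto)
  fix x assume "x \<in> S"
  show "\<exists>T. open T \<and> x \<in> T \<and> smooth_fun_on M (S \<inter> T) h"
    using 1 2 N(1,2) assms(2) by (metis UNIV_I UnE)
qed

end

section \<open>Alternating forms on a fibre\<close>

text \<open>The left copy of v is exchanged with its right neighbours until it meets the other copy;
  exchanging the two equal entries then gives a = - a.\<close>

lemma swap_imp_alternating:
  fixes a :: "'v list \<Rightarrow> real"
  assumes swap: "\<And>us v w ws. set (us @ v # w # ws) \<subseteq> S \<Longrightarrow> a (us @ v # w # ws) = - a (us @ w # v # ws)"
    and "set (us @ v # ws @ v # zs) \<subseteq> S"
  shows "a (us @ v # ws @ v # zs) = 0"
  using assms(2)
proof (induction ws arbitrary: us)
  case Nil
  with swap[of us v v zs] show ?case by simp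
next
  case (Cons w ws)
  then have "a (us @ v # w # ws @ v # zs) = - a ((us @ [w]) @ v # ws @ v # zs)"
    using swap[of us v w "ws @ v # zs"] by auto
  also have "\<dots> = 0" using Cons.IH[of "us @ [w]"] Cons.prems by auto
  finally show ?case by simp
qed

text \<open>A sign change under adjacent exchanges is what constructions deliver directly, whereas
  \<open>alt_forms\<close> asks for vanishing on arbitrary repeated arguments.\<close>

lemma alt_formsI:
  assumes "\<And>vs. \<not> set vs \<subseteq> fibre E x \<Longrightarrow> a vs = 0"
    "\<And>us v w ws. set (us @ v # w # ws) \<subseteq> fibre E x \<Longrightarrow>
      a (us @ vadd E v w # ws) = a (us @ v # ws) + a (us @ w # ws)"
    "\<And>us c v ws. set (us @ v # ws) \<subseteq> fibre E x \<Longrightarrow> a (us @ vscale E c v # ws) = c * a (us @ v # ws)"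
    "\<And>us v w ws. set (us @ v # w # ws) \<subseteq> fibre E x \<Longrightarrow> a (us @ v # w # ws) = - a (us @ w # v # ws)"
  shows "a \<in> alt_forms E x"
proof -
  have "a (us @ v # ws @ v # zs) = 0" for us v ws zs
    using swap_imp_alternating[of "fibre E x" a, OF assms(4)] assms(1) by blast
  with assms(1-3) show ?thesis
    unfolding alt_forms_def by blast
qed

lemma alt_formsD:
  assumes "a \<in> alt_forms E x"
  shows "\<not> set vs \<subseteq> fibre E x \<Longrightarrow> a vs = 0"
    "set (us @ v # w # ws) \<subseteq> fibre E x \<Longrightarrow> a (us @ vadd E v w # ws) = a (us @ v # ws) + a (us @ w # ws)"
    "set (us @ v # ws) \<subseteq> fibre E x \<Longrightarrow> a (us @ vscale E c v # ws) = c * a (us @ v # ws)"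
    "a (us @ v # ws @ v # zs) = 0"
  using assms unfolding alt_forms_def by blast+

lemma alt_forms_Cons: "a \<in> alt_forms E x \<Longrightarrow> (\<lambda>ws. a (v # ws)) \<in> alt_forms E x"
  using alt_forms_prefix[of a E x "[v]"] by simp

lemma alt_forms_rev: "a \<in> alt_forms E x \<Longrightarrow> (\<lambda>vs. a (rev vs)) \<in> alt_forms E x"
  using alt_forms_rev_suffix[of a E x "[]"] by simp

lemma alt_forms_0: "(\<lambda>vs. 0) \<in> alt_forms E x"
  by (simp add: alt_forms_def)

lemma alt_forms_add:
  assumes "a \<in> alt_forms E x" "b \<in> alt_forms E x"
  shows "(\<lambda>vs. a vs + b vs) \<in> alt_forms E x"
  unfolding alt_forms_def using assms[THEN alt_formsD(1)] assms[THEN alt_formsD(2)]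
    assms[THEN alt_formsD(3)] assms[THEN alt_formsD(4)]
  by (simp add: algebra_simps)

lemma alt_forms_scale: "a \<in> alt_forms E x \<Longrightarrow> (\<lambda>vs. c * a vs) \<in> alt_forms E x"
  unfolding alt_forms_def by (auto simp: algebra_simps)

lemma alt_forms_sum: "(\<And>i. i \<in> I \<Longrightarrow> a i \<in> alt_forms E x) \<Longrightarrow> (\<lambda>vs. \<Sum>i\<in>I. a i vs) \<in> alt_forms E x"
  by (induction I rule: infinite_finite_induct) (auto intro: alt_forms_add alt_forms_0)

text \<open>\<open>wedge_one \<alpha> a\<close> is \<open>\<alpha> \<and> a\<close> for a linear form \<open>\<alpha>\<close>, by the antiderivation rule \<open>i(v)(\<alpha> \<and> a) = \<alpha>(v) a - \<alpha> \<and> i(v)a\<close>.\<close>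

primrec wedge_one :: "('e \<Rightarrow> real) \<Rightarrow> ('e list \<Rightarrow> real) \<Rightarrow> 'e list \<Rightarrow> real" where
  "wedge_one \<alpha> a [] = 0"
| wedge_one_Cons: "wedge_one \<alpha> a (v # vs) = \<alpha> v * a vs - wedge_one \<alpha> (\<lambda>ws. a (v # ws)) vs"
declare wedge_one_Cons[simp del]

lemma wedge_one_0: "wedge_one \<alpha> (\<lambda>ws. 0) vs = 0"
  by (induction vs) (simp_all add: wedge_one_Cons)

lemma wedge_one_add: "wedge_one \<alpha> (\<lambda>ws. a ws + b ws) vs = wedge_one \<alpha> a vs + wedge_one \<alpha> b vs"
  by (induction vs arbitrary: a b) (simp_all add: algebra_simps wedge_one_Cons)

lemma wedge_one_scale: "wedge_one \<alpha> (\<lambda>ws. c * a ws) vs = c * wedge_one \<alpha> a vs"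
  by (induction vs arbitrary: a) (simp_all add: algebra_simps wedge_one_Cons)

lemma wedge_one_no_factor: "(\<And>v. v \<in> set vs \<Longrightarrow> \<alpha> v = 0) \<Longrightarrow> wedge_one \<alpha> a vs = 0"
  by (induction vs arbitrary: a) (simp_all add: wedge_one_Cons)

text \<open>If contraction with v kills both factors, it kills the product, by the antiderivation
  rule. Together with \<open>wedge_one_no_factor\<close> this evaluates the dual basis on the
  frame.\<close>

lemma wedge_one_annihilated:
  "(\<And>ws. v \<in> set ws \<Longrightarrow> a ws = 0) \<Longrightarrow> \<alpha> v = 0 \<Longrightarrow> v \<in> set vs \<Longrightarrow> wedge_one \<alpha> a vs = 0"
proof (induction vs arbitrary: a)
  case (Cons u us)
  show ?case
  proof (cases "u = v")
    case True
    then have "(\<lambda>ws. a (u # ws)) = (\<lambda>ws. 0)" using Cons.prems(1) by auto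
    then show ?thesis using True Cons.prems(2) by (simp add: wedge_one_0 wedge_one_Cons)
  next
    case False
    then have "v \<in> set us" using Cons.prems(3) by simp
    then show ?thesis using Cons.prems Cons.IH[of "\<lambda>ws. a (u # ws)"] by (simp add: wedge_one_Cons)
  qed
qed simp

lemma wedge_one_degree:
  "(\<And>ws. length ws \<noteq> n \<Longrightarrow> a ws = 0) \<Longrightarrow> length vs \<noteq> Suc n \<Longrightarrow> wedge_one \<alpha> a vs = 0"
proof (induction vs arbitrary: a n)
  case (Cons u us)
  show ?case
  proof (cases n)
    case 0
    then have "(\<lambda>ws. a (u # ws)) = (\<lambda>ws. 0)" using Cons.prems(1) by auto
    then show ?thesis using Cons.prems 0 by (simp add: wedge_one_0 wedge_one_Cons)
  next
    case (Suc m)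
    have "wedge_one \<alpha> (\<lambda>ws. a (u # ws)) us = 0"
      using Cons.prems Suc by (intro Cons.IH[of m]) auto
    then show ?thesis using Cons.prems by (simp add: wedge_one_Cons)
  qed
qed simp

lemma alt_swap:
  assumes "a \<in> alt_forms E x" "\<And>v w. v \<in> fibre E x \<Longrightarrow> w \<in> fibre E x \<Longrightarrow> vadd E v w \<in> fibre E x"
  shows "a (us @ v # w # ws) = - a (us @ w # v # ws)"
proof (cases "set (us @ v # w # ws) \<subseteq> fibre E x")
  case True
  note D = alt_formsD[OF assms(1)]
  have s: "vadd E v w \<in> fibre E x" using True assms(2) by auto
  have "0 = a (us @ vadd E v w # vadd E v w # ws)"
    using D(4)[of us "vadd E v w" "[]" ws] by simp
  also have "\<dots> = a (us @ v # vadd E v w # ws) + a (us @ w # vadd E v w # ws)"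
    using True s by (intro D(2)) auto
  also have "\<dots> = a (us @ v # v # ws) + a (us @ v # w # ws) + (a (us @ w # v # ws) + a (us @ w # w # ws))"
    using True D(2)[of "us @ [v]" v w ws] D(2)[of "us @ [w]" v w ws] by auto
  finally show ?thesis
    using D(4)[of us v "[]" ws] D(4)[of us w "[]" ws] by simp
next
  case False
  then show ?thesis using alt_formsD(1)[OF assms(1)] by auto
qed

text \<open>The positions removed in \<open>d_rho\<close> shift when the head of the list is split
  off; this is the bookkeeping behind the recursion for d.\<close>

lemma nths_Cons_remove:
  "nths (v # vs) (- {0}) = vs" "nths (v # vs) (- {Suc i}) = v # nths vs (- {i})"
  "nths (v # vs) (- {0, Suc i}) = nths vs (- {i})"
  "nths (v # vs) (- {Suc i, Suc j}) = v # nths vs (- {i, j})"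
  by (auto simp: nths_Cons nths_all intro!: arg_cong[where f = "nths vs"])

section \<open>Linear and multilinear algebra in the fibres of a vector bundle\<close>

locale vbundle =
  fixes E :: "('m :: {t2_space, second_countable_topology}, 'e, 'z) vector_bundle_scheme"
  assumes smooth_vector_bundle: "smooth_vector_bundle E"

sublocale vbundle \<subseteq> manifold "bas E"
  using smooth_vector_bundle by unfold_locales (simp add: smooth_vector_bundle_def)

context vbundle begin

lemma vector_bundle_parts:
  shows fibre_vector_space: "real_vector_space_on (fibre E x) (vadd E) (vscale E) (vzero E x)"
    and triv_Union: "(\<Union>(W, \<Phi>) \<in> trivs E. W) = UNIV"
    and triv_fibrewise: "\<forall>(W, \<Phi>) \<in> trivs E. open W \<and>
        (\<forall>x\<in>W. bij_betw \<Phi> (fibre E x) (topspace (Euclidean_space (vb_rank E))) \<and>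
           (\<forall>u \<in> fibre E x. \<forall>v \<in> fibre E x. \<Phi> (vadd E u v) = (\<lambda>i. \<Phi> u i + \<Phi> v i)) \<and>
           (\<forall>c. \<forall>v \<in> fibre E x. \<Phi> (vscale E c v) = (\<lambda>i. c * \<Phi> v i)))"
    and triv_transition: "\<forall>(W, \<Phi>) \<in> trivs E. \<forall>(W', \<Phi>') \<in> trivs E. \<forall>j < vb_rank E. \<forall>k < vb_rank E.
        smooth_fun_on (bas E) (W \<inter> W') (\<lambda>x. \<Phi>' (frame E \<Phi> k x) j)"
  using smooth_vector_bundle unfolding smooth_vector_bundle_def by - ((elim conjE, erule spec), (elim conjE, assumption)+)

lemma triv_cover: obtains W \<Phi> where "(W, \<Phi>) \<in> trivs E" "x \<in> W"
proof -
  have "x \<in> (\<Union>(W, \<Phi>) \<in> trivs E. W)" using triv_Union by simp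
  then show ?thesis using that by auto
qed

lemma fibre_closed:
  "vzero E x \<in> fibre E x" "u \<in> fibre E x \<Longrightarrow> v \<in> fibre E x \<Longrightarrow> vadd E u v \<in> fibre E x"
  "v \<in> fibre E x \<Longrightarrow> vscale E c v \<in> fibre E x" "v \<in> fibre E x \<Longrightarrow> vscale E 1 v = v"
  "vadd E (vzero E x) (vzero E x) = vzero E x"
  using fibre_vector_space[of x] unfolding real_vector_space_on_def by simp_all

lemma trivD:
  assumes "(W, \<Phi>) \<in> trivs E"
  shows "open W" "x \<in> W \<Longrightarrow> bij_betw \<Phi> (fibre E x) (topspace (Euclidean_space (vb_rank E)))"
    "x \<in> W \<Longrightarrow> u \<in> fibre E x \<Longrightarrow> v \<in> fibre E x \<Longrightarrow> \<Phi> (vadd E u v) = (\<lambda>i. \<Phi> u i + \<Phi> v i)"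
    "x \<in> W \<Longrightarrow> v \<in> fibre E x \<Longrightarrow> \<Phi> (vscale E c v) = (\<lambda>i. c * \<Phi> v i)"
    "(W', \<Phi>') \<in> trivs E \<Longrightarrow> j < vb_rank E \<Longrightarrow> k < vb_rank E \<Longrightarrow>
      smooth_fun_on (bas E) (W \<inter> W') (\<lambda>x. \<Phi>' (frame E \<Phi> k x) j)"
  using bspec[OF triv_fibrewise assms] bspec[OF bspec[OF triv_transition assms, simplified], of "(W', \<Phi>')"]
  by simp_all

lemma triv_inj: "(W, \<Phi>) \<in> trivs E \<Longrightarrow> x \<in> W \<Longrightarrow> u \<in> fibre E x \<Longrightarrow> v \<in> fibre E x \<Longrightarrow> \<Phi> u = \<Phi> v \<Longrightarrow> u = v"
  using trivD(2) unfolding bij_betw_def inj_on_def by blast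

lemma triv_out: "(W, \<Phi>) \<in> trivs E \<Longrightarrow> x \<in> W \<Longrightarrow> v \<in> fibre E x \<Longrightarrow> i \<ge> vb_rank E \<Longrightarrow> \<Phi> v i = 0"
  using trivD(2)[of W \<Phi> x] bij_betwE by (force simp: topspace_Euclidean_space)

lemma triv_zero:
  assumes "(W, \<Phi>) \<in> trivs E" "x \<in> W"
  shows "\<Phi> (vzero E x) i = 0"
proof -
  have "\<Phi> (vadd E (vzero E x) (vzero E x)) i = \<Phi> (vzero E x) i + \<Phi> (vzero E x) i"
    using trivD(3)[OF assms fibre_closed(1) fibre_closed(1)] by simp
  then show ?thesis by (simp add: fibre_closed(5))
qed

lemma vscale_0:
  assumes "v \<in> fibre E x"
  shows "vscale E 0 v = vzero E x"
proof -
  obtain W \<Phi> where t: "(W, \<Phi>) \<in> trivs E" "x \<in> W" by (rule triv_cover)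
  have "\<Phi> (vscale E 0 v) = \<Phi> (vzero E x)"
    using trivD(4)[OF t assms] triv_zero[OF t] by auto
  then show ?thesis using triv_inj[OF t] fibre_closed assms by blast
qed

text \<open>Unit coordinates give the frame; general constant coordinates are needed to extend an
  arbitrary vector of a fibre to a section.\<close>

definition unframe :: "('e \<Rightarrow> nat \<Rightarrow> real) \<Rightarrow> (nat \<Rightarrow> real) \<Rightarrow> 'm \<Rightarrow> 'e" where
  "unframe \<Phi> c x = inv_into (fibre E x) \<Phi> c"

lemma unframe:
  assumes "(W, \<Phi>) \<in> trivs E" "x \<in> W" "\<And>i. i \<ge> vb_rank E \<Longrightarrow> c i = 0"
  shows "unframe \<Phi> c x \<in> fibre E x" "\<Phi> (unframe \<Phi> c x) = c"
proof -
  have "c \<in> \<Phi> ` fibre E x"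
    using trivD(2)[OF assms(1,2)] assms(3) by (simp add: bij_betw_def topspace_Euclidean_space)
  then show "unframe \<Phi> c x \<in> fibre E x" "\<Phi> (unframe \<Phi> c x) = c"
    by (simp_all add: unframe_def inv_into_into f_inv_into_f)
qed

lemma frame_eq_unframe: "frame E \<Phi> k = unframe \<Phi> (\<lambda>i. if i = k then 1 else 0)"
  by (simp add: frame_def unframe_def fun_eq_iff)

lemma frame:
  assumes "(W, \<Phi>) \<in> trivs E" "x \<in> W" "k < vb_rank E"
  shows "frame E \<Phi> k x \<in> fibre E x" "\<Phi> (frame E \<Phi> k x) i = (if i = k then 1 else 0)"
  using unframe[OF assms(1,2), of "\<lambda>i. if i = k then 1 else 0"] assms(3) by (auto simp: frame_eq_unframe)

lemma unframe_triv:
  "(W, \<Phi>) \<in> trivs E \<Longrightarrow> x \<in> W \<Longrightarrow> v \<in> fibre E x \<Longrightarrow> unframe \<Phi> (\<Phi> v) x = v"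
  unfolding unframe_def using trivD(2) by (auto simp: bij_betw_def)

text \<open>Induction on the number m of coordinates that may be nonzero: subtracting the last of
  them times its frame vector lowers m by one. Hence no sum of vectors is formed in the fibre, which
  is only a set with operations.\<close>

lemma linear_expand:
  assumes t: "(W, \<Phi>) \<in> trivs E" "x \<in> W" and v: "v \<in> fibre E x"
    and add: "\<And>u v. u \<in> fibre E x \<Longrightarrow> v \<in> fibre E x \<Longrightarrow> l (vadd E u v) = l u + l v"
    and scale: "\<And>c v. v \<in> fibre E x \<Longrightarrow> l (vscale E c v) = c * (l v :: real)"
  shows "l v = (\<Sum>i<vb_rank E. \<Phi> v i * l (frame E \<Phi> i x))"
proof -
  have "l v = (\<Sum>i<m. \<Phi> v i * l (frame E \<Phi> i x))"
    if "v \<in> fibre E x" "m \<le> vb_rank E" "\<And>i. i \<ge> m \<Longrightarrow> \<Phi> v i = 0" for v m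
    using that
  proof (induction m arbitrary: v)
    case 0
    then have "v = vzero E x"
      using triv_zero[OF t] fibre_closed(1) by (intro triv_inj[OF t]) auto
    moreover have "l (vzero E x) = 0"
      using scale[OF 0(1), of 0] vscale_0[OF 0(1)] by simp
    ultimately show ?case by simp
  next
    case (Suc m)
    define e where "e = frame E \<Phi> m x"
    have e: "e \<in> fibre E x" "\<And>i. \<Phi> e i = (if i = m then 1 else 0)"
      using frame[OF t, of m] Suc.prems(2) by (auto simp: e_def)
    define v' where "v' = vadd E v (vscale E (- \<Phi> v m) e)"
    have v': "v' \<in> fibre E x" using Suc.prems(1) e fibre_closed by (simp add: v'_def)
    have \<Phi>: "\<Phi> v' i = (if i = m then 0 else \<Phi> v i)" for i
      using e fibre_closed Suc.prems(1) by (simp add: v'_def trivD(3)[OF t] trivD(4)[OF t])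
    have "l v' = (\<Sum>i<m. \<Phi> v' i * l (frame E \<Phi> i x))"
      by (rule Suc.IH) (use v' \<Phi> Suc.prems in \<open>auto simp: le_Suc_eq\<close>)
    also have "\<dots> = (\<Sum>i<m. \<Phi> v i * l (frame E \<Phi> i x))"
      by (simp add: \<Phi>)
    finally have "l v' = (\<Sum>i<m. \<Phi> v i * l (frame E \<Phi> i x))" .
    moreover have "l v' = l v - \<Phi> v m * l e"
      using Suc.prems(1) e fibre_closed by (simp add: v'_def add scale)
    ultimately show ?case by (simp add: e_def)
  qed
  from this[OF v order_refl] show ?thesis using triv_out[OF t v] by simp
qed

lemmas alt_forms_swap = alt_swap[OF _ fibre_closed(2)]

lemma alt_forms_move:
  "a \<in> alt_forms E x \<Longrightarrow> a (v # ws @ zs) = (-1) ^ length ws * a (ws @ v # zs)"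
proof (induction ws arbitrary: a)
  case (Cons w ws)
  have "a (v # (w # ws) @ zs) = - a (w # v # ws @ zs)"
    using alt_forms_swap[OF Cons.prems, of "[]" v w] by simp
  also have "a (w # v # ws @ zs) = (-1) ^ length ws * a (w # ws @ v # zs)"
    by (rule Cons.IH[OF alt_forms_Cons[OF Cons.prems]])
  finally show ?case by simp
qed simp

lemma alt_forms_block:
  "a \<in> alt_forms E x \<Longrightarrow> a (vs @ ws @ zs) = (-1) ^ (length vs * length ws) * a (ws @ vs @ zs)"
proof (induction vs arbitrary: a)
  case (Cons v vs)
  have "a ((v # vs) @ ws @ zs) = (-1) ^ (length vs * length ws) * a (v # ws @ vs @ zs)"
    using Cons.IH[OF alt_forms_Cons[OF Cons.prems]] by simp
  also have "a (v # ws @ vs @ zs) = (-1) ^ length ws * a (ws @ v # vs @ zs)"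
    by (rule alt_forms_move[OF Cons.prems])
  finally show ?case by (simp add: power_add algebra_simps)
qed simp

text \<open>Compares two conventions: the Lie derivative replaces an argument in place, while the
  differential puts the bracket in front of the remaining arguments. The sign counts the i
  exchanges.\<close>

lemma alt_forms_update:
  "a \<in> alt_forms E x \<Longrightarrow> i < length vs \<Longrightarrow> a (vs[i := u]) = (-1) ^ i * a (u # nths vs (- {i}))"
proof (induction vs arbitrary: a i)
  case (Cons v vs)
  show ?case
  proof (cases i)
    case 0
    then show ?thesis by (simp add: nths_Cons_remove)
  next
    case (Suc j)
    have "a ((v # vs)[Suc j := u]) = (-1) ^ j * a (v # u # nths vs (- {j}))"
      using Cons.IH[OF alt_forms_Cons[OF Cons.prems(1)], of j v] Cons.prems(2) Suc by simp
    also have "a (v # u # nths vs (- {j})) = - a (u # v # nths vs (- {j}))"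
      using alt_forms_swap[OF Cons.prems(1), of "[]" v u] by simp
    finally show ?thesis by (simp add: Suc nths_Cons_remove)
  qed
qed simp

text \<open>Each clause is an induction on the leading arguments. The form a is generalised because
  the antiderivation rule replaces it by its contraction with the first argument, which is again
  alternating.\<close>

lemma wedge_one_alt:
  assumes "a \<in> alt_forms E x" "\<And>v. v \<notin> fibre E x \<Longrightarrow> \<alpha> v = 0"
    "\<And>u v. u \<in> fibre E x \<Longrightarrow> v \<in> fibre E x \<Longrightarrow> \<alpha> (vadd E u v) = \<alpha> u + \<alpha> v"
    "\<And>c v. v \<in> fibre E x \<Longrightarrow> \<alpha> (vscale E c v) = c * \<alpha> v"
  shows "wedge_one \<alpha> a \<in> alt_forms E x"
proof (rule alt_formsI)
  show "wedge_one \<alpha> a vs = 0" if "\<not> set vs \<subseteq> fibre E x" for vs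
    using that assms(1)
  proof (induction vs arbitrary: a)
    case (Cons v vs)
    show ?case
    proof (cases "v \<in> fibre E x")
      case True
      then have "\<not> set vs \<subseteq> fibre E x" using Cons.prems by simp
      then show ?thesis
        using Cons.IH[OF _ alt_forms_Cons[OF Cons.prems(2)]] alt_formsD(1)[OF Cons.prems(2)]
        by (simp add: wedge_one_Cons)
    next
      case False
      then have "(\<lambda>ws. a (v # ws)) = (\<lambda>ws. 0)" using alt_formsD(1)[OF Cons.prems(2)] by auto
      then show ?thesis using assms(2) False by (simp add: wedge_one_Cons wedge_one_0)
    qed
  qed simp
  show "wedge_one \<alpha> a (us @ vadd E v w # ws) = wedge_one \<alpha> a (us @ v # ws) + wedge_one \<alpha> a (us @ w # ws)"
    if "set (us @ v # w # ws) \<subseteq> fibre E x" for us v w ws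
    using that assms(1)
  proof (induction us arbitrary: a)
    case Nil
    have "a (vadd E v w # vs) = a (v # vs) + a (w # vs)" for vs
    proof (cases "set vs \<subseteq> fibre E x")
      case True
      then show ?thesis using alt_formsD(2)[OF Nil(2), of "[]" v w vs] Nil(1) by auto
    next
      case False
      then show ?thesis using alt_formsD(1)[OF Nil(2)] by simp
    qed
    then show ?case using Nil assms(3)[of v w] by (simp add: wedge_one_Cons wedge_one_add algebra_simps)
  next
    case (Cons u us)
    then show ?case
      using Cons.IH[OF _ alt_forms_Cons[OF Cons.prems(2)]] alt_formsD(2)[OF Cons.prems(2), of us v w ws]
      by (simp add: wedge_one_Cons algebra_simps)
  qed
  show "wedge_one \<alpha> a (us @ vscale E c v # ws) = c * wedge_one \<alpha> a (us @ v # ws)"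
    if "set (us @ v # ws) \<subseteq> fibre E x" for us c v ws
    using that assms(1)
  proof (induction us arbitrary: a)
    case Nil
    have "a (vscale E c v # vs) = c * a (v # vs)" for vs
    proof (cases "set vs \<subseteq> fibre E x")
      case True
      then show ?thesis using alt_formsD(3)[OF Nil(2), of "[]" v vs] Nil(1) by auto
    next
      case False
      then show ?thesis using alt_formsD(1)[OF Nil(2)] by simp
    qed
    then show ?case using Nil assms(4)[of v] by (simp add: wedge_one_Cons wedge_one_scale algebra_simps)
  next
    case (Cons u us)
    then show ?case
      using Cons.IH[OF _ alt_forms_Cons[OF Cons.prems(2)]] alt_formsD(3)[OF Cons.prems(2), of us v ws]
      by (simp add: wedge_one_Cons algebra_simps)
  qed
  show "wedge_one \<alpha> a (us @ v # w # ws) = - wedge_one \<alpha> a (us @ w # v # ws)" for us v w ws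
    using assms(1)
  proof (induction us arbitrary: a)
    case Nil
    have "(\<lambda>vs. a (v # w # vs)) = (\<lambda>vs. (-1) * a (w # v # vs))"
      using alt_forms_swap[OF Nil, of "[]" v w] by (simp add: fun_eq_iff)
    then have "wedge_one \<alpha> (\<lambda>vs. a (v # w # vs)) ws = - wedge_one \<alpha> (\<lambda>vs. a (w # v # vs)) ws"
      by (simp only: wedge_one_scale)
    then show ?case by (simp add: wedge_one_Cons)
  next
    case (Cons u us)
    then show ?case
      using Cons.IH[OF alt_forms_Cons[OF Cons.prems]] alt_forms_swap[OF Cons.prems, of us v w ws]
      by (simp add: wedge_one_Cons)
  qed
qed

end

section \<open>Local frames, sections and forms\<close>

context vbundle begin

definition frame_indices :: "nat list set" where
  "frame_indices = {I. sorted_wrt (<) I \<and> set I \<subseteq> {..<vb_rank E}}"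

abbreviation frame_list :: "('e \<Rightarrow> nat \<Rightarrow> real) \<Rightarrow> 'm \<Rightarrow> nat list \<Rightarrow> 'e list" where
  "frame_list \<Phi> x I \<equiv> map (\<lambda>i. frame E \<Phi> i x) I"

text \<open>The default 0 off the fibre is chosen because elements of \<open>alt_forms\<close>
  vanish there.\<close>

definition coord :: "('e \<Rightarrow> nat \<Rightarrow> real) \<Rightarrow> 'm \<Rightarrow> nat \<Rightarrow> 'e \<Rightarrow> real" where
  "coord \<Phi> x i v = (if v \<in> fibre E x then \<Phi> v i else 0)"

text \<open>For increasing I these are the basis forms e^{i_1} \<and> ... \<and> e^{i_p} dual to the
  basis of multivectors used in \<open>multivector_fields\<close>.\<close>

primrec coframe :: "('e \<Rightarrow> nat \<Rightarrow> real) \<Rightarrow> 'm \<Rightarrow> nat list \<Rightarrow> 'e list \<Rightarrow> real" where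
  "coframe \<Phi> x [] = (\<lambda>vs. if vs = [] then 1 else 0)"
| "coframe \<Phi> x (i # I) = wedge_one (coord \<Phi> x i) (coframe \<Phi> x I)"

lemma finite_frame_indices: "finite frame_indices"
proof (rule finite_imageD[where f = set])
  show "finite (set ` frame_indices)"
    by (rule finite_subset[of _ "Pow {..<vb_rank E}"]) (auto simp: frame_indices_def)
  show "inj_on set frame_indices"
    by (auto intro!: inj_onI simp: frame_indices_def strict_sorted_iff sorted_distinct_set_unique)
qed

lemma frame_list_fibre:
  "(W, \<Phi>) \<in> trivs E \<Longrightarrow> x \<in> W \<Longrightarrow> set I \<subseteq> {..<vb_rank E} \<Longrightarrow> set (frame_list \<Phi> x I) \<subseteq> fibre E x"
  using frame(1) by auto

lemma coframe_alt:
  assumes t: "(W, \<Phi>) \<in> trivs E" "x \<in> W"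
  shows "coframe \<Phi> x I \<in> alt_forms E x"
proof (induction I)
  case Nil
  show ?case by (auto simp: alt_forms_def)
next
  case (Cons i I)
  then show ?case
    by (auto intro!: wedge_one_alt simp: coord_def trivD(3)[OF t] trivD(4)[OF t] fibre_closed)
qed

lemma coframe_degree: "length vs \<noteq> length I \<Longrightarrow> coframe \<Phi> x I vs = 0"
proof (induction I arbitrary: vs)
  case (Cons i I)
  then show ?case by (auto intro: wedge_one_degree[of "length I"])
qed auto

lemma coframe_annihilated:
  "\<forall>i\<in>set I. coord \<Phi> x i v = 0 \<Longrightarrow> v \<in> set vs \<Longrightarrow> coframe \<Phi> x I vs = 0"
proof (induction I arbitrary: vs)
  case (Cons i I)
  then show ?case by (auto intro!: wedge_one_annihilated[of v])
qed auto

lemma coord_frame: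
  "(W, \<Phi>) \<in> trivs E \<Longrightarrow> x \<in> W \<Longrightarrow> k < vb_rank E \<Longrightarrow> coord \<Phi> x i (frame E \<Phi> k x) = (if i = k then 1 else 0)"
  using frame(1)[of W \<Phi> x k] frame(2)[of W \<Phi> x k i] by (simp add: coord_def)

text \<open>The first indices i of I and j of J are compared. If i < j, the factor e^i kills every
  vector of the list; if i > j, every factor kills e_j; if i = j, only the first term of the
  antiderivation rule survives and the induction hypothesis applies.\<close>

lemma coframe_dual:
  assumes t: "(W, \<Phi>) \<in> trivs E" "x \<in> W"
  shows "sorted_wrt (<) I \<Longrightarrow> sorted_wrt (<) J \<Longrightarrow> set J \<subseteq> {..<vb_rank E} \<Longrightarrow>
    coframe \<Phi> x I (frame_list \<Phi> x J) = (if I = J then 1 else 0)"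
proof (induction I arbitrary: J)
  case Nil
  then show ?case by auto
next
  case (Cons i I J)
  show ?case
  proof (cases J)
    case Nil
    then show ?thesis by simp
  next
    case J: (Cons j J')
    have j: "j < vb_rank E" "\<And>k. k \<in> set J' \<Longrightarrow> j < k \<and> k < vb_rank E"
      using Cons.prems J by auto
    have nj: "j \<notin> set J'" using j(2)[of j] by auto
    consider "i = j" | "i < j" | "i > j" by linarith
    then show ?thesis
    proof cases
      case 1
      have "wedge_one (coord \<Phi> x i) a (frame_list \<Phi> x J') = 0" for a
        using j 1 nj by (intro wedge_one_no_factor) (auto simp: coord_frame[OF t])
      then show ?thesis
        using 1 J j Cons.IH[of J'] Cons.prems by (simp add: wedge_one_Cons coord_frame[OF t])
    next
      case 2
      have ni: "i \<notin> set J'" using j(2)[of i] 2 by auto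
      have "coframe \<Phi> x (i # I) (frame_list \<Phi> x J) = 0"
        unfolding coframe.simps using j 2 J ni by (intro wedge_one_no_factor) (auto simp: coord_frame[OF t])
      then show ?thesis using 2 J by simp
    next
      case 3
      have "coframe \<Phi> x (i # I) (frame_list \<Phi> x J) = 0"
        by (rule coframe_annihilated[where v = "frame E \<Phi> j x"])
           (use 3 J j Cons.prems in \<open>auto simp: coord_frame[OF t]\<close>)
      then show ?thesis using 3 J by simp
    qed
  qed
qed

text \<open>Only vanishing is tracked while indices are sorted, so the sign of the sorting
  permutation never has to be computed.\<close>

lemma alt_zero_insort:
  "a \<in> alt_forms E x \<Longrightarrow> a (map e (insort j K)) = 0 \<Longrightarrow> a (e j # map e K) = 0"
proof (induction K arbitrary: a)
  case (Cons k K)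
  show ?case
  proof (cases "j \<le> k")
    case False
    then have "a (e k # e j # map e K) = 0"
      using Cons.IH[OF alt_forms_Cons[OF Cons.prems(1)]] Cons.prems(2) by simp
    then show ?thesis using alt_forms_swap[OF Cons.prems(1), of "[]" "e j" "e k"] by simp
  qed (use Cons.prems in simp)
qed simp

lemma alt_zero_sort:
  "a \<in> alt_forms E x \<Longrightarrow> a (map e (sort J)) = 0 \<Longrightarrow> a (map e J) = 0"
proof (induction J arbitrary: a)
  case (Cons j J)
  have *: "a (e j # map e (sort J)) = 0"
    using alt_zero_insort[OF Cons.prems(1), of e j "sort J"] Cons.prems(2) by simp
  then show ?case
    using Cons.IH[OF alt_forms_Cons[OF Cons.prems(1)], of "e j"] by simp
qed simp

text \<open>Repeated indices give 0 and distinct ones can be sorted, so a vanishes on all lists of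
  frame vectors; expanding one argument after the other reaches arbitrary vectors.\<close>

lemma alt_eq_0:
  assumes t: "(W, \<Phi>) \<in> trivs E" "x \<in> W" and a: "a \<in> alt_forms E x"
    and z: "\<And>I. I \<in> frame_indices \<Longrightarrow> a (frame_list \<Phi> x I) = 0"
  shows "a vs = 0"
proof -
  have all: "a (frame_list \<Phi> x J) = 0" if J: "set J \<subseteq> {..<vb_rank E}" for J
  proof (cases "distinct J")
    case True
    then have "sort J \<in> frame_indices"
      using J by (auto simp: frame_indices_def strict_sorted_iff)
    then show ?thesis using alt_zero_sort[OF a] z by blast
  next
    case False
    then obtain us v ws zs where "J = us @ [v] @ ws @ [v] @ zs"
      using not_distinct_decomp by blast
    then show ?thesis using alt_formsD(4)[OF a] by simp
  qed
  have "a vs = 0" if "a \<in> alt_forms E x" "\<And>J. set J \<subseteq> {..<vb_rank E} \<Longrightarrow> a (frame_list \<Phi> x J) = 0" for a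
    using that
  proof (induction vs arbitrary: a)
    case Nil
    from Nil(2)[of "[]"] show ?case by simp
  next
    case (Cons v vs)
    show ?case
    proof (cases "set (v # vs) \<subseteq> fibre E x")
      case True
      have "a (v # vs) = (\<Sum>i<vb_rank E. \<Phi> v i * a (frame E \<Phi> i x # vs))"
        using True alt_formsD(2)[OF Cons.prems(1), of "[]"] alt_formsD(3)[OF Cons.prems(1), of "[]"]
        by (intro linear_expand[OF t]) auto
      also have "\<dots> = 0"
      proof (intro sum.neutral ballI)
        fix i assume i: "i \<in> {..<vb_rank E}"
        have "a (frame E \<Phi> i x # frame_list \<Phi> x J) = 0" if "set J \<subseteq> {..<vb_rank E}" for J
          using Cons.prems(2)[of "i # J"] that i by simp
        then have "a (frame E \<Phi> i x # vs) = 0"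
          by (rule Cons.IH[OF alt_forms_Cons[OF Cons.prems(1)]])
        then show "\<Phi> v i * a (frame E \<Phi> i x # vs) = 0" by simp
      qed
      finally show ?thesis .
    qed (use alt_formsD(1)[OF Cons.prems(1)] in blast)
  qed
  then show ?thesis using a all by blast
qed

lemma alt_expand:
  assumes t: "(W, \<Phi>) \<in> trivs E" "x \<in> W" and a: "a \<in> alt_forms E x"
  shows "a vs = (\<Sum>I\<in>frame_indices. a (frame_list \<Phi> x I) * coframe \<Phi> x I vs)"
proof -
  define b where "b vs = a vs + (-1) * (\<Sum>I\<in>frame_indices. a (frame_list \<Phi> x I) * coframe \<Phi> x I vs)" for vs
  have "b \<in> alt_forms E x"
    unfolding b_def by (intro alt_forms_add alt_forms_scale alt_forms_sum a coframe_alt[OF t])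
  moreover have "b (frame_list \<Phi> x J) = 0" if J: "J \<in> frame_indices" for J
  proof -
    have "(\<Sum>I\<in>frame_indices. a (frame_list \<Phi> x I) * coframe \<Phi> x I (frame_list \<Phi> x J)) =
        (\<Sum>I\<in>frame_indices. if I = J then a (frame_list \<Phi> x I) else 0)"
      using J by (intro sum.cong) (auto simp: frame_indices_def coframe_dual[OF t])
    then show ?thesis using J finite_frame_indices by (simp add: b_def)
  qed
  ultimately have "b vs = 0" by (rule alt_eq_0[OF t])
  then show ?thesis by (simp add: b_def)
qed

section \<open>Forms and global sections\<close>

lemma all_formsD:
  assumes "\<eta> \<in> all_forms E"
  shows "\<eta> x \<in> alt_forms E x"
    "(W, \<Phi>) \<in> trivs E \<Longrightarrow> set is \<subseteq> {..<vb_rank E} \<Longrightarrow> smooth_fun_on (bas E) W (\<lambda>x. \<eta> x (frame_list \<Phi> x is))"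
  using assms unfolding all_forms_def by auto

lemma all_formsI:
  assumes "\<And>x. \<eta> x \<in> alt_forms E x"
    "\<And>W \<Phi> is. (W, \<Phi>) \<in> trivs E \<Longrightarrow> set is \<subseteq> {..<vb_rank E} \<Longrightarrow>
      smooth_fun_on (bas E) W (\<lambda>x. \<eta> x (frame_list \<Phi> x is))"
  shows "\<eta> \<in> all_forms E"
  using assms unfolding all_forms_def by auto

lemma all_forms_0: "(\<lambda>x vs. 0) \<in> all_forms E"
  by (intro all_formsI alt_forms_0 smooth_fun_on_const trivD(1))

lemma all_forms_add:
  "\<eta> \<in> all_forms E \<Longrightarrow> \<theta> \<in> all_forms E \<Longrightarrow> (\<lambda>x vs. \<eta> x vs + \<theta> x vs) \<in> all_forms E"
  by (rule all_formsI) (auto intro: alt_forms_add smooth_fun_on_add trivD(1) all_formsD)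

lemma all_forms_smult:
  "smooth_fun_on (bas E) UNIV f \<Longrightarrow> \<eta> \<in> all_forms E \<Longrightarrow> (\<lambda>x vs. f x * \<eta> x vs) \<in> all_forms E"
  by (rule all_formsI, rule alt_forms_scale, erule all_formsD(1), rule smooth_fun_on_mult)
     (auto dest: trivD(1) all_formsD(2) intro: smooth_fun_on_subset)

lemma all_forms_scale: "\<eta> \<in> all_forms E \<Longrightarrow> (\<lambda>x vs. c * \<eta> x vs) \<in> all_forms E"
  by (rule all_forms_smult) (simp add: smooth_fun_on_const)

lemma all_forms_diff:
  assumes "\<eta> \<in> all_forms E" "\<theta> \<in> all_forms E"
  shows "(\<lambda>x vs. \<eta> x vs - \<theta> x vs) \<in> all_forms E"
  using all_forms_add[OF assms(1) all_forms_scale[OF assms(2), of "-1"]] by simp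

lemma all_forms_sum:
  "(\<And>i. i \<in> I \<Longrightarrow> \<eta> i \<in> all_forms E) \<Longrightarrow> (\<lambda>x vs. \<Sum>i\<in>I. \<eta> i x vs) \<in> all_forms E"
  by (induction I rule: infinite_finite_induct) (auto intro: all_forms_add all_forms_0)

lemma sectionsD:
  assumes "s \<in> sections E"
  shows "s x \<in> fibre E x"
    "(W, \<Phi>) \<in> trivs E \<Longrightarrow> j < vb_rank E \<Longrightarrow> smooth_fun_on (bas E) W (\<lambda>x. \<Phi> (s x) j)"
  using assms unfolding sections_def by auto

lemma sectionsI:
  assumes "\<And>x. s x \<in> fibre E x"
    "\<And>W \<Phi> j. (W, \<Phi>) \<in> trivs E \<Longrightarrow> j < vb_rank E \<Longrightarrow> smooth_fun_on (bas E) W (\<lambda>x. \<Phi> (s x) j)"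
  shows "s \<in> sections E"
  using assms unfolding sections_def by auto

lemma sec_add_in:
  assumes "s \<in> sections E" "t \<in> sections E"
  shows "sec_add E s t \<in> sections E"
proof (rule sectionsI)
  note s = sectionsD[OF assms(1)] and t = sectionsD[OF assms(2)]
  show "sec_add E s t x \<in> fibre E x" for x
    by (simp add: sec_add_def fibre_closed s t)
  fix W \<Phi> j assume W: "(W, \<Phi>) \<in> trivs E" "j < vb_rank E"
  show "smooth_fun_on (bas E) W (\<lambda>x. \<Phi> (sec_add E s t x) j)"
    by (rule smooth_fun_on_cong[OF _ smooth_fun_on_add[OF _ s(2)[OF W] t(2)[OF W]]])
       (use W in \<open>auto simp: sec_add_def trivD s(1) t(1) trivD(3)[OF W(1) _ s(1) t(1)]\<close>)
qed

lemma sec_scale_in: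
  assumes "smooth_fun_on (bas E) UNIV f" "s \<in> sections E"
  shows "sec_scale E f s \<in> sections E"
proof (rule sectionsI)
  note s = sectionsD[OF assms(2)]
  show "sec_scale E f s x \<in> fibre E x" for x
    by (simp add: sec_scale_def fibre_closed s)
  fix W \<Phi> j assume W: "(W, \<Phi>) \<in> trivs E" "j < vb_rank E"
  show "smooth_fun_on (bas E) W (\<lambda>x. \<Phi> (sec_scale E f s x) j)"
    by (rule smooth_fun_on_cong[OF _ smooth_fun_on_mult[OF _ smooth_fun_on_subset[OF assms(1)] s(2)[OF W]]])
       (use W in \<open>auto simp: sec_scale_def trivD(1) trivD(4)[OF W(1) _ s(1)]\<close>)
qed

lemma vzero_in: "vzero E \<in> sections E"
proof (rule sectionsI)
  fix W \<Phi> j assume W: "(W, \<Phi>) \<in> trivs E"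
  show "smooth_fun_on (bas E) W (\<lambda>x. \<Phi> (vzero E x) j)"
    by (rule smooth_fun_on_cong[OF _ smooth_fun_on_const[of _ 0]])
       (use W in \<open>auto simp: trivD(1) triv_zero\<close>)
qed (rule fibre_closed)

text \<open>Test sections must be defined on all of M: the section over W with constant coordinates
  c is cut off by b and continued by the zero section.\<close>

definition local_section ::
  "('m \<Rightarrow> real) \<Rightarrow> 'm set \<Rightarrow> ('e \<Rightarrow> nat \<Rightarrow> real) \<Rightarrow> (nat \<Rightarrow> real) \<Rightarrow> 'm \<Rightarrow> 'e" where
  "local_section b W \<Phi> c x = (if x \<in> W then vscale E (b x) (unframe \<Phi> c x) else vzero E x)"

lemma local_section_in:
  assumes W: "(W, \<Phi>) \<in> trivs E" and b: "supported_in b W" and c: "\<And>i. i \<ge> vb_rank E \<Longrightarrow> c i = 0"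
  shows "local_section b W \<Phi> c \<in> sections E"
proof (rule sectionsI)
  note u = unframe[OF W, where c = c, OF _ c]
  show "local_section b W \<Phi> c x \<in> fibre E x" for x
    by (simp add: local_section_def fibre_closed u)
  fix W' \<Phi>' j assume W': "(W', \<Phi>') \<in> trivs E" and j: "j < vb_rank E"
  have o: "open (W' \<inter> W)" using trivD(1) W W' by auto
  \<comment> \<open>The j-th coordinate in the other trivialization is a linear form on the fibre,
    so it expands along the frame; its values on the frame are the smooth transition
    functions.\<close>
  have e: "\<Phi>' (unframe \<Phi> c x) j = (\<Sum>i<vb_rank E. c i * \<Phi>' (frame E \<Phi> i x) j)" if "x \<in> W' \<inter> W" for x
  proof -
    have "\<Phi>' (unframe \<Phi> c x) j = (\<Sum>i<vb_rank E. \<Phi> (unframe \<Phi> c x) i * \<Phi>' (frame E \<Phi> i x) j)"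
      using that by (intro linear_expand[OF W]) (auto simp: u trivD(3)[OF W'] trivD(4)[OF W'])
    then show ?thesis using that by (simp add: u)
  qed
  have "smooth_fun_on (bas E) (W' \<inter> W) (\<lambda>x. \<Sum>i<vb_rank E. c i * \<Phi>' (frame E \<Phi> i x) j)"
    using trivD(5)[OF W W' j] by (intro smooth_fun_on_sum smooth_fun_on_mult smooth_fun_on_const o) (auto simp: Int_commute)
  then have s: "smooth_fun_on (bas E) (W' \<inter> W) (\<lambda>x. \<Phi>' (unframe \<Phi> c x) j)"
    by (rule smooth_fun_on_cong[OF o]) (simp add: e)
  show "smooth_fun_on (bas E) W' (\<lambda>x. \<Phi>' (local_section b W \<Phi> c x) j)"
  proof (rule smooth_fun_on_extend[OF b trivD(1)[OF W] trivD(1)[OF W'] s])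
    show "\<Phi>' (local_section b W \<Phi> c x) j = b x * \<Phi>' (unframe \<Phi> c x) j" if "x \<in> W' \<inter> W" for x
      using that u trivD(4)[OF W', of x "unframe \<Phi> c x" "b x"] by (simp add: local_section_def)
    show "\<Phi>' (local_section b W \<Phi> c x) j = 0" if "x \<in> W'" "b x = 0" for x
      using that u by (cases "x \<in> W") (simp_all add: local_section_def vscale_0[OF u(1)] triv_zero[OF W'])
  qed
qed

lemma section_through:
  assumes "v \<in> fibre E x"
  obtains V where "V \<in> sections E" "V x = v"
proof -
  obtain W \<Phi> where W: "(W, \<Phi>) \<in> trivs E" "x \<in> W" by (rule triv_cover)
  obtain b T where b: "supported_in b W" "x \<in> T" "\<And>y. y \<in> T \<Longrightarrow> b y = 1"
    using bump_supported[OF trivD(1)[OF W(1)] W(2)] by metis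
  show ?thesis
  proof (rule that)
    show "local_section b W \<Phi> (\<Phi> v) \<in> sections E"
      by (rule local_section_in[OF W(1) b(1)]) (rule triv_out[OF W assms])
    show "local_section b W \<Phi> (\<Phi> v) x = v"
      using b W unframe_triv[OF W assms] fibre_closed(4)[OF assms] by (simp add: local_section_def)
  qed
qed

lemma sections_through:
  assumes "set vs \<subseteq> fibre E x"
  obtains Vs where "set Vs \<subseteq> sections E" "map (\<lambda>V. V x) Vs = vs"
proof -
  have "\<exists>Vs. set Vs \<subseteq> sections E \<and> map (\<lambda>V. V x) Vs = vs"
    using assms
  proof (induction vs)
    case (Cons v vs)
    then obtain Vs where Vs: "set Vs \<subseteq> sections E" "map (\<lambda>V. V x) Vs = vs" by auto
    obtain V where "V \<in> sections E" "V x = v" using section_through[of v x] Cons.prems by auto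
    with Vs show ?case by (intro exI[of _ "V # Vs"]) auto
  qed simp
  then show ?thesis using that by blast
qed

lemma insert_vector_in:
  assumes \<eta>: "\<eta> \<in> all_forms E" and V: "V \<in> sections E"
  shows "insert_vector V \<eta> \<in> all_forms E"
proof (rule all_formsI)
  note D = all_formsD[OF \<eta>] and S = sectionsD[OF V]
  show "insert_vector V \<eta> x \<in> alt_forms E x" for x
    unfolding insert_vector_def by (rule alt_forms_Cons[OF D(1)])
  fix W \<Phi> js assume W: "(W, \<Phi>) \<in> trivs E" and js: "set js \<subseteq> {..<vb_rank E}"
  have o: "open W" using trivD(1)[OF W] .
  have "smooth_fun_on (bas E) W (\<lambda>x. \<Sum>i<vb_rank E. \<Phi> (V x) i * \<eta> x (frame_list \<Phi> x (i # js)))"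
    using js by (intro smooth_fun_on_sum smooth_fun_on_mult o S(2)[OF W] D(2)[OF W]) auto
  then show "smooth_fun_on (bas E) W (\<lambda>x. insert_vector V \<eta> x (frame_list \<Phi> x js))"
  proof (rule smooth_fun_on_cong[OF o])
    fix x assume x: "x \<in> W"
    have "\<eta> x (V x # frame_list \<Phi> x js) = (\<Sum>i<vb_rank E. \<Phi> (V x) i * \<eta> x (frame E \<Phi> i x # frame_list \<Phi> x js))"
      using frame_list_fibre[OF W x js] alt_formsD(2)[OF D(1)[of x], of "[]"] alt_formsD(3)[OF D(1)[of x], of "[]"]
      by (intro linear_expand[OF W x S(1)]) auto
    then show "(\<Sum>i<vb_rank E. \<Phi> (V x) i * \<eta> x (frame_list \<Phi> x (i # js))) = insert_vector V \<eta> x (frame_list \<Phi> x js)"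
      by (simp add: insert_vector_def)
  qed
qed

lemma eval_form_Cons: "eval_form \<eta> (V # Vs) = eval_form (insert_vector V \<eta>) Vs"
  by (simp add: eval_form_def insert_vector_def)

lemma eval_form_smooth:
  "\<eta> \<in> all_forms E \<Longrightarrow> set Vs \<subseteq> sections E \<Longrightarrow> smooth_fun_on (bas E) UNIV (eval_form \<eta> Vs)"
proof (induction Vs arbitrary: \<eta>)
  case Nil
  show ?case
  proof (rule smooth_fun_on_local)
    fix x
    obtain W \<Phi> where W: "(W, \<Phi>) \<in> trivs E" "x \<in> W" by (rule triv_cover)
    then show "\<exists>T. open T \<and> x \<in> T \<and> smooth_fun_on (bas E) (UNIV \<inter> T) (eval_form \<eta> [])"
      using all_formsD(2)[OF Nil(1) W(1), of "[]"] trivD(1)[OF W(1)]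
      by (intro exI[of _ W]) (simp add: eval_form_def)
  qed simp
next
  case (Cons V Vs)
  then show ?case by (simp add: eval_form_Cons insert_vector_in)
qed

lemma all_forms_eqI:
  assumes "\<eta> \<in> all_forms E" "\<theta> \<in> all_forms E"
    "\<And>Vs. set Vs \<subseteq> sections E \<Longrightarrow> eval_form \<eta> Vs = eval_form \<theta> Vs"
  shows "\<eta> = \<theta>"
proof (intro ext)
  fix x vs
  show "\<eta> x vs = \<theta> x vs"
  proof (cases "set vs \<subseteq> fibre E x")
    case True
    then obtain Vs where "set Vs \<subseteq> sections E" "map (\<lambda>V. V x) Vs = vs"
      by (rule sections_through)
    then show ?thesis using assms(3)[of Vs] by (metis eval_form_def)
  next
    case False
    then show ?thesis using assms(1,2) by (simp add: alt_formsD(1)[OF all_formsD(1)])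
  qed
qed

section \<open>Tensoriality: forms from multilinear functions of sections\<close>

abbreviation unit_coords :: "nat \<Rightarrow> nat \<Rightarrow> real" where
  "unit_coords k \<equiv> (\<lambda>i. if i = k then 1 else 0)"

text \<open>Locality: \<open>b\<^sup>2 V = \<Sum> (b V\<^sup>i) (b e\<^sub>i)\<close> holds globally.\<close>

lemma functional_expand:
  fixes T :: "('m \<Rightarrow> 'e) \<Rightarrow> real"
  assumes W: "(W, \<Phi>) \<in> trivs E" "x \<in> W" and b: "supported_in b W" "b x = 1"
    and add: "\<And>U V. U \<in> sections E \<Longrightarrow> V \<in> sections E \<Longrightarrow> T (sec_add E U V) = T U + T V"
    and scale: "\<And>f V. smooth_fun_on (bas E) UNIV f \<Longrightarrow> V \<in> sections E \<Longrightarrow> T (sec_scale E f V) = f x * T V"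
    and V: "V \<in> sections E"
  shows "T V = (\<Sum>i<vb_rank E. \<Phi> (V x) i * T (local_section b W \<Phi> (unit_coords i)))"
proof -
  have sb: "smooth_fun_on (bas E) UNIV b" using b(1) by (simp add: supported_in_def)
  have "T V = (\<Sum>i<m. \<Phi> (V x) i * T (local_section b W \<Phi> (unit_coords i)))"
    if "V \<in> sections E" "m \<le> vb_rank E" "\<And>i y. y \<in> W \<Longrightarrow> i \<ge> m \<Longrightarrow> \<Phi> (V y) i = 0" for V m
    using that
  proof (induction m arbitrary: V)
    case 0
    \<comment> \<open>V vanishes on W and b vanishes off W, so b V = 0; as b = 1 at x, the
      functional T kills V.\<close>
    have "sec_scale E b V y = sec_scale E (\<lambda>y. 0) V y" for y
    proof (cases "y \<in> W")
      case True
      have v: "V y \<in> fibre E y" using sectionsD(1)[OF 0(1)] .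
      show ?thesis
        unfolding sec_scale_def
        by (rule triv_inj[OF W(1) True])
           (use 0(3)[OF True] in \<open>simp_all add: fibre_closed v trivD(4)[OF W(1) True v]\<close>)
    next
      case False
      then show ?thesis using supported_in_zero[OF b(1)] by (simp add: sec_scale_def)
    qed
    then have "T (sec_scale E b V) = T (sec_scale E (\<lambda>y. 0) V)" by (metis ext)
    then show ?case using scale[OF sb 0(1)] scale[OF smooth_fun_on_const 0(1), of 0] b(2) by simp
  next
    case (Suc m)
    have m: "m < vb_rank E" using Suc.prems(2) by simp
    define e where "e = local_section b W \<Phi> (unit_coords m)"
    have e: "e \<in> sections E" unfolding e_def using m by (intro local_section_in[OF W(1) b(1)]) auto
    define g where "g y = (if y \<in> W then b y * (- \<Phi> (V y) m) else 0)" for y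
    have "smooth_fun_on (bas E) W (\<lambda>y. - \<Phi> (V y) m)"
      using smooth_fun_on_mult[OF _ smooth_fun_on_const sectionsD(2)[OF Suc.prems(1) W(1) m], of "-1"] trivD(1)[OF W(1)]
      by simp
    then have g: "smooth_fun_on (bas E) UNIV g"
      by - (rule smooth_fun_on_extend[OF b(1) trivD(1)[OF W(1)] open_UNIV, where g = "\<lambda>y. - \<Phi> (V y) m"],
           simp_all add: g_def)
    \<comment> \<open>The m-th coordinate is removed by means of global objects: V' is b b V minus
      (b V^m) times the cut-off frame section e. Its m-th coordinate vanishes on W, and b = 1 at x
      gives T V' = T V - V^m(x) T e.\<close>
    define V' where "V' = sec_add E (sec_scale E (\<lambda>y. b y * b y) V) (sec_scale E g e)"
    have bb: "smooth_fun_on (bas E) UNIV (\<lambda>y. b y * b y)" using sb by (intro smooth_fun_on_mult) auto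
    have V': "V' \<in> sections E"
      unfolding V'_def by (intro sec_add_in sec_scale_in g e bb Suc.prems(1))
    have \<Phi>: "\<Phi> (V' y) i = b y * b y * (if i = m then 0 else \<Phi> (V y) i)" if y: "y \<in> W" for y i
    proof -
      note c = fibre_closed sectionsD(1)[OF Suc.prems(1)] sectionsD(1)[OF e]
      have f: "unframe \<Phi> (unit_coords m) y \<in> fibre E y" "\<Phi> (unframe \<Phi> (unit_coords m) y) = unit_coords m"
        using unframe[OF W(1) y, of "unit_coords m"] m by auto
      have "\<Phi> (V' y) i = b y * b y * \<Phi> (V y) i + g y * \<Phi> (e y) i"
        unfolding V'_def sec_add_def sec_scale_def
        by (simp add: trivD(3)[OF W(1) y] trivD(4)[OF W(1) y] c)
      moreover have "\<Phi> (e y) i = b y * unit_coords m i"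
        using y f by (simp add: e_def local_section_def trivD(4)[OF W(1) y])
      ultimately show ?thesis using y by (cases "i = m") (simp_all add: g_def algebra_simps)
    qed
    have "T V' = (\<Sum>i<m. \<Phi> (V' x) i * T (local_section b W \<Phi> (unit_coords i)))"
      by (rule Suc.IH) (use V' \<Phi> Suc.prems in \<open>auto simp: le_Suc_eq\<close>)
    also have "\<dots> = (\<Sum>i<m. \<Phi> (V x) i * T (local_section b W \<Phi> (unit_coords i)))"
      using b(2) W(2) by (simp add: \<Phi>)
    finally have "T V' = (\<Sum>i<m. \<Phi> (V x) i * T (local_section b W \<Phi> (unit_coords i)))" .
    moreover have "T V' = T V - \<Phi> (V x) m * T e"
      unfolding V'_def using add[OF sec_scale_in[OF bb Suc.prems(1)] sec_scale_in[OF g e]]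
        scale[OF bb Suc.prems(1)] scale[OF g e] b(2) W(2) by (simp add: g_def)
    ultimately show ?case by (simp add: e_def)
  qed
  from this[OF V order_refl] show ?thesis
    using triv_out[OF W(1) _ sectionsD(1)[OF V]] by blast
qed

lemma functional_pointwise:
  fixes T :: "('m \<Rightarrow> 'e) \<Rightarrow> real"
  assumes add: "\<And>U V. U \<in> sections E \<Longrightarrow> V \<in> sections E \<Longrightarrow> T (sec_add E U V) = T U + T V"
    and scale: "\<And>f V. smooth_fun_on (bas E) UNIV f \<Longrightarrow> V \<in> sections E \<Longrightarrow> T (sec_scale E f V) = f x * T V"
    and V: "V \<in> sections E" "V' \<in> sections E" "V x = V' x"
  shows "T V = T V'"
proof -
  obtain W \<Phi> where W: "(W, \<Phi>) \<in> trivs E" "x \<in> W" by (rule triv_cover)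
  obtain b N where b: "supported_in b W" "x \<in> N" "\<And>y. y \<in> N \<Longrightarrow> b y = 1"
    using bump_supported[OF trivD(1)[OF W(1)] W(2)] by metis
  note e = functional_expand[where T = T, OF W b(1) b(3)[OF b(2)] add scale]
  show ?thesis using e[OF _ _ _ _ V(1)] e[OF _ _ _ _ V(2)] V(3) by simp
qed

text \<open>In each slot T is linear over functions, so its value at x depends on the section there
  only through its value at x; replacing the sections slot by slot gives the same for the whole
  list. The form is then defined on vectors by choosing sections through them. This produces the
  form whose existence the definition of \<open>d_rho\<close> presupposes.\<close>

lemma tensor_form:
  fixes T :: "('m \<Rightarrow> 'e) list \<Rightarrow> 'm \<Rightarrow> real"
  assumes smooth: "\<And>Vs. set Vs \<subseteq> sections E \<Longrightarrow> smooth_fun_on (bas E) UNIV (T Vs)"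
    and add: "\<And>Us U V Vs x. set (Us @ U # V # Vs) \<subseteq> sections E \<Longrightarrow>
      T (Us @ sec_add E U V # Vs) x = T (Us @ U # Vs) x + T (Us @ V # Vs) x"
    and scale: "\<And>Us f V Vs x. set (Us @ V # Vs) \<subseteq> sections E \<Longrightarrow> smooth_fun_on (bas E) UNIV f \<Longrightarrow>
      T (Us @ sec_scale E f V # Vs) x = f x * T (Us @ V # Vs) x"
    and swap: "\<And>Us U V Vs x. set (Us @ U # V # Vs) \<subseteq> sections E \<Longrightarrow>
      T (Us @ U # V # Vs) x = - T (Us @ V # U # Vs) x"
  obtains \<omega> where "\<omega> \<in> all_forms E" "\<And>Vs. set Vs \<subseteq> sections E \<Longrightarrow> eval_form \<omega> Vs = T Vs"
proof -
  have one: "T (Us @ V # Vs) x = T (Us @ V' # Vs) x"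
    if "set (Us @ V # V' # Vs) \<subseteq> sections E" "V x = V' x" for Us V V' Vs x
    by (rule functional_pointwise[where T = "\<lambda>V. T (Us @ V # Vs) x" and x = x])
       (use that in \<open>simp_all add: add scale\<close>)
  have pw: "T (Us @ Vs) x = T (Us @ Vs') x"
    if "set Us \<subseteq> sections E" "set Vs \<subseteq> sections E" "set Vs' \<subseteq> sections E"
      "map (\<lambda>V. V x) Vs = map (\<lambda>V. V x) Vs'" for Us Vs Vs' x
    using that
  proof (induction Vs arbitrary: Us Vs')
    case (Cons V Vs)
    then obtain V' Ws where V': "Vs' = V' # Ws" "V x = V' x" "map (\<lambda>V. V x) Vs = map (\<lambda>V. V x) Ws"
      by auto
    have "T (Us @ V # Vs) x = T ((Us @ [V']) @ Vs) x"
      using one[of Us V V' Vs x] Cons.prems V' by auto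
    also have "\<dots> = T ((Us @ [V']) @ Ws) x"
      using Cons.IH[of "Us @ [V']" Ws] Cons.prems V' by auto
    finally show ?case using V' by simp
  qed simp
  define sec where "sec x v = (SOME V. V \<in> sections E \<and> V x = v)" for x v
  have sec: "sec x v \<in> sections E" "sec x v x = v" if "v \<in> fibre E x" for x v
  proof -
    have "\<exists>V. V \<in> sections E \<and> V x = v" using section_through[OF that] by blast
    from someI_ex[OF this] show "sec x v \<in> sections E" "sec x v x = v" by (auto simp: sec_def)
  qed
  have secs: "set (map (sec x) vs) \<subseteq> sections E" "map (\<lambda>V. V x) (map (sec x) vs) = vs"
    if "set vs \<subseteq> fibre E x" for x vs
    using that sec by (auto simp: list.map_comp o_def subset_eq intro!: map_idI)
  define \<omega> where "\<omega> x vs = (if set vs \<subseteq> fibre E x then T (map (sec x) vs) x else 0)" for x vs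
  have \<omega>: "\<omega> x (map (\<lambda>V. V x) Vs) = T Vs x" if Vs: "set Vs \<subseteq> sections E" for Vs x
  proof -
    have f: "set (map (\<lambda>V. V x) Vs) \<subseteq> fibre E x" using Vs sectionsD(1) by auto
    then show ?thesis
      unfolding \<omega>_def using pw[of "[]" "map (sec x) (map (\<lambda>V. V x) Vs)" Vs x] Vs secs[OF f] by simp
  qed
  show ?thesis
  proof (rule that)
    show "eval_form \<omega> Vs = T Vs" if "set Vs \<subseteq> sections E" for Vs
      using \<omega>[OF that] by (auto simp: eval_form_def)
    show "\<omega> \<in> all_forms E"
    proof (rule all_formsI)
      fix x
      show "\<omega> x \<in> alt_forms E x"
      proof (rule alt_formsI)
        show "\<omega> x vs = 0" if "\<not> set vs \<subseteq> fibre E x" for vs using that by (simp add: \<omega>_def)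
        fix us v w ws assume A: "set (us @ v # w # ws) \<subseteq> fibre E x"
        let ?us = "map (sec x) us" and ?ws = "map (sec x) ws"
        have S: "set (?us @ sec x v # sec x w # ?ws) \<subseteq> sections E"
          using secs(1)[OF A] by simp
        have m: "map (\<lambda>V. V x) ?us = us" "map (\<lambda>V. V x) ?ws = ws" "sec x v x = v" "sec x w x = w"
          using A secs(2)[of us x] secs(2)[of ws x] sec(2)[of v x] sec(2)[of w x] by auto
        have "\<omega> x (us @ vadd E v w # ws) = T (?us @ sec_add E (sec x v) (sec x w) # ?ws) x"
          using \<omega>[of "?us @ sec_add E (sec x v) (sec x w) # ?ws" x] S m sec_add_in by (simp add: sec_add_def)
        then show "\<omega> x (us @ vadd E v w # ws) = \<omega> x (us @ v # ws) + \<omega> x (us @ w # ws)"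
          using add[OF S] \<omega>[of "?us @ sec x v # ?ws" x] \<omega>[of "?us @ sec x w # ?ws" x] S m by simp
        show "\<omega> x (us @ v # w # ws) = - \<omega> x (us @ w # v # ws)"
          using swap[OF S] \<omega>[of "?us @ sec x v # sec x w # ?ws" x] \<omega>[of "?us @ sec x w # sec x v # ?ws" x] S m by simp
      next
        fix us c v ws assume A: "set (us @ v # ws) \<subseteq> fibre E x"
        let ?us = "map (sec x) us" and ?ws = "map (sec x) ws"
        have S: "set (?us @ sec x v # ?ws) \<subseteq> sections E"
          using secs(1)[OF A] by simp
        have m: "map (\<lambda>V. V x) ?us = us" "map (\<lambda>V. V x) ?ws = ws" "sec x v x = v"
          using A secs(2)[of us x] secs(2)[of ws x] sec(2)[of v x] by auto
        have c: "smooth_fun_on (bas E) UNIV (\<lambda>x. c)" by (rule smooth_fun_on_const) simp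
        have "\<omega> x (us @ vscale E c v # ws) = T (?us @ sec_scale E (\<lambda>x. c) (sec x v) # ?ws) x"
          using \<omega>[of "?us @ sec_scale E (\<lambda>x. c) (sec x v) # ?ws" x] S m sec_scale_in[OF c] by (simp add: sec_scale_def)
        then show "\<omega> x (us @ vscale E c v # ws) = c * \<omega> x (us @ v # ws)"
          using scale[OF S c] \<omega>[of "?us @ sec x v # ?ws" x] S m by simp
      qed
    next
      fix W \<Phi> js assume W: "(W, \<Phi>) \<in> trivs E" and js: "set js \<subseteq> {..<vb_rank E}"
      show "smooth_fun_on (bas E) W (\<lambda>x. \<omega> x (frame_list \<Phi> x js))"
      proof (rule smooth_fun_on_local[OF trivD(1)[OF W]])
        fix x assume x: "x \<in> W"
        obtain b N where b: "supported_in b W" "open N" "x \<in> N" "\<And>y. y \<in> N \<Longrightarrow> b y = 1"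
          using bump_supported[OF trivD(1)[OF W] x] by metis
        \<comment> \<open>Near x the cut-off frame sections coincide with the frame, so there the
          frame component of \<omega> is the smooth function T Vs.\<close>
        define Vs where "Vs = map (\<lambda>i. local_section b W \<Phi> (unit_coords i)) js"
        have Vs: "set Vs \<subseteq> sections E"
          using js by (auto simp: Vs_def intro!: local_section_in[OF W b(1)])
        have eq: "T Vs y = \<omega> y (frame_list \<Phi> y js)" if y: "y \<in> W \<inter> N" for y
        proof -
          have "map (\<lambda>V. V y) Vs = frame_list \<Phi> y js"
            using y b(4) js frame(1)[OF W, of y] unfolding frame_eq_unframe
            by (auto simp: Vs_def local_section_def fibre_closed(4)[of _ y] subset_eq)
          then show ?thesis using \<omega>[OF Vs, of y] by simp
        qed
        have o: "open (W \<inter> N)" using b(2) trivD(1)[OF W] by auto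
        have "smooth_fun_on (bas E) (W \<inter> N) (\<lambda>x. \<omega> x (frame_list \<Phi> x js))"
          by (rule smooth_fun_on_cong[OF o smooth_fun_on_subset[OF smooth[OF Vs]]]) (auto simp: eq)
        then show "\<exists>N. open N \<and> x \<in> N \<and> smooth_fun_on (bas E) (W \<inter> N) (\<lambda>x. \<omega> x (frame_list \<Phi> x js))"
          using b by blast
      qed
    qed
  qed
qed

section \<open>Forms supported in one trivialization\<close>

definition local_form ::
  "('m \<Rightarrow> real) \<Rightarrow> 'm set \<Rightarrow> ('e \<Rightarrow> nat \<Rightarrow> real) \<Rightarrow> nat list \<Rightarrow> ('m, 'e) form" where
  "local_form b W \<Phi> I = (\<lambda>x vs. if x \<in> W then b x * coframe \<Phi> x I vs else 0)"

text \<open>Inside the induction on I runs one on the arguments, for an arbitrary family a, because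
  the antiderivation rule replaces a by its contractions with frame vectors. The coordinates of one
  frame in the other trivialization are the smooth transition functions.\<close>

lemma coframe_smooth:
  assumes W: "(W, \<Phi>) \<in> trivs E" and W': "(W', \<Phi>') \<in> trivs E"
    and I: "set I \<subseteq> {..<vb_rank E}" and js: "set js \<subseteq> {..<vb_rank E}"
  shows "smooth_fun_on (bas E) (W' \<inter> W) (\<lambda>x. coframe \<Phi> x I (frame_list \<Phi>' x js))"
  using I js
proof (induction I arbitrary: js)
  have o: "open (W' \<inter> W)" using trivD(1) W W' by auto
  {
    case Nil
    show ?case by (auto intro!: smooth_fun_on_const o)
  next
    case (Cons i I)
    have i: "i < vb_rank E" using Cons.prems by simp
    have s: "smooth_fun_on (bas E) (W' \<inter> W) (\<lambda>x. coord \<Phi> x i (frame E \<Phi>' k x))" if "k < vb_rank E" for k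
      by (rule smooth_fun_on_cong[OF o trivD(5)[OF W' W i that]])
         (use frame(1)[OF W' _ that] in \<open>auto simp: coord_def\<close>)
    have "smooth_fun_on (bas E) (W' \<inter> W) (\<lambda>x. wedge_one (coord \<Phi> x i) (a x) (frame_list \<Phi>' x js))"
      if "\<And>js. set js \<subseteq> {..<vb_rank E} \<Longrightarrow> smooth_fun_on (bas E) (W' \<inter> W) (\<lambda>x. a x (frame_list \<Phi>' x js))"
        "set js \<subseteq> {..<vb_rank E}" for a js
      using that
    proof (induction js arbitrary: a)
      case Nil
      show ?case by (auto intro!: smooth_fun_on_const o)
    next
      case (Cons k js)
      have "smooth_fun_on (bas E) (W' \<inter> W) (\<lambda>x. wedge_one (coord \<Phi> x i) (\<lambda>ws. a x (frame E \<Phi>' k x # ws)) (frame_list \<Phi>' x js))"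
        using Cons.prems(1)[of "k # _"] Cons.prems(2) by (intro Cons.IH) auto
      then show ?case
        using Cons.prems(1)[of js] Cons.prems(2) s[of k]
        by (simp add: wedge_one_Cons) (intro smooth_fun_on_diff smooth_fun_on_mult o)
    qed
    then show ?case using Cons by simp
  }
qed

lemma local_form_in:
  assumes W: "(W, \<Phi>) \<in> trivs E" and b: "supported_in b W" and I: "set I \<subseteq> {..<vb_rank E}"
  shows "local_form b W \<Phi> I \<in> all_forms E"
proof (rule all_formsI)
  show "local_form b W \<Phi> I x \<in> alt_forms E x" for x
    using alt_forms_scale[OF coframe_alt[OF W, of x I], of "b x"] alt_forms_0
    by (cases "x \<in> W") (auto simp: local_form_def)
  fix W' \<Phi>' js assume W': "(W', \<Phi>') \<in> trivs E" and js: "set js \<subseteq> {..<vb_rank E}"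
  show "smooth_fun_on (bas E) W' (\<lambda>x. local_form b W \<Phi> I x (frame_list \<Phi>' x js))"
    by (rule smooth_fun_on_extend[OF b trivD(1)[OF W] trivD(1)[OF W'] coframe_smooth[OF W W' I js]])
       (auto simp: local_form_def)
qed

text \<open>One factor b makes the coefficient b \<eta>_I globally smooth, the other makes the basis
  form b e^I global; hence b b on the left.\<close>

lemma form_expand:
  assumes W: "(W, \<Phi>) \<in> trivs E" and b: "supported_in b W" and \<eta>: "\<eta> \<in> all_forms E"
  obtains c where "\<And>I. I \<in> frame_indices \<Longrightarrow> smooth_fun_on (bas E) UNIV (c I)"
    "\<And>I x. x \<in> W \<Longrightarrow> c I x = b x * \<eta> x (frame_list \<Phi> x I)"
    "\<And>x vs. b x * b x * \<eta> x vs = (\<Sum>I\<in>frame_indices. c I x * local_form b W \<Phi> I x vs)"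
proof
  let ?c = "\<lambda>I x. if x \<in> W then b x * \<eta> x (frame_list \<Phi> x I) else 0"
  show "smooth_fun_on (bas E) UNIV (?c I)" if "I \<in> frame_indices" for I
    using all_formsD(2)[OF \<eta> W, of I] that
    by - (rule smooth_fun_on_extend[OF b trivD(1)[OF W] open_UNIV, where g = "\<lambda>x. \<eta> x (frame_list \<Phi> x I)"],
         simp_all add: frame_indices_def)
  show "b x * b x * \<eta> x vs = (\<Sum>I\<in>frame_indices. ?c I x * local_form b W \<Phi> I x vs)" for x vs
  proof (cases "x \<in> W")
    case True
    show ?thesis
      using True by (subst alt_expand[OF W True all_formsD(1)[OF \<eta>]])
        (simp add: local_form_def sum_distrib_left algebra_simps)
  next
    case False
    then show ?thesis using supported_in_zero[OF b] by simp
  qed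
qed simp

lemma form_through:
  assumes "a \<in> alt_forms E x"
  obtains \<eta> where "\<eta> \<in> all_forms E" "\<eta> x = a"
proof -
  obtain W \<Phi> where W: "(W, \<Phi>) \<in> trivs E" "x \<in> W" by (rule triv_cover)
  obtain b N where b: "supported_in b W" "x \<in> N" "\<And>y. y \<in> N \<Longrightarrow> b y = 1"
    using bump_supported[OF trivD(1)[OF W(1)] W(2)] by metis
  show ?thesis
  proof (rule that)
    show "(\<lambda>y vs. \<Sum>I\<in>frame_indices. a (frame_list \<Phi> x I) * local_form b W \<Phi> I y vs) \<in> all_forms E"
      by (intro all_forms_sum all_forms_scale local_form_in[OF W(1) b(1)]) (auto simp: frame_indices_def)
    show "(\<lambda>vs. \<Sum>I\<in>frame_indices. a (frame_list \<Phi> x I) * local_form b W \<Phi> I x vs) = a"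
    proof (rule ext)
      show "(\<Sum>I\<in>frame_indices. a (frame_list \<Phi> x I) * local_form b W \<Phi> I x vs) = a vs" for vs
        using b(3)[OF b(2)] W(2) alt_expand[OF W assms, of vs] by (simp add: local_form_def)
    qed
  qed
qed

end

section \<open>Graded operators on forms\<close>

text \<open>Signs with integer exponents depend on parities only, so the sign identities for graded
  brackets are settled by distinguishing even and odd degrees.\<close>

lemma powi_minus_one: "(-1 :: real) powi k = (if even k then 1 else -1)"
  by (simp add: power_int_def even_nat_iff minus_one_power_iff)

context vbundle begin

abbreviation smult_form :: "('m \<Rightarrow> real) \<Rightarrow> ('m, 'e) form \<Rightarrow> ('m, 'e) form" where
  "smult_form f \<eta> \<equiv> (\<lambda>x vs. f x * \<eta> x vs)"

text \<open>Linearity over the reals only, since d is not linear over functions, and on forms only,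
  since \<open>d_rho\<close> is controlled only on \<open>all_forms\<close>.\<close>

definition lin_op :: "(('m, 'e) form \<Rightarrow> ('m, 'e) form) \<Rightarrow> bool" where
  "lin_op F \<longleftrightarrow> (\<forall>\<eta> \<in> all_forms E. F \<eta> \<in> all_forms E) \<and>
     (\<forall>\<eta> \<in> all_forms E. \<forall>\<theta> \<in> all_forms E. \<forall>c.
        F (\<lambda>x vs. \<eta> x vs + c * \<theta> x vs) = (\<lambda>x vs. F \<eta> x vs + c * F \<theta> x vs))"

lemma lin_opI:
  assumes "\<And>\<eta>. \<eta> \<in> all_forms E \<Longrightarrow> F \<eta> \<in> all_forms E"
    "\<And>\<eta> \<theta> c x vs. \<eta> \<in> all_forms E \<Longrightarrow> \<theta> \<in> all_forms E \<Longrightarrow>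
      F (\<lambda>x vs. \<eta> x vs + c * \<theta> x vs) x vs = F \<eta> x vs + c * F \<theta> x vs"
  shows "lin_op F"
  using assms unfolding lin_op_def by (auto simp: fun_eq_iff)

lemma lin_op_closed: "lin_op F \<Longrightarrow> \<eta> \<in> all_forms E \<Longrightarrow> F \<eta> \<in> all_forms E"
  unfolding lin_op_def by blast

lemma lin_op_comb:
  "lin_op F \<Longrightarrow> \<eta> \<in> all_forms E \<Longrightarrow> \<theta> \<in> all_forms E \<Longrightarrow>
    F (\<lambda>x vs. \<eta> x vs + c * \<theta> x vs) = (\<lambda>x vs. F \<eta> x vs + c * F \<theta> x vs)"
  unfolding lin_op_def by blast

lemma lin_op_add:
  "lin_op F \<Longrightarrow> \<eta> \<in> all_forms E \<Longrightarrow> \<theta> \<in> all_forms E \<Longrightarrow>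
    F (\<lambda>x vs. \<eta> x vs + \<theta> x vs) = (\<lambda>x vs. F \<eta> x vs + F \<theta> x vs)"
  using lin_op_comb[of F \<eta> \<theta> 1] by simp

lemma lin_op_diff:
  "lin_op F \<Longrightarrow> \<eta> \<in> all_forms E \<Longrightarrow> \<theta> \<in> all_forms E \<Longrightarrow>
    F (\<lambda>x vs. \<eta> x vs - c * \<theta> x vs) = (\<lambda>x vs. F \<eta> x vs - c * F \<theta> x vs)"
  using lin_op_comb[of F \<eta> \<theta> "-c"] by simp

lemma lin_op_0: "lin_op F \<Longrightarrow> F (\<lambda>x vs. 0) = (\<lambda>x vs. 0)"
  using lin_op_comb[OF _ all_forms_0 all_forms_0, of F "-1"] by simp

lemma lin_op_scale:
  "lin_op F \<Longrightarrow> \<eta> \<in> all_forms E \<Longrightarrow> F (\<lambda>x vs. c * \<eta> x vs) = (\<lambda>x vs. c * F \<eta> x vs)"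
  using lin_op_comb[OF _ all_forms_0, of F \<eta> c] lin_op_0[of F] by simp

lemma lin_op_sum:
  "lin_op F \<Longrightarrow> (\<And>i. i \<in> I \<Longrightarrow> \<eta> i \<in> all_forms E) \<Longrightarrow>
    F (\<lambda>x vs. \<Sum>i\<in>I. \<eta> i x vs) = (\<lambda>x vs. \<Sum>i\<in>I. F (\<eta> i) x vs)"
proof (induction I rule: infinite_finite_induct)
  case (insert j I)
  then show ?case
    using lin_op_add[OF insert(4), of "\<eta> j" "\<lambda>x vs. \<Sum>i\<in>I. \<eta> i x vs"]
    by (simp add: all_forms_sum)
qed (simp_all add: lin_op_0)

lemma lin_op_compose: "lin_op F \<Longrightarrow> lin_op G \<Longrightarrow> lin_op (\<lambda>\<eta>. F (G \<eta>))"
  by (rule lin_opI) (auto simp: lin_op_comb lin_op_closed)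

lemma lin_op_graded_bracket:
  assumes "lin_op F" "lin_op G"
  shows "lin_op (graded_bracket a b F G)"
proof (rule lin_opI)
  show "graded_bracket a b F G \<eta> \<in> all_forms E" if "\<eta> \<in> all_forms E" for \<eta>
    unfolding graded_bracket_def
    by (intro all_forms_diff all_forms_scale lin_op_closed[OF assms(1)] lin_op_closed[OF assms(2)] that)
qed (use assms in \<open>simp add: graded_bracket_def lin_op_comb lin_op_closed algebra_simps\<close>)

lemma lin_op_insert_vector: "V \<in> sections E \<Longrightarrow> lin_op (insert_vector V)"
  by (rule lin_opI) (simp_all add: insert_vector_in, simp add: insert_vector_def)

lemma lin_op_smult: "smooth_fun_on (bas E) UNIV f \<Longrightarrow> lin_op (smult_form f)"
  by (rule lin_opI) (simp_all add: all_forms_smult algebra_simps)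

text \<open>The integers a, b, c only fix signs and are not tied to degrees of F, G, H. Expanded,
  this is an identity between triple compositions; linearity serves to expand the outer operator
  over an inner difference.\<close>

lemma graded_bracket_jacobi:
  assumes "lin_op F" "lin_op G" "lin_op H" "\<eta> \<in> all_forms E"
  shows "graded_bracket (a + b) c (graded_bracket a b F G) H \<eta> x vs =
    graded_bracket a (b + c) F (graded_bracket b c G H) \<eta> x vs +
    (-1) powi (b * c) * graded_bracket (a + c) b (graded_bracket a c F H) G \<eta> x vs"
  using assms
  by (cases "even a"; cases "even b"; cases "even c")
     (simp_all add: graded_bracket_def powi_minus_one lin_op_diff[where c = 1, simplified]
        lin_op_add lin_op_closed)

lemma graded_bracket_anti:
  "graded_bracket a b F G \<eta> x vs = - ((-1) powi (a * b)) * graded_bracket b a G F \<eta> x vs"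
  by (cases "even a"; cases "even b") (simp_all add: graded_bracket_def powi_minus_one)

lemma graded_bracket_compose_right:
  assumes "lin_op F" "lin_op G" "lin_op H" "\<eta> \<in> all_forms E"
  shows "graded_bracket a (b + c) F (\<lambda>\<eta>. G (H \<eta>)) \<eta> x vs =
    graded_bracket a b F G (H \<eta>) x vs + (-1) powi (a * b) * G (graded_bracket a c F H \<eta>) x vs"
  using assms
  by (cases "even a"; cases "even b"; cases "even c")
     (simp_all add: graded_bracket_def powi_minus_one lin_op_diff[where c = 1, simplified]
        lin_op_add lin_op_closed)

lemma graded_bracket_compose_left:
  assumes "lin_op F" "lin_op G" "lin_op H" "\<eta> \<in> all_forms E"
  shows "graded_bracket (a + b) c (\<lambda>\<eta>. F (G \<eta>)) H \<eta> x vs =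
    F (graded_bracket b c G H \<eta>) x vs + (-1) powi (b * c) * graded_bracket a c F H (G \<eta>) x vs"
  using assms
  by (cases "even a"; cases "even b"; cases "even c")
     (simp_all add: graded_bracket_def powi_minus_one lin_op_diff[where c = 1, simplified]
        lin_op_add lin_op_closed)

definition gcomm :: "int \<Rightarrow> int \<Rightarrow> (('m, 'e) form \<Rightarrow> ('m, 'e) form) \<Rightarrow> (('m, 'e) form \<Rightarrow> ('m, 'e) form) \<Rightarrow> bool" where
  "gcomm a b F G \<longleftrightarrow> (\<forall>\<eta> \<in> all_forms E. graded_bracket a b F G \<eta> = (\<lambda>x vs. 0))"

lemma gcommI: "(\<And>\<eta> x vs. \<eta> \<in> all_forms E \<Longrightarrow> graded_bracket a b F G \<eta> x vs = 0) \<Longrightarrow> gcomm a b F G"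
  by (simp add: gcomm_def fun_eq_iff)

lemma gcommD: "gcomm a b F G \<Longrightarrow> \<eta> \<in> all_forms E \<Longrightarrow> graded_bracket a b F G \<eta> = (\<lambda>x vs. 0)"
  by (auto simp: gcomm_def)

lemma graded_bracket_0_left: "lin_op H \<Longrightarrow> \<eta> \<in> all_forms E \<Longrightarrow>
    (\<And>\<eta>. \<eta> \<in> all_forms E \<Longrightarrow> F \<eta> = (\<lambda>x vs. 0)) \<Longrightarrow> graded_bracket a b F H \<eta> x vs = 0"
  by (simp add: graded_bracket_def lin_op_0 lin_op_closed)

lemma graded_bracket_0_right: "lin_op F \<Longrightarrow> \<eta> \<in> all_forms E \<Longrightarrow>
    (\<And>\<eta>. \<eta> \<in> all_forms E \<Longrightarrow> H \<eta> = (\<lambda>x vs. 0)) \<Longrightarrow> graded_bracket a b F H \<eta> x vs = 0"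
  by (simp add: graded_bracket_def lin_op_0 lin_op_closed)

lemma graded_bracket_cong_left: "lin_op H \<Longrightarrow> \<eta> \<in> all_forms E \<Longrightarrow>
    (\<And>\<eta>. \<eta> \<in> all_forms E \<Longrightarrow> F \<eta> = F' \<eta>) \<Longrightarrow> graded_bracket a b F H \<eta> = graded_bracket a b F' H \<eta>"
  by (simp add: graded_bracket_def lin_op_closed)

lemma graded_bracket_cong_right: "lin_op F \<Longrightarrow> \<eta> \<in> all_forms E \<Longrightarrow>
    (\<And>\<eta>. \<eta> \<in> all_forms E \<Longrightarrow> H \<eta> = H' \<eta>) \<Longrightarrow> graded_bracket a b F H \<eta> = graded_bracket a b F H' \<eta>"
  by (simp add: graded_bracket_def lin_op_closed)

text \<open>When F and H commute, one of the three terms of the Jacobi identity drops out; many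
  commutator computations below are one such step. The separate variables e and f let differently
  written degrees such as 1 - p be matched.\<close>

lemma jacobi_right:
  assumes "lin_op F" "lin_op G" "lin_op H" "\<eta> \<in> all_forms E" "gcomm a c F H" "e = a + b" "f = b + c"
  shows "graded_bracket e c (graded_bracket a b F G) H \<eta> x vs = graded_bracket a f F (graded_bracket b c G H) \<eta> x vs"
  using graded_bracket_jacobi[OF assms(1-4), of a b c x vs] gcommD[OF assms(5)] assms(2,4,6,7)
  by (simp add: graded_bracket_0_left)

lemma jacobi_left:
  assumes "lin_op F" "lin_op G" "lin_op H" "\<eta> \<in> all_forms E" "gcomm b c G H" "e = a + b" "f = a + c"
  shows "graded_bracket e c (graded_bracket a b F G) H \<eta> x vs =
    (-1) powi (b * c) * graded_bracket f b (graded_bracket a c F H) G \<eta> x vs"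
  using graded_bracket_jacobi[OF assms(1-4), of a b c x vs] gcommD[OF assms(5)] assms(1,4,6,7)
  by (simp add: graded_bracket_0_right)

lemma gcomm_bracket:
  assumes "lin_op F" "lin_op G" "lin_op H" "gcomm a c F H" "gcomm b c G H" "e = a + b"
  shows "gcomm e c (graded_bracket a b F G) H"
  using jacobi_right[OF assms(1-3) _ assms(4,6)] gcommD[OF assms(5)]
  by (intro gcommI) (simp add: graded_bracket_0_right assms(1))

lemma gcomm_compose:
  assumes "lin_op F" "lin_op G" "lin_op H" "gcomm a c F H" "gcomm b c G H" "e = a + b"
  shows "gcomm e c (\<lambda>\<eta>. F (G \<eta>)) H"
  using graded_bracket_compose_left[OF assms(1-3)] gcommD[OF assms(4)] gcommD[OF assms(5)] assms(1,2,6)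
  by (intro gcommI) (simp add: lin_op_0 lin_op_closed)

section \<open>Degrees of operators and a criterion for their vanishing\<close>

definition vanish_deg :: "int \<Rightarrow> ('m, 'e) form \<Rightarrow> bool" where
  "vanish_deg k \<eta> \<longleftrightarrow> (\<forall>x vs. int (length vs) = k \<longrightarrow> \<eta> x vs = 0)"

text \<open>\<open>F\<close> has degree \<open>e\<close>: the component of degree \<open>k + e\<close> of \<open>F \<eta>\<close> depends only on that of degree \<open>k\<close> of \<open>\<eta>\<close>.\<close>

definition has_deg :: "int \<Rightarrow> (('m, 'e) form \<Rightarrow> ('m, 'e) form) \<Rightarrow> bool" where
  "has_deg e F \<longleftrightarrow> (\<forall>\<eta> \<in> all_forms E. \<forall>k. vanish_deg k \<eta> \<longrightarrow> vanish_deg (k + e) (F \<eta>))"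

lemma has_degD: "has_deg e F \<Longrightarrow> \<eta> \<in> all_forms E \<Longrightarrow> vanish_deg k \<eta> \<Longrightarrow> l = k + e \<Longrightarrow> vanish_deg l (F \<eta>)"
  by (simp add: has_deg_def)

lemma has_deg_compose:
  assumes "lin_op G" "has_deg a F" "has_deg b G" "e = a + b"
  shows "has_deg e (\<lambda>\<eta>. F (G \<eta>))"
  unfolding has_deg_def
proof (intro ballI allI impI)
  fix \<eta> k assume \<eta>: "\<eta> \<in> all_forms E" "vanish_deg k \<eta>"
  show "vanish_deg (k + e) (F (G \<eta>))"
    by (rule has_degD[OF assms(2) lin_op_closed[OF assms(1) \<eta>(1)] has_degD[OF assms(3) \<eta> refl]])
       (simp add: assms(4))
qed

lemma has_deg_bracket:
  assumes "lin_op F" "lin_op G" "has_deg a F" "has_deg b G" "e = a + b"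
  shows "has_deg e (graded_bracket c d F G)"
  using has_deg_compose[OF assms(2,3,4,5)] has_deg_compose[OF assms(1,4,3), of e] assms(5)
  unfolding has_deg_def vanish_deg_def graded_bracket_def by simp

lemma has_deg_insert_vector: "has_deg (-1) (insert_vector V)"
  by (auto simp: has_deg_def vanish_deg_def insert_vector_def)

lemma has_deg_smult: "has_deg 0 (smult_form f)"
  by (auto simp: has_deg_def vanish_deg_def)

text \<open>Inserting sections one after the other reduces every component of \<open>F \<eta>\<close> to that of degree \<open>0\<close>.\<close>

lemma operator_eq_0:
  assumes "lin_op F" "\<And>V. V \<in> sections E \<Longrightarrow> gcomm e (-1) F (insert_vector V)"
    "\<And>\<eta> x. \<eta> \<in> all_forms E \<Longrightarrow> F \<eta> x [] = 0" "\<eta> \<in> all_forms E"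
  shows "F \<eta> x vs = 0"
  using assms(4)
proof (induction vs arbitrary: \<eta>)
  case Nil
  then show ?case by (rule assms(3))
next
  case (Cons v vs)
  show ?case
  proof (cases "v \<in> fibre E x")
    case True
    then obtain V where V: "V \<in> sections E" "V x = v" by (rule section_through)
    have "F (insert_vector V \<eta>) x vs - (-1) powi (- e) * F \<eta> x (v # vs) = 0"
      using gcommD[OF assms(2)[OF V(1)] Cons.prems] V(2)
      by (simp add: graded_bracket_def fun_eq_iff insert_vector_def)
    then show ?thesis
      using Cons.IH[OF insert_vector_in[OF Cons.prems V(1)]] by simp
  next
    case False
    then show ?thesis using alt_formsD(1)[OF all_formsD(1)[OF lin_op_closed[OF assms(1) Cons.prems]]] by simp
  qed
qed

lemma operator_eq:
  assumes "lin_op F" "\<And>V. V \<in> sections E \<Longrightarrow> gcomm e (-1) F (insert_vector V)"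
    "lin_op G" "\<And>V. V \<in> sections E \<Longrightarrow> gcomm e (-1) G (insert_vector V)"
    "\<And>\<eta> x. \<eta> \<in> all_forms E \<Longrightarrow> F \<eta> x [] = G \<eta> x []" "\<eta> \<in> all_forms E"
  shows "F \<eta> = G \<eta>"
proof -
  let ?D = "\<lambda>\<eta> x vs. F \<eta> x vs - G \<eta> x vs"
  have "?D \<eta> x vs = 0" for x vs
  proof (rule operator_eq_0[where F = ?D and e = e])
    show "lin_op ?D"
      by (rule lin_opI)
         (use assms(1,3) in \<open>simp_all add: lin_op_comb all_forms_diff lin_op_closed algebra_simps\<close>)
    show "gcomm e (-1) ?D (insert_vector V)" if V: "V \<in> sections E" for V
    proof (rule gcommI)
      fix \<eta> x vs assume \<eta>: "\<eta> \<in> all_forms E"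
      have "graded_bracket e (-1) ?D (insert_vector V) \<eta> x vs =
          graded_bracket e (-1) F (insert_vector V) \<eta> x vs - graded_bracket e (-1) G (insert_vector V) \<eta> x vs"
        by (simp add: graded_bracket_def insert_vector_def algebra_simps)
      then show "graded_bracket e (-1) ?D (insert_vector V) \<eta> x vs = 0"
        using gcommD[OF assms(2)[OF V] \<eta>] gcommD[OF assms(4)[OF V] \<eta>] by simp
    qed
  qed (use assms in auto)
  then show ?thesis by (auto simp: fun_eq_iff)
qed

section \<open>Multivector fields as operators\<close>

abbreviation frame_indices_of :: "int \<Rightarrow> nat list set" where
  "frame_indices_of p \<equiv> {I \<in> frame_indices. int (length I) = p}"

lemma mv_expand:
  assumes P: "P \<in> multivector_fields E p" and W: "(W, \<Phi>) \<in> trivs E"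
  shows "\<exists>c :: nat list \<Rightarrow> 'm \<Rightarrow> real. (\<forall>I. smooth_fun_on (bas E) W (c I)) \<and>
    (\<forall>x\<in>W. \<forall>a\<in>alt_forms E x. P x a = (\<Sum>I\<in>frame_indices_of p. c I x * a (frame_list \<Phi> x I))) \<and>
    (\<forall>x\<in>W. \<forall>a. a \<notin> alt_forms E x \<longrightarrow> P x a = 0)"
proof -
  from bspec[OF P[unfolded multivector_fields_def mem_Collect_eq] W]
  obtain c where c: "\<forall>I. smooth_fun_on (bas E) W (c I)"
    "\<forall>x\<in>W. P x = (\<lambda>a. \<Sum>I | sorted_wrt (<) I \<and> set I \<subseteq> {..<vb_rank E} \<and> int (length I) = p.
              c I x * decomposable E x (map (\<lambda>i. frame E \<Phi> i x) I) a)"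
    unfolding prod.case by (elim exE conjE)
  then show ?thesis
    by (intro exI[of _ c]) (simp add: decomposable_def frame_indices_def conj_assoc)
qed

lemma mv_out:
  assumes "P \<in> multivector_fields E p" "a \<notin> alt_forms E x"
  shows "P x a = 0"
proof -
  obtain W \<Phi> where W: "(W, \<Phi>) \<in> trivs E" "x \<in> W" by (rule triv_cover)
  obtain c :: "nat list \<Rightarrow> 'm \<Rightarrow> real" where "\<forall>x\<in>W. \<forall>a. a \<notin> alt_forms E x \<longrightarrow> P x a = 0"
    using mv_expand[OF assms(1) W(1)] by (elim exE conjE)
  then show ?thesis using W(2) assms(2) by simp
qed

lemma mv_fieldsI:
  assumes "\<And>W \<Phi>. (W, \<Phi>) \<in> trivs E \<Longrightarrow> \<exists>c :: nat list \<Rightarrow> 'm \<Rightarrow> real. (\<forall>I. smooth_fun_on (bas E) W (c I)) \<and>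
    (\<forall>x\<in>W. \<forall>a\<in>alt_forms E x. P x a = (\<Sum>I\<in>frame_indices_of p. c I x * a (frame_list \<Phi> x I)))"
    "\<And>x a. a \<notin> alt_forms E x \<Longrightarrow> P x a = 0"
  shows "P \<in> multivector_fields E p"
  unfolding multivector_fields_def
proof (rule CollectI, rule ballI, rule prod.split[THEN iffD2], intro allI impI)
  fix wp W \<Phi> assume "wp \<in> trivs E" "wp = (W, \<Phi>)"
  then have "(W, \<Phi>) \<in> trivs E" by simp
  from assms(1)[OF this] obtain c :: "nat list \<Rightarrow> 'm \<Rightarrow> real" where c: "\<forall>I. smooth_fun_on (bas E) W (c I)"
    "\<forall>x\<in>W. \<forall>a\<in>alt_forms E x. P x a = (\<Sum>I\<in>frame_indices_of p. c I x * a (frame_list \<Phi> x I))"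
    by (elim exE conjE)
  have *: "P x a = (\<Sum>I | sorted_wrt (<) I \<and> set I \<subseteq> {..<vb_rank E} \<and> int (length I) = p.
              c I x * decomposable E x (map (\<lambda>i. frame E \<Phi> i x) I) a)" if "x \<in> W" for x a
    using c(2) that assms(2)[of a x] by (cases "a \<in> alt_forms E x") (simp_all add: decomposable_def frame_indices_def conj_assoc)
  show "\<exists>c :: nat list \<Rightarrow> 'm \<Rightarrow> real. (\<forall>I. smooth_fun_on (bas E) W (c I)) \<and>
      (\<forall>x\<in>W. P x = (\<lambda>a. \<Sum>I | sorted_wrt (<) I \<and> set I \<subseteq> {..<vb_rank E} \<and> int (length I) = p.
              c I x * decomposable E x (map (\<lambda>i. frame E \<Phi> i x) I) a))"
    by (intro exI[of _ c] conjI c(1) ballI ext *)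
qed

lemma int_prod_expand:
  assumes P: "P \<in> multivector_fields E p" and W: "(W, \<Phi>) \<in> trivs E"
  shows "\<exists>c :: nat list \<Rightarrow> 'm \<Rightarrow> real. (\<forall>I. smooth_fun_on (bas E) W (c I)) \<and>
    (\<forall>x\<in>W. \<forall>\<eta>\<in>all_forms E. \<forall>ws.
      int_prod P \<eta> x ws = (\<Sum>I\<in>frame_indices_of p. c I x * \<eta> x (frame_list \<Phi> x (rev I) @ ws)))"
proof -
  obtain c :: "nat list \<Rightarrow> 'm \<Rightarrow> real" where c: "\<forall>I. smooth_fun_on (bas E) W (c I)"
    "\<forall>x\<in>W. \<forall>a\<in>alt_forms E x. P x a = (\<Sum>I\<in>frame_indices_of p. c I x * a (frame_list \<Phi> x I))"
    using mv_expand[OF P W] by (elim exE conjE)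
  have *: "int_prod P \<eta> x ws = (\<Sum>I\<in>frame_indices_of p. c I x * \<eta> x (frame_list \<Phi> x (rev I) @ ws))"
    if "x \<in> W" "\<eta> \<in> all_forms E" for x \<eta> ws
    using c(2)[rule_format, OF that(1) alt_forms_rev_suffix[OF all_formsD(1)[OF that(2)]]]
    unfolding int_prod_def by (simp add: rev_map)
  show ?thesis by (intro exI[of _ c] conjI c(1) ballI allI *)
qed

text \<open>At a single point only the lengths of the inserted lists matter, for degrees and for
  signs; the frame itself is forgotten.\<close>

lemma int_prod_at:
  assumes P: "P \<in> multivector_fields E p"
  shows "\<exists>(c :: nat list \<Rightarrow> real) e. (\<forall>I. length (e I) = length I) \<and>
    (\<forall>\<eta>\<in>all_forms E. \<forall>ws. int_prod P \<eta> x ws = (\<Sum>I\<in>frame_indices_of p. c I * \<eta> x (e I @ ws)))"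
proof -
  obtain W \<Phi> where W: "(W, \<Phi>) \<in> trivs E" "x \<in> W" by (rule triv_cover)
  obtain c :: "nat list \<Rightarrow> 'm \<Rightarrow> real" where "\<forall>x\<in>W. \<forall>\<eta>\<in>all_forms E. \<forall>ws.
      int_prod P \<eta> x ws = (\<Sum>I\<in>frame_indices_of p. c I x * \<eta> x (frame_list \<Phi> x (rev I) @ ws))"
    using int_prod_expand[OF P W(1)] by (elim exE conjE)
  then show ?thesis
    using W(2) by (intro exI[of _ "\<lambda>I. c I x"] exI[of _ "\<lambda>I. frame_list \<Phi> x (rev I)"]) simp
qed

lemma lin_op_int_prod:
  assumes P: "P \<in> multivector_fields E p"
  shows "lin_op (int_prod P)"
proof (rule lin_opI)
  fix \<eta> assume \<eta>: "\<eta> \<in> all_forms E"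
  show "int_prod P \<eta> \<in> all_forms E"
  proof (rule all_formsI)
    fix x
    obtain c :: "nat list \<Rightarrow> real" and e where c: "\<forall>\<eta>\<in>all_forms E. \<forall>ws. int_prod P \<eta> x ws =
        (\<Sum>I\<in>frame_indices_of p. c I * \<eta> x (e I @ ws))"
      using int_prod_at[OF P, of x] by (elim exE conjE)
    have "(\<lambda>ws. \<Sum>I\<in>frame_indices_of p. c I * \<eta> x (e I @ ws)) \<in> alt_forms E x"
      by (rule alt_forms_sum, rule alt_forms_scale, rule alt_forms_prefix, rule all_formsD(1)[OF \<eta>])
    moreover have "int_prod P \<eta> x = (\<lambda>ws. \<Sum>I\<in>frame_indices_of p. c I * \<eta> x (e I @ ws))"
      using c \<eta> by blast
    ultimately show "int_prod P \<eta> x \<in> alt_forms E x" by simp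
  next
    fix W \<Phi> js assume W: "(W, \<Phi>) \<in> trivs E" and js: "set js \<subseteq> {..<vb_rank E}"
    obtain c :: "nat list \<Rightarrow> 'm \<Rightarrow> real" where c: "\<forall>I. smooth_fun_on (bas E) W (c I)"
      "\<forall>x\<in>W. \<forall>\<eta>\<in>all_forms E. \<forall>ws. int_prod P \<eta> x ws =
        (\<Sum>I\<in>frame_indices_of p. c I x * \<eta> x (frame_list \<Phi> x (rev I) @ ws))"
      using int_prod_expand[OF P W] by (elim exE conjE)
    have "smooth_fun_on (bas E) W (\<lambda>x. c I x * \<eta> x (frame_list \<Phi> x (rev I @ js)))"
      if "I \<in> frame_indices_of p" for I
      by (rule smooth_fun_on_mult[OF trivD(1)[OF W] c(1)[rule_format] all_formsD(2)[OF \<eta> W]])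
         (use js that in \<open>auto simp: frame_indices_def\<close>)
    then have "smooth_fun_on (bas E) W (\<lambda>x. \<Sum>I\<in>frame_indices_of p. c I x * \<eta> x (frame_list \<Phi> x (rev I @ js)))"
      by (rule smooth_fun_on_sum[OF trivD(1)[OF W]])
    then show "smooth_fun_on (bas E) W (\<lambda>x. int_prod P \<eta> x (frame_list \<Phi> x js))"
      by (rule smooth_fun_on_cong[OF trivD(1)[OF W]]) (simp add: c(2)[rule_format, OF _ \<eta>])
  qed
next
  fix \<eta> \<theta> :: "('m, 'e) form" and c x vs assume \<eta>: "\<eta> \<in> all_forms E" "\<theta> \<in> all_forms E"
  obtain C :: "nat list \<Rightarrow> real" and e where C: "\<forall>\<eta>\<in>all_forms E. \<forall>ws. int_prod P \<eta> x ws =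
      (\<Sum>I\<in>frame_indices_of p. C I * \<eta> x (e I @ ws))"
    using int_prod_at[OF P, of x] by (elim exE conjE)
  note C = C[rule_format]
  have s: "(\<lambda>x vs. \<eta> x vs + c * \<theta> x vs) \<in> all_forms E"
    by (intro all_forms_add all_forms_scale \<eta>)
  show "int_prod P (\<lambda>x vs. \<eta> x vs + c * \<theta> x vs) x vs = int_prod P \<eta> x vs + c * int_prod P \<theta> x vs"
    by (simp add: C[OF s] C[OF \<eta>(1)] C[OF \<eta>(2)] sum.distrib sum_distrib_left algebra_simps)
qed

lemma has_deg_int_prod:
  assumes P: "P \<in> multivector_fields E p"
  shows "has_deg (- p) (int_prod P)"
  unfolding has_deg_def
proof (intro ballI allI impI)
  fix \<eta> k assume \<eta>: "\<eta> \<in> all_forms E" "vanish_deg k \<eta>"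
  show "vanish_deg (k + - p) (int_prod P \<eta>)"
    unfolding vanish_deg_def
  proof (intro allI impI)
    fix x and vs :: "'e list" assume l: "int (length vs) = k + - p"
    obtain c :: "nat list \<Rightarrow> real" and e where c: "\<forall>I. length (e I) = length I"
      "\<forall>\<eta>\<in>all_forms E. \<forall>ws. int_prod P \<eta> x ws = (\<Sum>I\<in>frame_indices_of p. c I * \<eta> x (e I @ ws))"
      using int_prod_at[OF P, of x] by (elim exE conjE)
    show "int_prod P \<eta> x vs = 0"
      unfolding c(2)[rule_format, OF \<eta>(1)] using \<eta>(2) l c(1) by (intro sum.neutral) (auto simp: vanish_deg_def)
  qed
qed

text \<open>Both compositions insert the same two blocks of p and q vectors in opposite orders, and
  exchanging the blocks costs (-1)^(pq).\<close>

lemma int_prod_commute: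
  assumes P: "P \<in> multivector_fields E p" and Q: "Q \<in> multivector_fields E q"
  shows "gcomm (- p) (- q) (int_prod P) (int_prod Q)"
proof (rule gcommI)
  fix \<eta> x ws assume \<eta>: "\<eta> \<in> all_forms E"
  let ?I = frame_indices_of
  obtain c :: "nat list \<Rightarrow> real" and e where lc: "\<forall>I. length (e I) = length I" and
    c: "\<forall>\<eta>\<in>all_forms E. \<forall>ws. int_prod P \<eta> x ws = (\<Sum>I\<in>?I p. c I * \<eta> x (e I @ ws))"
    using int_prod_at[OF P, of x] by (elim exE conjE)
  obtain d :: "nat list \<Rightarrow> real" and e' where ld: "\<forall>I. length (e' I) = length I" and
    d: "\<forall>\<eta>\<in>all_forms E. \<forall>ws. int_prod Q \<eta> x ws = (\<Sum>I\<in>?I q. d I * \<eta> x (e' I @ ws))"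
    using int_prod_at[OF Q, of x] by (elim exE conjE)
  note c = c[rule_format] and d = d[rule_format]
  note i = lin_op_closed[OF lin_op_int_prod[OF P] \<eta>] lin_op_closed[OF lin_op_int_prod[OF Q] \<eta>]
  have "int_prod P (int_prod Q \<eta>) x ws = (\<Sum>I\<in>?I p. \<Sum>J\<in>?I q. c I * d J * \<eta> x (e' J @ e I @ ws))"
    by (simp add: c[OF i(2)] d[OF \<eta>] sum_distrib_left algebra_simps)
  also have "\<dots> = (\<Sum>I\<in>?I p. \<Sum>J\<in>?I q. (-1) powi (- p * - q) * (c I * d J * \<eta> x (e I @ e' J @ ws)))"
  proof (intro sum.cong refl)
    fix I J assume "I \<in> ?I p" "J \<in> ?I q"
    then have "\<eta> x (e' J @ e I @ ws) = (-1) powi (- p * - q) * \<eta> x (e I @ e' J @ ws)"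
      using alt_forms_block[OF all_formsD(1)[OF \<eta>], of x "e' J" "e I" ws]
      using lc ld by (auto simp: powi_minus_one minus_one_power_iff)
    then show "c I * d J * \<eta> x (e' J @ e I @ ws) = (-1) powi (- p * - q) * (c I * d J * \<eta> x (e I @ e' J @ ws))"
      by simp
  qed
  also have "\<dots> = (-1) powi (- p * - q) * (\<Sum>J\<in>?I q. \<Sum>I\<in>?I p. c I * d J * \<eta> x (e I @ e' J @ ws))"
    by (subst sum.swap) (simp add: sum_distrib_left)
  also have "\<dots> = (-1) powi (- p * - q) * int_prod Q (int_prod P \<eta>) x ws"
    by (simp add: d[OF i(1)] c[OF \<eta>] sum_distrib_left algebra_simps)
  finally show "graded_bracket (- p) (- q) (int_prod P) (int_prod Q) \<eta> x ws = 0"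
    by (simp add: graded_bracket_def)
qed

lemma sec_mv_in:
  assumes V: "V \<in> sections E"
  shows "sec_mv E V \<in> multivector_fields E 1"
proof (rule mv_fieldsI)
  show "sec_mv E V x a = 0" if "a \<notin> alt_forms E x" for x a
    using that by (simp add: sec_mv_def decomposable_def)
  fix W \<Phi> assume W: "(W, \<Phi>) \<in> trivs E"
  \<comment> \<open>Smooth coefficients are demanded at every list I, also at those that do not
    occur in the sum; hence the default 0 when \<open>hd I\<close> is not an index of the
    frame.\<close>
  let ?c = "\<lambda>I x. if hd I < vb_rank E then \<Phi> (V x) (hd I) else 0"
  have "frame_indices_of 1 = (\<lambda>i. [i]) ` {..<vb_rank E}"
    by (auto simp: frame_indices_def length_Suc_conv)
  then have s: "(\<Sum>I\<in>frame_indices_of 1. g I) = (\<Sum>i<vb_rank E. g [i])" for g :: "nat list \<Rightarrow> real"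
    by (simp add: sum.reindex inj_on_def)
  have "sec_mv E V x a = (\<Sum>I\<in>frame_indices_of 1. ?c I x * a (frame_list \<Phi> x I))"
    if "x \<in> W" "a \<in> alt_forms E x" for x a
  proof -
    have "a [V x] = (\<Sum>i<vb_rank E. \<Phi> (V x) i * a [frame E \<Phi> i x])"
      using alt_formsD(2)[OF that(2), of "[]" _ _ "[]"] alt_formsD(3)[OF that(2), of "[]" _ "[]"]
      by (intro linear_expand[OF W that(1) sectionsD(1)[OF V]]) auto
    then show ?thesis
      unfolding s using that by (simp add: sec_mv_def decomposable_def)
  qed
  moreover have "smooth_fun_on (bas E) W (?c I)" for I
    using sectionsD(2)[OF V W] smooth_fun_on_const[OF trivD(1)[OF W], of 0] by (cases "hd I < vb_rank E") simp_all
  ultimately show "\<exists>c. (\<forall>I. smooth_fun_on (bas E) W (c I)) \<and> (\<forall>x\<in>W. \<forall>a\<in>alt_forms E x.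
      sec_mv E V x a = (\<Sum>I\<in>frame_indices_of 1. c I x * a (frame_list \<Phi> x I)))"
    by (intro exI[of _ ?c]) blast
qed

lemma fun_mv_in:
  assumes f: "smooth_fun_on (bas E) UNIV f"
  shows "fun_mv E f \<in> multivector_fields E 0"
proof (rule mv_fieldsI)
  show "fun_mv E f x a = 0" if "a \<notin> alt_forms E x" for x a
    using that by (simp add: fun_mv_def decomposable_def)
  fix W \<Phi> assume W: "(W, \<Phi>) \<in> trivs E"
  have "frame_indices_of 0 = {[]}"
    by (auto simp: frame_indices_def)
  moreover have "smooth_fun_on (bas E) W f" using f by (rule smooth_fun_on_subset) simp
  ultimately show "\<exists>c. (\<forall>I. smooth_fun_on (bas E) W (c I)) \<and> (\<forall>x\<in>W. \<forall>a\<in>alt_forms E x.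
      fun_mv E f x a = (\<Sum>I\<in>frame_indices_of 0. c I x * a (frame_list \<Phi> x I)))"
    by (intro exI[of _ "\<lambda>I. f"]) (simp add: fun_mv_def decomposable_def)
qed

lemma int_prod_sec_mv: "\<eta> \<in> all_forms E \<Longrightarrow> int_prod (sec_mv E V) \<eta> = insert_vector V \<eta>"
  by (simp add: int_prod_def sec_mv_def decomposable_def insert_vector_def alt_forms_rev_suffix all_formsD fun_eq_iff)

lemma int_prod_fun_mv: "\<eta> \<in> all_forms E \<Longrightarrow> int_prod (fun_mv E f) \<eta> = smult_form f \<eta>"
  by (simp add: int_prod_def fun_mv_def decomposable_def alt_forms_rev_suffix all_formsD fun_eq_iff)

section \<open>Characterization of interior products among operators\<close>

lemma gcomm_cong_right:
  "gcomm a b F G \<Longrightarrow> lin_op F \<Longrightarrow> (\<And>\<eta>. \<eta> \<in> all_forms E \<Longrightarrow> G \<eta> = G' \<eta>) \<Longrightarrow> gcomm a b F G'"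
  using graded_bracket_cong_right[of F _ G G'] by (simp add: gcomm_def)

text \<open>Linearity over the smooth functions is expressed as commutation with multiplications, so
  that the rules for \<open>gcomm\<close> treat functions and sections alike.\<close>

definition mv_op :: "int \<Rightarrow> (('m, 'e) form \<Rightarrow> ('m, 'e) form) \<Rightarrow> bool" where
  "mv_op m G \<longleftrightarrow> lin_op G \<and> has_deg (- m) G \<and>
     (\<forall>V \<in> sections E. gcomm (- m) (-1) G (insert_vector V)) \<and>
     (\<forall>f. smooth_fun_on (bas E) UNIV f \<longrightarrow> gcomm (- m) 0 G (smult_form f))"

lemma mv_opD:
  assumes "mv_op m G"
  shows "lin_op G" "has_deg (- m) G" "V \<in> sections E \<Longrightarrow> gcomm (- m) (-1) G (insert_vector V)"
    "smooth_fun_on (bas E) UNIV f \<Longrightarrow> gcomm (- m) 0 G (smult_form f)"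
  using assms unfolding mv_op_def by simp_all

lemma mv_op_int_prod:
  assumes P: "P \<in> multivector_fields E p"
  shows "mv_op p (int_prod P)"
  unfolding mv_op_def
proof (intro conjI ballI allI impI)
  show l: "lin_op (int_prod P)" by (rule lin_op_int_prod[OF P])
  show "has_deg (- p) (int_prod P)" by (rule has_deg_int_prod[OF P])
  show "gcomm (- p) (-1) (int_prod P) (insert_vector V)" if "V \<in> sections E" for V
    by (rule gcomm_cong_right[OF int_prod_commute[OF P sec_mv_in[OF that]] l int_prod_sec_mv])
  show "gcomm (- p) 0 (int_prod P) (smult_form f)" if "smooth_fun_on (bas E) UNIV f" for f
    using gcomm_cong_right[OF int_prod_commute[OF P fun_mv_in[OF that]] l int_prod_fun_mv] by simp
qed

lemma mv_op_smult:
  assumes "mv_op m G" "smooth_fun_on (bas E) UNIV f" "\<eta> \<in> all_forms E"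
  shows "G (smult_form f \<eta>) = smult_form f (G \<eta>)"
  using gcommD[OF mv_opD(4)[OF assms(1,2)] assms(3)] by (simp add: graded_bracket_def fun_eq_iff)

text \<open>Expanding b b \<eta> into global basis forms and pulling out the functions leaves only
  the values of the coefficients at x. For indices of length m these are 0 by assumption; for the
  others the degree of G removes the component on the empty list.\<close>

lemma mv_op_local:
  assumes G: "mv_op m G" and \<eta>: "\<eta> \<in> all_forms E" and z: "\<And>vs. int (length vs) = m \<Longrightarrow> \<eta> x vs = 0"
  shows "G \<eta> x [] = 0"
proof -
  note lin = mv_opD(1)[OF G]
  obtain W \<Phi> where W: "(W, \<Phi>) \<in> trivs E" "x \<in> W" by (rule triv_cover)
  obtain b N where b: "supported_in b W" "x \<in> N" "\<And>y. y \<in> N \<Longrightarrow> b y = 1"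
    using bump_supported[OF trivD(1)[OF W(1)] W(2)] by metis
  have bx: "b x = 1" using b by simp
  have sb: "smooth_fun_on (bas E) UNIV (\<lambda>x. b x * b x)"
    using b(1) by (intro smooth_fun_on_mult) (auto simp: supported_in_def)
  obtain c where c: "\<And>I. I \<in> frame_indices \<Longrightarrow> smooth_fun_on (bas E) UNIV (c I)"
    "\<And>I x. x \<in> W \<Longrightarrow> c I x = b x * \<eta> x (frame_list \<Phi> x I)"
    "\<And>x vs. b x * b x * \<eta> x vs = (\<Sum>I\<in>frame_indices. c I x * local_form b W \<Phi> I x vs)"
    using form_expand[OF W(1) b(1) \<eta>] by blast
  have lf: "local_form b W \<Phi> I \<in> all_forms E" if "I \<in> frame_indices" for I
    using that by (intro local_form_in[OF W(1) b(1)]) (simp add: frame_indices_def)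
  have "G \<eta> x [] = smult_form (\<lambda>x. b x * b x) (G \<eta>) x []" by (simp add: bx)
  also have "\<dots> = G (smult_form (\<lambda>x. b x * b x) \<eta>) x []"
    by (simp only: mv_op_smult[OF G sb \<eta>])
  also have "\<dots> = G (\<lambda>x vs. \<Sum>I\<in>frame_indices. smult_form (c I) (local_form b W \<Phi> I) x vs) x []"
    by (simp only: c(3))
  also have "\<dots> = (\<Sum>I\<in>frame_indices. G (smult_form (c I) (local_form b W \<Phi> I)) x [])"
    by (subst lin_op_sum[OF lin]) (simp_all add: all_forms_smult lf c(1))
  also have "\<dots> = (\<Sum>I\<in>frame_indices. c I x * G (local_form b W \<Phi> I) x [])"
    by (intro sum.cong refl) (simp add: mv_op_smult[OF G c(1) lf])
  also have "\<dots> = 0"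
  proof (intro sum.neutral ballI)
    fix I assume I: "I \<in> frame_indices"
    show "c I x * G (local_form b W \<Phi> I) x [] = 0"
    proof (cases "int (length I) = m")
      case True
      then show ?thesis using c(2)[OF W(2), of I] z by simp
    next
      case False
      then have "vanish_deg m (local_form b W \<Phi> I)"
        by (auto simp: vanish_deg_def local_form_def coframe_degree)
      then have "vanish_deg 0 (G (local_form b W \<Phi> I))"
        by (rule has_degD[OF mv_opD(2)[OF G] lf[OF I]]) simp
      then show ?thesis by (simp add: vanish_deg_def)
    qed
  qed
  finally show ?thesis .
qed

lemma all_forms_rev:
  assumes \<eta>: "\<eta> \<in> all_forms E"
  shows "(\<lambda>x vs. \<eta> x (rev vs)) \<in> all_forms E"
proof (rule all_formsI)
  show "(\<lambda>vs. \<eta> x (rev vs)) \<in> alt_forms E x" for x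
    by (rule alt_forms_rev[OF all_formsD(1)[OF \<eta>]])
  show "smooth_fun_on (bas E) W (\<lambda>x. \<eta> x (rev (frame_list \<Phi> x js)))"
    if "(W, \<Phi>) \<in> trivs E" "set js \<subseteq> {..<vb_rank E}" for W \<Phi> js
    using all_formsD(2)[OF \<eta> that(1), of "rev js"] that(2) by (simp add: rev_map)
qed

text \<open>A multivector at x is a functional on \<open>alt_forms\<close>. Its value on a must be
  the degree 0 component at x of G applied to a form that extends a with reversed arguments; this
  reversal cancels the one in \<open>int_prod\<close>.\<close>

lemma multivector_of_operator:
  assumes G: "mv_op m G"
  obtains R where "R \<in> multivector_fields E m" "\<And>\<eta>. \<eta> \<in> all_forms E \<Longrightarrow> int_prod R \<eta> = G \<eta>"
proof -
  note lin = mv_opD(1)[OF G]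
  define ex where "ex x a = (SOME \<eta>. \<eta> \<in> all_forms E \<and> \<eta> x = (\<lambda>vs. a (rev vs)))" for x and a :: "'e list \<Rightarrow> real"
  have ex: "ex x a \<in> all_forms E" "ex x a x = (\<lambda>vs. a (rev vs))" if a: "a \<in> alt_forms E x" for x a
  proof -
    obtain \<eta> where "\<eta> \<in> all_forms E" "\<eta> x = (\<lambda>vs. a (rev vs))"
      by (rule form_through[OF alt_forms_rev[OF a]])
    then have "\<exists>\<eta>. \<eta> \<in> all_forms E \<and> \<eta> x = (\<lambda>vs. a (rev vs))" by blast
    from someI_ex[OF this] show "ex x a \<in> all_forms E" "ex x a x = (\<lambda>vs. a (rev vs))"
      by (simp_all add: ex_def)
  qed
  define R where "R x a = (if a \<in> alt_forms E x then G (ex x a) x [] else 0)" for x a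
  \<comment> \<open>Independence of the chosen extension: G is local and the difference of two
    extensions vanishes at x.\<close>
  have R: "R x a = G \<eta> x []" if a: "a \<in> alt_forms E x" and \<eta>: "\<eta> \<in> all_forms E"
    and e: "\<And>vs. \<eta> x vs = a (rev vs)" for x a \<eta>
  proof -
    have "G (\<lambda>y vs. ex x a y vs - 1 * \<eta> y vs) x [] = 0"
      by (rule mv_op_local[OF G]) (simp_all add: all_forms_diff ex[OF a] \<eta> e)
    then have "G (ex x a) x [] = G \<eta> x []"
      by (subst (asm) lin_op_diff[OF lin ex(1)[OF a] \<eta>]) simp
    then show ?thesis using a by (simp add: R_def)
  qed
  have Rout: "R x a = 0" if "a \<notin> alt_forms E x" for x a using that by (simp add: R_def)
  have RA: "R \<in> multivector_fields E m"
  proof (rule mv_fieldsI[OF _ Rout])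
    fix W \<Phi> assume W: "(W, \<Phi>) \<in> trivs E"
    note oW = trivD(1)[OF W]
    \<comment> \<open>The coefficients are the values of R on the dual basis. Near each point they
      coincide with the smooth function that G produces from a cut-off basis form.\<close>
    let ?c = "\<lambda>I x. if I \<in> frame_indices then R x (coframe \<Phi> x I) else 0"
    let ?l = "\<lambda>b I x vs. local_form b W \<Phi> I x (rev vs)"
    have lf: "?l b I \<in> all_forms E" if "I \<in> frame_indices" "supported_in b W" for I b
      using that by (intro all_forms_rev local_form_in[OF W]) (simp_all add: frame_indices_def)
    have val: "R x (coframe \<Phi> x I) = G (?l b I) x []"
      if "x \<in> W" "b x = 1" "I \<in> frame_indices" "supported_in b W" for x I b
      using that by (intro R coframe_alt[OF W] lf) (simp_all add: local_form_def)
    have sm: "smooth_fun_on (bas E) W (?c I)" for I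
    proof (cases "I \<in> frame_indices")
      case True
      have "smooth_fun_on (bas E) W (\<lambda>x. R x (coframe \<Phi> x I))"
      proof (rule smooth_fun_on_local[OF oW])
        fix x assume x: "x \<in> W"
        obtain b N where b: "supported_in b W" "open N" "x \<in> N" "\<And>y. y \<in> N \<Longrightarrow> b y = 1"
          using bump_supported[OF oW x] by metis
        have s: "smooth_fun_on (bas E) W (\<lambda>x. G (?l b I) x [])"
          using all_formsD(2)[OF lin_op_closed[OF lin lf[OF True b(1)]] W, of "[]"] by simp
        have "smooth_fun_on (bas E) (W \<inter> N) (\<lambda>x. R x (coframe \<Phi> x I))"
        proof (rule smooth_fun_on_cong)
          show "open (W \<inter> N)" using oW b by auto
          show "smooth_fun_on (bas E) (W \<inter> N) (\<lambda>x. G (?l b I) x [])"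
            by (rule smooth_fun_on_subset[OF s]) simp
          show "G (?l b I) y [] = R y (coframe \<Phi> y I)" if "y \<in> W \<inter> N" for y
            using val[of y b I] that b True by simp
        qed
        with b show "\<exists>T. open T \<and> x \<in> T \<and> smooth_fun_on (bas E) (W \<inter> T) (\<lambda>x. R x (coframe \<Phi> x I))"
          by blast
      qed
      then show ?thesis using True by simp
    next
      case False
      then show ?thesis using smooth_fun_on_const[OF oW] by simp
    qed
    have ex: "R x a = (\<Sum>I\<in>frame_indices_of m. ?c I x * a (frame_list \<Phi> x I))"
      if x: "x \<in> W" and a: "a \<in> alt_forms E x" for x a
    proof -
      obtain b N where b: "supported_in b W" "x \<in> N" "\<And>y. y \<in> N \<Longrightarrow> b y = 1"
        using bump_supported[OF oW x] by metis
      have bx: "b x = 1" using b by simp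
      have sf: "(\<lambda>y vs. a (frame_list \<Phi> x I) * ?l b I y vs) \<in> all_forms E" if "I \<in> frame_indices" for I
        by (rule all_forms_scale[OF lf[OF that b(1)]])
      have "R x a = G (\<lambda>y vs. \<Sum>I\<in>frame_indices. a (frame_list \<Phi> x I) * ?l b I y vs) x []"
      proof (rule R[OF a])
        show "(\<lambda>y vs. \<Sum>I\<in>frame_indices. a (frame_list \<Phi> x I) * ?l b I y vs) \<in> all_forms E"
          using sf by (rule all_forms_sum)
        show "(\<Sum>I\<in>frame_indices. a (frame_list \<Phi> x I) * ?l b I x vs) = a (rev vs)" for vs
          using alt_expand[OF W x a, of "rev vs"] x bx by (simp add: local_form_def)
      qed
      also have "\<dots> = (\<Sum>I\<in>frame_indices. a (frame_list \<Phi> x I) * G (?l b I) x [])"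
      proof -
        have "G (\<lambda>y vs. \<Sum>I\<in>frame_indices. a (frame_list \<Phi> x I) * ?l b I y vs) =
            (\<lambda>y vs. \<Sum>I\<in>frame_indices. G (\<lambda>y vs. a (frame_list \<Phi> x I) * ?l b I y vs) y vs)"
          by (rule lin_op_sum[OF lin sf])
        then show ?thesis
          by (simp add: lin_op_scale[OF lin lf[OF _ b(1)]])
      qed
      also have "\<dots> = (\<Sum>I\<in>frame_indices_of m. a (frame_list \<Phi> x I) * G (?l b I) x [])"
      proof (rule sum.mono_neutral_right[OF finite_frame_indices], blast, rule ballI)
        fix I assume I: "I \<in> frame_indices - frame_indices_of m"
        then have "G (?l b I) x [] = 0"
          by (intro mv_op_local[OF G] lf b(1)) (auto simp: local_form_def coframe_degree)
        then show "a (frame_list \<Phi> x I) * G (?l b I) x [] = 0" by simp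
      qed
      also have "\<dots> = (\<Sum>I\<in>frame_indices_of m. ?c I x * a (frame_list \<Phi> x I))"
        using val[OF x bx _ b(1)] by (intro sum.cong refl) simp
      finally show ?thesis .
    qed
    show "\<exists>c. (\<forall>I. smooth_fun_on (bas E) W (c I)) \<and>
        (\<forall>x\<in>W. \<forall>a\<in>alt_forms E x. R x a = (\<Sum>I\<in>frame_indices_of m. c I x * a (frame_list \<Phi> x I)))"
      by (intro exI[of _ ?c] conjI allI ballI sm ex)
  qed
  show ?thesis
  proof (rule that[OF RA])
    fix \<eta> assume \<eta>: "\<eta> \<in> all_forms E"
    \<comment> \<open>The degree 0 components agree by construction; as both operators
      graded-commute with every i(V), all components agree.\<close>
    show "int_prod R \<eta> = G \<eta>"
    proof (rule operator_eq[OF lin_op_int_prod[OF RA] mv_opD(3)[OF mv_op_int_prod[OF RA]] lin mv_opD(3)[OF G] _ \<eta>])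
      show "int_prod R \<eta> x [] = G \<eta> x []" if "\<eta> \<in> all_forms E" for \<eta> x
        unfolding int_prod_def using that by (intro R) (simp_all add: alt_forms_rev all_formsD)
    qed
  qed
qed

text \<open>The degree 0 components of i(S) \<eta> already recover S on every alternating form.
  Asking of S only that it vanish elsewhere makes the criterion applicable to a candidate such as
  \<open>wedge_mv\<close>, whose smoothness is still to be shown.\<close>

lemma mv_eqI:
  assumes R: "R \<in> multivector_fields E m" and S: "\<And>x a. a \<notin> alt_forms E x \<Longrightarrow> S x a = 0"
    and e: "\<And>\<eta>. \<eta> \<in> all_forms E \<Longrightarrow> int_prod S \<eta> = int_prod R \<eta>"
  shows "S = R"
proof (intro ext)
  fix x a
  show "S x a = R x a"
  proof (cases "a \<in> alt_forms E x")
    case True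
    obtain \<eta> where \<eta>: "\<eta> \<in> all_forms E" "\<eta> x = (\<lambda>vs. a (rev vs))"
      by (rule form_through[OF alt_forms_rev[OF True]])
    have "int_prod S \<eta> x [] = int_prod R \<eta> x []" by (simp only: e[OF \<eta>(1)])
    then show ?thesis by (simp add: int_prod_def \<eta>(2))
  next
    case False
    then show ?thesis by (simp add: S mv_out[OF R])
  qed
qed

section \<open>Sums, multiples and exterior products of multivector fields\<close>

lemma add_mv_in:
  assumes "P \<in> multivector_fields E p" "Q \<in> multivector_fields E p"
  shows "add_mv P Q \<in> multivector_fields E p"
proof (rule mv_fieldsI)
  show "add_mv P Q x a = 0" if "a \<notin> alt_forms E x" for x a
    using that assms by (simp add: add_mv_def mv_out)
  fix W \<Phi> assume W: "(W, \<Phi>) \<in> trivs E"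
  obtain c :: "nat list \<Rightarrow> 'm \<Rightarrow> real" where c: "\<forall>I. smooth_fun_on (bas E) W (c I)"
    "\<forall>x\<in>W. \<forall>a\<in>alt_forms E x. P x a = (\<Sum>I\<in>frame_indices_of p. c I x * a (frame_list \<Phi> x I))"
    using mv_expand[OF assms(1) W] by (elim exE conjE)
  obtain d :: "nat list \<Rightarrow> 'm \<Rightarrow> real" where d: "\<forall>I. smooth_fun_on (bas E) W (d I)"
    "\<forall>x\<in>W. \<forall>a\<in>alt_forms E x. Q x a = (\<Sum>I\<in>frame_indices_of p. d I x * a (frame_list \<Phi> x I))"
    using mv_expand[OF assms(2) W] by (elim exE conjE)
  show "\<exists>c. (\<forall>I. smooth_fun_on (bas E) W (c I)) \<and> (\<forall>x\<in>W. \<forall>a\<in>alt_forms E x.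
      add_mv P Q x a = (\<Sum>I\<in>frame_indices_of p. c I x * a (frame_list \<Phi> x I)))"
    using c d by (intro exI[of _ "\<lambda>I x. c I x + d I x"])
      (simp add: smooth_fun_on_add trivD(1)[OF W] add_mv_def sum.distrib algebra_simps)
qed

lemma scale_mv_in:
  assumes "P \<in> multivector_fields E p"
  shows "scale_mv r P \<in> multivector_fields E p"
proof (rule mv_fieldsI)
  show "scale_mv r P x a = 0" if "a \<notin> alt_forms E x" for x a
    using that assms by (simp add: scale_mv_def mv_out)
  fix W \<Phi> assume W: "(W, \<Phi>) \<in> trivs E"
  obtain c :: "nat list \<Rightarrow> 'm \<Rightarrow> real" where c: "\<forall>I. smooth_fun_on (bas E) W (c I)"
    "\<forall>x\<in>W. \<forall>a\<in>alt_forms E x. P x a = (\<Sum>I\<in>frame_indices_of p. c I x * a (frame_list \<Phi> x I))"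
    using mv_expand[OF assms(1) W] by (elim exE conjE)
  show "\<exists>c. (\<forall>I. smooth_fun_on (bas E) W (c I)) \<and> (\<forall>x\<in>W. \<forall>a\<in>alt_forms E x.
      scale_mv r P x a = (\<Sum>I\<in>frame_indices_of p. c I x * a (frame_list \<Phi> x I)))"
    using c by (intro exI[of _ "\<lambda>I x. r * c I x"])
      (simp add: smooth_fun_on_mult smooth_fun_on_const trivD(1)[OF W] scale_mv_def sum_distrib_left mult.assoc)
qed

lemma int_prod_add_mv: "int_prod (add_mv P Q) \<eta> = (\<lambda>x vs. int_prod P \<eta> x vs + int_prod Q \<eta> x vs)"
  by (simp add: int_prod_def add_mv_def)

lemma int_prod_scale_mv: "int_prod (scale_mv c P) \<eta> = (\<lambda>x vs. c * int_prod P \<eta> x vs)"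
  by (simp add: int_prod_def scale_mv_def)

lemma int_prod_wedge_mv:
  assumes "\<eta> \<in> all_forms E"
  shows "int_prod (wedge_mv E P Q) \<eta> = int_prod P (int_prod Q \<eta>)"
  using alt_forms_rev_suffix[OF all_formsD(1)[OF assms]]
  by (simp add: int_prod_def wedge_mv_def fun_eq_iff)

text \<open>Joining increasing index lists need not give increasing ones, so an expansion in frames
  would involve sorting and signs. Instead i(P) o i(Q) has the characteristic properties of an
  interior product, and its multivector field turns out to be the exterior product.\<close>

lemma wedge_mv_in:
  assumes P: "P \<in> multivector_fields E p" and Q: "Q \<in> multivector_fields E q"
  shows "wedge_mv E P Q \<in> multivector_fields E (p + q)"
proof -
  note p = mv_opD[OF mv_op_int_prod[OF P]] and q = mv_opD[OF mv_op_int_prod[OF Q]]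
  have op: "mv_op (p + q) (\<lambda>\<eta>. int_prod P (int_prod Q \<eta>))"
    unfolding mv_op_def
  proof (intro conjI ballI allI impI)
    show "lin_op (\<lambda>\<eta>. int_prod P (int_prod Q \<eta>))" by (rule lin_op_compose[OF p(1) q(1)])
    show "has_deg (- (p + q)) (\<lambda>\<eta>. int_prod P (int_prod Q \<eta>))"
      by (rule has_deg_compose[OF q(1) p(2) q(2)]) simp
    show "gcomm (- (p + q)) (-1) (\<lambda>\<eta>. int_prod P (int_prod Q \<eta>)) (insert_vector V)" if "V \<in> sections E" for V
      by (rule gcomm_compose[OF p(1) q(1) lin_op_insert_vector[OF that] p(3)[OF that] q(3)[OF that]]) simp
    show "gcomm (- (p + q)) 0 (\<lambda>\<eta>. int_prod P (int_prod Q \<eta>)) (smult_form f)"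
      if "smooth_fun_on (bas E) UNIV f" for f
      by (rule gcomm_compose[OF p(1) q(1) lin_op_smult[OF that] p(4)[OF that] q(4)[OF that]]) simp
  qed
  obtain R where R: "R \<in> multivector_fields E (p + q)"
    "\<And>\<eta>. \<eta> \<in> all_forms E \<Longrightarrow> int_prod R \<eta> = int_prod P (int_prod Q \<eta>)"
    using multivector_of_operator[OF op] by blast
  have "wedge_mv E P Q = R"
  proof (rule mv_eqI[OF R(1)])
    show "wedge_mv E P Q x a = 0" if "a \<notin> alt_forms E x" for x a
      using that by (simp add: wedge_mv_def)
  qed (simp add: int_prod_wedge_mv R(2))
  then show ?thesis using R(1) by simp
qed

end

section \<open>The differential of a Lie algebroid\<close>

locale algebroid =
  fixes L :: "('m :: {t2_space, second_countable_topology}, 'e) lie_algebroid"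
  assumes is_lie_algebroid: "is_lie_algebroid L"

sublocale algebroid \<subseteq> vbundle L
  using is_lie_algebroid by unfold_locales (simp add: is_lie_algebroid_def)

context algebroid begin

abbreviation bra :: "('m \<Rightarrow> 'e) \<Rightarrow> ('m \<Rightarrow> 'e) \<Rightarrow> 'm \<Rightarrow> 'e" where
  "bra \<equiv> lie_bracket L"

abbreviation smooth :: "('m \<Rightarrow> real) \<Rightarrow> bool" where
  "smooth f \<equiv> smooth_fun_on (bas L) UNIV f"

lemma bracket_parts:
  shows bra_closed: "\<forall>s \<in> sections L. \<forall>t \<in> sections L. bra s t \<in> sections L"
    and bra_adds: "\<forall>s \<in> sections L. \<forall>t \<in> sections L. \<forall>u \<in> sections L.
        bra (sec_add L s t) u = sec_add L (bra s u) (bra t u) \<and>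
        bra u (sec_add L s t) = sec_add L (bra u s) (bra u t)"
    and bra_scales: "\<forall>c. \<forall>s \<in> sections L. \<forall>t \<in> sections L.
        bra (sec_scale L (\<lambda>x. c) s) t = sec_scale L (\<lambda>x. c) (bra s t) \<and>
        bra s (sec_scale L (\<lambda>x. c) t) = sec_scale L (\<lambda>x. c) (bra s t)"
    and bra_selfs: "\<forall>s \<in> sections L. bra s s = vzero L"
    and bra_jacobis: "\<forall>s \<in> sections L. \<forall>t \<in> sections L. \<forall>u \<in> sections L.
        sec_add L (bra s (bra t u)) (sec_add L (bra t (bra u s)) (bra u (bra s t))) = vzero L"
    and bra_leibnizs: "\<forall>f \<in> smooth_funs (bas L). \<forall>s \<in> sections L. \<forall>t \<in> sections L.
        bra s (sec_scale L f t) = sec_add L (sec_scale L f (bra s t)) (sec_scale L (lie_fun L s f) t)"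
    and anchor_bundle_map: "smooth_bundle_map L (tangent_bundle (bas L)) (anchor L)"
  using is_lie_algebroid unfolding is_lie_algebroid_def by - (elim conjE, assumption)+

lemma bra_in: "s \<in> sections L \<Longrightarrow> t \<in> sections L \<Longrightarrow> bra s t \<in> sections L"
  using bra_closed by blast

lemma bra_add:
  assumes "s \<in> sections L" "t \<in> sections L" "u \<in> sections L"
  shows "bra (sec_add L s t) u = sec_add L (bra s u) (bra t u)"
    "bra u (sec_add L s t) = sec_add L (bra u s) (bra u t)"
  using bra_adds[rule_format, OF assms] by simp_all

lemma bra_scale:
  assumes "s \<in> sections L" "t \<in> sections L"
  shows "bra (sec_scale L (\<lambda>x. c) s) t = sec_scale L (\<lambda>x. c) (bra s t)"
    "bra s (sec_scale L (\<lambda>x. c) t) = sec_scale L (\<lambda>x. c) (bra s t)"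
  using bra_scales[rule_format, OF assms] by simp_all

lemma bra_self: "s \<in> sections L \<Longrightarrow> bra s s = vzero L"
  using bra_selfs by blast

lemma bra_jacobi: "s \<in> sections L \<Longrightarrow> t \<in> sections L \<Longrightarrow> u \<in> sections L \<Longrightarrow>
    sec_add L (bra s (bra t u)) (sec_add L (bra t (bra u s)) (bra u (bra s t))) = vzero L"
  using bra_jacobis by blast

lemma bra_leibniz: "smooth f \<Longrightarrow> s \<in> sections L \<Longrightarrow> t \<in> sections L \<Longrightarrow>
    bra s (sec_scale L f t) = sec_add L (sec_scale L f (bra s t)) (sec_scale L (lie_fun L s f) t)"
  using bra_leibnizs by blast

lemma coords_simps:
  assumes "(W, \<Phi>) \<in> trivs L" "x \<in> W"
  shows "s \<in> sections L \<Longrightarrow> t \<in> sections L \<Longrightarrow> \<Phi> (sec_add L s t x) i = \<Phi> (s x) i + \<Phi> (t x) i"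
    "s \<in> sections L \<Longrightarrow> \<Phi> (sec_scale L f s x) i = f x * \<Phi> (s x) i"
  using trivD(3)[OF assms sectionsD(1) sectionsD(1)] trivD(4)[OF assms sectionsD(1)]
  by (simp_all add: sec_add_def sec_scale_def)

text \<open>Identities between sections can be verified in coordinates, where real arithmetic
  replaces the fibre operations.\<close>

lemma sections_eqI:
  assumes "s \<in> sections L" "t \<in> sections L"
    "\<And>W \<Phi> x i. (W, \<Phi>) \<in> trivs L \<Longrightarrow> x \<in> W \<Longrightarrow> \<Phi> (s x) i = \<Phi> (t x) i"
  shows "s = t"
proof
  fix x
  obtain W \<Phi> where W: "(W, \<Phi>) \<in> trivs L" "x \<in> W" by (rule triv_cover)
  show "s x = t x"
    by (rule triv_inj[OF W sectionsD(1)[OF assms(1)] sectionsD(1)[OF assms(2)]]) (rule ext, rule assms(3)[OF W])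
qed

lemma bra_anti:
  assumes s: "s \<in> sections L" and t: "t \<in> sections L"
  shows "bra s t = sec_scale L (\<lambda>x. -1) (bra t s)"
proof (rule sections_eqI[OF bra_in[OF s t] sec_scale_in[OF smooth_fun_on_const[OF open_UNIV] bra_in[OF t s]]])
  fix W \<Phi> x i assume W: "(W, \<Phi>) \<in> trivs L" "x \<in> W"
  note C = coords_simps[OF W] and Z = triv_zero[OF W] and st = sec_add_in[OF s t]
  have "0 = \<Phi> (bra (sec_add L s t) (sec_add L s t) x) i"
    by (simp add: bra_self[OF st] Z)
  also have "\<dots> = \<Phi> (bra s s x) i + \<Phi> (bra s t x) i + (\<Phi> (bra t s x) i + \<Phi> (bra t t x) i)"
    by (simp add: bra_add(1)[OF s t st] bra_add(2)[OF s t s] bra_add(2)[OF s t t] C bra_in s t sec_add_in)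
  finally show "\<Phi> (bra s t x) i = \<Phi> (sec_scale L (\<lambda>x. -1) (bra t s) x) i"
    by (simp add: bra_self[OF s] bra_self[OF t] Z C bra_in s t)
qed

section \<open>The derivative of functions along the anchor\<close>

lemma anchor_tangent:
  assumes "v \<in> fibre L x"
  shows "fst (anchor L v) = x" "snd (anchor L v) \<in> tangent_space (bas L) x"
proof -
  have "\<forall>x. \<forall>v \<in> fibre L x. anchor L v \<in> fibre (tangent_bundle (bas L)) x"
    using anchor_bundle_map unfolding smooth_bundle_map_def by (elim conjE)
  then have "anchor L v \<in> fibre (tangent_bundle (bas L)) x" using assms by blast
  then show "fst (anchor L v) = x" "snd (anchor L v) \<in> tangent_space (bas L) x"
    by (auto simp: fibre_def tangent_bundle_def)
qed

lemma anchor_linear: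
  assumes "u \<in> fibre L x" "v \<in> fibre L x"
  shows "snd (anchor L (vadd L u v)) f = snd (anchor L u) f + snd (anchor L v) f"
    "snd (anchor L (vscale L c v)) f = c * snd (anchor L v) f"
proof -
  have "\<forall>x. \<forall>u \<in> fibre L x. \<forall>v \<in> fibre L x.
      anchor L (vadd L u v) = vadd (tangent_bundle (bas L)) (anchor L u) (anchor L v)"
    and "\<forall>x c. \<forall>v \<in> fibre L x. anchor L (vscale L c v) = vscale (tangent_bundle (bas L)) c (anchor L v)"
    using anchor_bundle_map unfolding smooth_bundle_map_def by - (elim conjE, assumption)+
  with assms have "anchor L (vadd L u v) = vadd (tangent_bundle (bas L)) (anchor L u) (anchor L v)"
    "anchor L (vscale L c v) = vscale (tangent_bundle (bas L)) c (anchor L v)"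
    by blast+
  then show "snd (anchor L (vadd L u v)) f = snd (anchor L u) f + snd (anchor L v) f"
    "snd (anchor L (vscale L c v)) f = c * snd (anchor L v) f"
    by (simp_all add: tangent_bundle_def case_prod_beta)
qed

lemma smooth_near: "smooth f \<Longrightarrow> smooth_near (bas L) x f"
  unfolding smooth_near_def by (intro exI[of _ UNIV]) simp

lemma lie_fun_derivation:
  assumes "V \<in> sections L" "smooth f" "smooth g"
  shows "lie_fun L V (\<lambda>y. f y + g y) x = lie_fun L V f x + lie_fun L V g x"
    "lie_fun L V (\<lambda>y. f y * g y) x = lie_fun L V f x * g x + f x * lie_fun L V g x"
    "lie_fun L V (\<lambda>y. c * f y) x = c * lie_fun L V f x"
  using anchor_tangent(2)[OF sectionsD(1)[OF assms(1), of x]] smooth_near[OF assms(2)] smooth_near[OF assms(3)]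
  unfolding lie_fun_def tangent_space_def by simp_all

lemma lie_fun_0: "V \<in> sections L \<Longrightarrow> lie_fun L V (\<lambda>y. 0) x = 0"
  using lie_fun_derivation(3)[of V "\<lambda>y. 0" "\<lambda>y. 0" 0 x] by (simp add: smooth_fun_on_const)

lemma lie_fun_section:
  assumes "U \<in> sections L" "V \<in> sections L"
  shows "lie_fun L (sec_add L U V) f x = lie_fun L U f x + lie_fun L V f x"
    "lie_fun L (sec_scale L g V) f x = g x * lie_fun L V f x"
  using anchor_linear[OF sectionsD(1)[OF assms(1)] sectionsD(1)[OF assms(2)]]
  by (simp_all add: lie_fun_def sec_add_def sec_scale_def)

text \<open>The Leibniz rule gives information about the derivative of f only through a section with
  nonzero values. In rank 0 there is none, but then V is the zero section.\<close>

lemma lie_fun_rank_0: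
  assumes "vb_rank L = 0" "V \<in> sections L"
  shows "lie_fun L V f x = 0"
proof -
  obtain W \<Phi> where W: "(W, \<Phi>) \<in> trivs L" "x \<in> W" by (rule triv_cover)
  note v = sectionsD(1)[OF assms(2), of x]
  have "V x = vscale L 0 (V x)"
    by (rule triv_inj[OF W v]) (auto simp: fibre_closed v triv_out[OF W] assms(1))
  then show ?thesis
    using anchor_linear(2)[OF v v, of 0 f] by (simp add: lie_fun_def)
qed

text \<open>The Leibniz rule expresses \<open>(\<rho> \<circ> V) f\<close> by components of sections, which spares the description of
  tangent vectors in coordinates.\<close>

lemma lie_fun_smooth:
  assumes V: "V \<in> sections L" and f: "smooth f"
  shows "smooth (lie_fun L V f)"
proof (cases "vb_rank L = 0")
  case True
  then have "lie_fun L V f = (\<lambda>x. 0)" using lie_fun_rank_0[OF True V] by auto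
  then show ?thesis by (simp add: smooth_fun_on_const)
next
  case False
  then have r: "0 < vb_rank L" by simp
  show ?thesis
  proof (rule smooth_fun_on_local[OF open_UNIV])
    fix x
    obtain W \<Phi> where W: "(W, \<Phi>) \<in> trivs L" "x \<in> W" by (rule triv_cover)
    note oW = trivD(1)[OF W(1)]
    obtain b N where b: "supported_in b W" "open N" "x \<in> N" "\<And>y. y \<in> N \<Longrightarrow> b y = 1"
      using bump_supported[OF oW W(2)] by metis
    define e where "e = local_section b W \<Phi> (unit_coords 0)"
    have e: "e \<in> sections L" unfolding e_def using r by (intro local_section_in[OF W(1) b(1)]) auto
    have e1: "\<Phi> (e y) 0 = 1" if "y \<in> W \<inter> N" for y
    proof -
      have f: "unframe \<Phi> (unit_coords 0) y \<in> fibre L y" "\<Phi> (unframe \<Phi> (unit_coords 0) y) = unit_coords 0"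
        using unframe[OF W(1), of y "unit_coords 0"] that r by auto
      have "e y = unframe \<Phi> (unit_coords 0) y"
        using that b(4)[of y] fibre_closed(4)[OF f(1)] by (simp add: e_def local_section_def)
      then show ?thesis by (simp add: f(2))
    qed
    note fe = sec_scale_in[OF f e]
    have o: "open (W \<inter> N)" using oW b(2) by auto
    have s: "smooth_fun_on (bas L) (W \<inter> N) (\<lambda>y. \<Phi> (bra V (sec_scale L f e) y) 0 - f y * \<Phi> (bra V e y) 0)"
      by (rule smooth_fun_on_subset[of W])
         (intro smooth_fun_on_diff smooth_fun_on_mult oW sectionsD(2)[OF bra_in[OF V fe] W(1) r]
            sectionsD(2)[OF bra_in[OF V e] W(1) r] smooth_fun_on_subset[OF f], simp_all)
    have "\<Phi> (bra V (sec_scale L f e) y) 0 - f y * \<Phi> (bra V e y) 0 = lie_fun L V f y" if y: "y \<in> W \<inter> N" for y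
    proof -
      have yW: "y \<in> W" using y by simp
      have A: "\<Phi> (sec_scale L g t y) i = g y * \<Phi> (t y) i" if "t \<in> sections L" for g t i
        by (rule coords_simps(2)[OF W(1) yW that])
      have B: "\<Phi> (vadd L u v) i = \<Phi> u i + \<Phi> v i" if "u \<in> fibre L y" "v \<in> fibre L y" for u v i
        using trivD(3)[OF W(1) yW that] by simp
      have s1: "sec_scale L f (bra V e) y \<in> fibre L y" "sec_scale L (lie_fun L V f) e y \<in> fibre L y"
        by (simp_all add: sec_scale_def fibre_closed sectionsD(1)[OF e] sectionsD(1)[OF bra_in[OF V e]])
      have "\<Phi> (bra V (sec_scale L f e) y) 0 = f y * \<Phi> (bra V e y) 0 + lie_fun L V f y * \<Phi> (e y) 0"
        unfolding bra_leibniz[OF f V e] sec_add_def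
        by (simp add: B[OF s1] A e bra_in[OF V e])
      then show ?thesis by (simp add: e1[OF y])
    qed
    then have "smooth_fun_on (bas L) (W \<inter> N) (lie_fun L V f)"
      by (rule smooth_fun_on_cong[OF o s])
    with W(2) b(3) o show "\<exists>T. open T \<and> x \<in> T \<and> smooth_fun_on (bas L) (UNIV \<inter> T) (lie_fun L V f)"
      by (intro exI[of _ "W \<inter> N"]) simp
  qed
qed

text \<open>Apply the Jacobi identity to V, W and f U and expand by the Leibniz rule. The terms
  containing f itself cancel by the Jacobi identity for U, those with one derivative of f cancel by
  symmetry, and what remains is the claimed difference times U, which is nonzero at x.\<close>

lemma anchor_hom:
  assumes V: "V \<in> sections L" and W: "W \<in> sections L" and f: "smooth f"
  shows "lie_fun L (bra V W) f x = lie_fun L V (lie_fun L W f) x - lie_fun L W (lie_fun L V f) x"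
proof (cases "vb_rank L = 0")
  case True
  then show ?thesis using V W bra_in lie_fun_rank_0 by simp
next
  case False
  then have r: "0 < vb_rank L" by simp
  obtain D \<Phi> where D: "(D, \<Phi>) \<in> trivs L" "x \<in> D" by (rule triv_cover)
  obtain U where U: "U \<in> sections L" "U x = frame L \<Phi> 0 x"
    by (rule section_through[OF frame(1)[OF D r]])
  have U1: "\<Phi> (U x) 0 = 1" using frame(2)[OF D r] U(2) by simp
  define c where "c s = \<Phi> (s x) 0" for s
  note C = coords_simps[OF D, of _ _ 0, folded c_def] coords_simps(2)[OF D, of _ _ 0, folded c_def]
  have fU: "sec_scale L f U \<in> sections L" by (rule sec_scale_in[OF f U(1)])
  have lb: "c (bra A (sec_scale L g B)) = g x * c (bra A B) + lie_fun L A g x * c B"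
    if "A \<in> sections L" "B \<in> sections L" "smooth g" for A B g
    using that by (simp add: bra_leibniz C bra_in sec_scale_in lie_fun_smooth)
  have nest: "c (bra A (bra B (sec_scale L f U))) =
      f x * c (bra A (bra B U)) + lie_fun L A f x * c (bra B U) +
      (lie_fun L B f x * c (bra A U) + lie_fun L A (lie_fun L B f) x * c U)"
    if A: "A \<in> sections L" and B: "B \<in> sections L" for A B
  proof -
    have "bra A (bra B (sec_scale L f U)) =
        sec_add L (bra A (sec_scale L f (bra B U))) (bra A (sec_scale L (lie_fun L B f) U))"
      by (simp add: bra_leibniz[OF f B U(1)] bra_add(2) A B U(1) bra_in sec_scale_in f lie_fun_smooth)
    then show ?thesis
      using A B U(1) f by (simp add: C lb bra_in sec_scale_in lie_fun_smooth)
  qed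
  have cm: "c (bra A B) = - c (bra B A)" if "A \<in> sections L" "B \<in> sections L" for A B
    by (subst bra_anti[OF that]) (simp add: C bra_in that)
  have cn: "c (bra A (bra B X)) = - c (bra A (bra X B))"
    if "A \<in> sections L" "B \<in> sections L" "X \<in> sections L" for A B X
    by (subst bra_anti[OF that(2,3)]) (simp add: C bra_in that bra_scale(2))
  have z: "c (vzero L) = 0" by (simp add: c_def triv_zero[OF D])
  have jac: "c (bra V (bra W X)) - c (bra W (bra V X)) - c (bra (bra V W) X) = 0" if X: "X \<in> sections L" for X
  proof -
    have "c (bra V (bra W X)) + (c (bra W (bra X V)) + c (bra X (bra V W))) = 0"
      using arg_cong[OF bra_jacobi[OF V W X], of c] z by (simp add: C bra_in sec_add_in V W X)
    then show ?thesis using cn[OF W X V] cm[OF X bra_in[OF V W]] by simp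
  qed
  have "c (bra V (bra W (sec_scale L f U))) - c (bra W (bra V (sec_scale L f U))) - c (bra (bra V W) (sec_scale L f U)) =
    f x * (c (bra V (bra W U)) - c (bra W (bra V U)) - c (bra (bra V W) U)) +
    (lie_fun L V (lie_fun L W f) x - lie_fun L W (lie_fun L V f) x - lie_fun L (bra V W) f x) * c U"
    unfolding nest[OF V W] nest[OF W V] lb[OF bra_in[OF V W] U(1) f] by (simp add: algebra_simps)
  then show ?thesis using jac[OF fU] jac[OF U(1)] U1 by (simp add: c_def)
qed

text \<open>This and \<open>d_eval\<close> are the right-hand sides in the definitions of
  \<open>lie_form\<close> and \<open>d_rho\<close>, as functions of lists of sections. They make
  sense before any form with these values is known to exist.\<close>

definition lie_eval :: "('m \<Rightarrow> 'e) \<Rightarrow> ('m, 'e) form \<Rightarrow> ('m \<Rightarrow> 'e) list \<Rightarrow> 'm \<Rightarrow> real" where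
  "lie_eval V \<eta> Vs x = lie_fun L V (eval_form \<eta> Vs) x -
     (\<Sum>i<length Vs. eval_form \<eta> (Vs[i := bra V (Vs ! i)]) x)"

definition d_eval :: "('m, 'e) form \<Rightarrow> ('m \<Rightarrow> 'e) list \<Rightarrow> 'm \<Rightarrow> real" where
  "d_eval \<eta> Vs x =
     (\<Sum>i<length Vs. (-1) ^ i * lie_fun L (Vs ! i) (eval_form \<eta> (nths Vs (- {i}))) x) +
     (\<Sum>j<length Vs. \<Sum>i<j. (-1) ^ (i + j) *
        eval_form \<eta> (bra (Vs ! i) (Vs ! j) # nths Vs (- {i, j})) x)"

lemma lie_eval_Nil: "lie_eval V \<eta> [] x = lie_fun L V (eval_form \<eta> []) x"
  by (simp add: lie_eval_def)

text \<open>On lists of sections this is the rule [L(V), i(W)] = i({V,W}); with it, statements about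
  L(V) become inductions on the list with \<eta> arbitrary.\<close>

lemma lie_eval_Cons:
  "lie_eval V \<eta> (W # Ws) x = lie_eval V (insert_vector W \<eta>) Ws x - eval_form \<eta> (bra V W # Ws) x"
  by (simp add: lie_eval_def eval_form_Cons sum.lessThan_Suc_shift del: sum.lessThan_Suc)

lemma d_eval_Nil: "d_eval \<eta> [] x = 0"
  by (simp add: d_eval_def)

text \<open>Cartan's formula \<open>i(V) d = \<L>(V) - d i(V)\<close>; as a recursion it replaces all reasoning about the index sums.\<close>

lemma d_eval_Cons:
  assumes \<eta>: "\<eta> \<in> all_forms L"
  shows "d_eval \<eta> (V # Vs) x = lie_eval V \<eta> Vs x - d_eval (insert_vector V \<eta>) Vs x"
proof -
  note a = all_formsD(1)[OF \<eta>, of x]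
  let ?n = "length Vs"
  have 1: "(\<Sum>i<length (V # Vs). (-1) ^ i * lie_fun L ((V # Vs) ! i) (eval_form \<eta> (nths (V # Vs) (- {i}))) x) =
      lie_fun L V (eval_form \<eta> Vs) x -
      (\<Sum>i<?n. (-1) ^ i * lie_fun L (Vs ! i) (eval_form (insert_vector V \<eta>) (nths Vs (- {i}))) x)"
    by (simp add: sum.lessThan_Suc_shift nths_Cons_remove eval_form_Cons sum_negf del: sum.lessThan_Suc)
  have sw: "eval_form \<eta> (A # V # Ws) x = - eval_form (insert_vector V \<eta>) (A # Ws) x" for A Ws
    using alt_forms_swap[OF a, of "[]" "A x" "V x"] by (simp add: eval_form_def insert_vector_def)
  have up: "eval_form \<eta> (Vs[j := A]) x = (-1) ^ j * eval_form \<eta> (A # nths Vs (- {j})) x" if "j < ?n" for j A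
    using alt_forms_update[OF a, of j "map (\<lambda>V. V x) Vs" "A x"] that
    by (simp add: eval_form_def map_update nths_map)
  \<comment> \<open>Pairs containing the first position give the bracket terms of L(V). In the other
    pairs V stands right behind the bracket; exchanging the two yields the terms of d for i(V)
    \<eta> with a minus sign.\<close>
  have 2: "(\<Sum>j<length (V # Vs). \<Sum>i<j. (-1) ^ (i + j) *
        eval_form \<eta> (bra ((V # Vs) ! i) ((V # Vs) ! j) # nths (V # Vs) (- {i, j})) x) =
      (\<Sum>j<?n. - ((-1) ^ j * eval_form \<eta> (bra V (Vs ! j) # nths Vs (- {j})) x) -
        (\<Sum>i<j. (-1) ^ (i + j) *
          eval_form (insert_vector V \<eta>) (bra (Vs ! i) (Vs ! j) # nths Vs (- {i, j})) x))"
    by (simp add: sum.lessThan_Suc_shift nths_Cons_remove sw sum_negf del: sum.lessThan_Suc)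
  show ?thesis
    unfolding d_eval_def[of \<eta>] 1 2 lie_eval_def d_eval_def[of "insert_vector V \<eta>"]
    by (simp add: up sum_subtractf sum_negf algebra_simps)
qed

lemma insert_sec_add:
  assumes \<eta>: "\<eta> \<in> all_forms L" and s: "A \<in> sections L" "B \<in> sections L"
  shows "insert_vector (sec_add L A B) \<eta> = (\<lambda>x vs. insert_vector A \<eta> x vs + insert_vector B \<eta> x vs)"
proof (intro ext)
  fix x vs
  note D = alt_formsD[OF all_formsD(1)[OF \<eta>, of x]]
  show "insert_vector (sec_add L A B) \<eta> x vs = insert_vector A \<eta> x vs + insert_vector B \<eta> x vs"
  proof (cases "set vs \<subseteq> fibre L x")
    case True
    then show ?thesis
      using D(2)[of "[]" "A x" "B x" vs] sectionsD(1)[OF s(1)] sectionsD(1)[OF s(2)]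
      by (simp add: insert_vector_def sec_add_def)
  next
    case False
    then show ?thesis by (simp add: insert_vector_def D(1))
  qed
qed

lemma insert_sec_scale:
  assumes \<eta>: "\<eta> \<in> all_forms L" and s: "A \<in> sections L"
  shows "insert_vector (sec_scale L f A) \<eta> = (\<lambda>x vs. f x * insert_vector A \<eta> x vs)"
proof (intro ext)
  fix x vs
  note D = alt_formsD[OF all_formsD(1)[OF \<eta>, of x]]
  show "insert_vector (sec_scale L f A) \<eta> x vs = f x * insert_vector A \<eta> x vs"
  proof (cases "set vs \<subseteq> fibre L x")
    case True
    then show ?thesis
      using D(3)[of "[]" "A x" vs "f x"] sectionsD(1)[OF s]
      by (simp add: insert_vector_def sec_scale_def)
  next
    case False
    then show ?thesis by (simp add: insert_vector_def D(1))
  qed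
qed

lemma insert_swap:
  assumes \<eta>: "\<eta> \<in> all_forms L"
  shows "insert_vector A (insert_vector B \<eta>) = (\<lambda>x vs. (-1) * insert_vector B (insert_vector A \<eta>) x vs)"
proof (intro ext)
  show "insert_vector A (insert_vector B \<eta>) x vs = (-1) * insert_vector B (insert_vector A \<eta>) x vs" for x vs
    using alt_forms_swap[OF all_formsD(1)[OF \<eta>, of x], of "[]" "B x" "A x"] by (simp add: insert_vector_def)
qed

lemma eval_add: "eval_form (\<lambda>x vs. \<eta> x vs + \<theta> x vs) Vs = (\<lambda>x. eval_form \<eta> Vs x + eval_form \<theta> Vs x)"
  by (simp add: eval_form_def)

lemma eval_smult: "eval_form (\<lambda>x vs. f x * \<eta> x vs) Vs = (\<lambda>x. f x * eval_form \<eta> Vs x)"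
  by (simp add: eval_form_def)

lemma insert_add: "insert_vector V (\<lambda>x vs. \<eta> x vs + \<theta> x vs) = (\<lambda>x vs. insert_vector V \<eta> x vs + insert_vector V \<theta> x vs)"
  by (simp add: insert_vector_def)

lemma insert_smult: "insert_vector V (\<lambda>x vs. f x * \<eta> x vs) = (\<lambda>x vs. f x * insert_vector V \<eta> x vs)"
  by (simp add: insert_vector_def)

lemma lie_eval_smooth:
  assumes "V \<in> sections L" "\<eta> \<in> all_forms L" "set Vs \<subseteq> sections L"
  shows "smooth (lie_eval V \<eta> Vs)"
  using assms(2,3)
proof (induction Vs arbitrary: \<eta>)
  case Nil
  have "lie_eval V \<eta> [] = lie_fun L V (eval_form \<eta> [])" by (simp add: fun_eq_iff lie_eval_Nil)
  then show ?case using lie_fun_smooth[OF assms(1) eval_form_smooth[OF Nil]] by simp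
next
  case (Cons W Ws)
  have "lie_eval V \<eta> (W # Ws) = (\<lambda>x. lie_eval V (insert_vector W \<eta>) Ws x - eval_form \<eta> (bra V W # Ws) x)"
    by (simp add: fun_eq_iff lie_eval_Cons)
  moreover have "smooth (\<lambda>x. lie_eval V (insert_vector W \<eta>) Ws x - eval_form \<eta> (bra V W # Ws) x)"
    using Cons by (intro smooth_fun_on_diff open_UNIV Cons.IH eval_form_smooth) (auto intro: insert_vector_in bra_in assms(1))
  ultimately show ?case by simp
qed

lemma d_eval_smooth:
  "\<eta> \<in> all_forms L \<Longrightarrow> set Vs \<subseteq> sections L \<Longrightarrow> smooth (d_eval \<eta> Vs)"
proof (induction Vs arbitrary: \<eta>)
  case Nil
  have "d_eval \<eta> [] = (\<lambda>x. 0)" by (simp add: fun_eq_iff d_eval_Nil)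
  then show ?case by (simp add: smooth_fun_on_const)
next
  case (Cons V Vs)
  have "d_eval \<eta> (V # Vs) = (\<lambda>x. lie_eval V \<eta> Vs x - d_eval (insert_vector V \<eta>) Vs x)"
    by (simp add: fun_eq_iff d_eval_Cons[OF Cons.prems(1)])
  moreover have "smooth (\<lambda>x. lie_eval V \<eta> Vs x - d_eval (insert_vector V \<eta>) Vs x)"
    using Cons by (intro smooth_fun_on_diff open_UNIV Cons.IH lie_eval_smooth) (auto intro: insert_vector_in)
  ultimately show ?case by simp
qed

lemma lie_eval_add:
  assumes "V \<in> sections L" "\<eta> \<in> all_forms L" "\<theta> \<in> all_forms L" "set Vs \<subseteq> sections L"
  shows "lie_eval V (\<lambda>x vs. \<eta> x vs + \<theta> x vs) Vs x = lie_eval V \<eta> Vs x + lie_eval V \<theta> Vs x"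
  using assms(2-4)
proof (induction Vs arbitrary: \<eta> \<theta>)
  case Nil
  then show ?case
    by (simp add: lie_eval_Nil eval_add lie_fun_derivation(1)[OF assms(1)] eval_form_smooth)
next
  case (Cons W Ws)
  then show ?case
    by (simp add: lie_eval_Cons eval_add insert_add insert_vector_in)
qed

lemma lie_eval_smult:
  assumes "V \<in> sections L" "\<eta> \<in> all_forms L" "smooth f" "set Vs \<subseteq> sections L"
  shows "lie_eval V (\<lambda>x vs. f x * \<eta> x vs) Vs x = f x * lie_eval V \<eta> Vs x + lie_fun L V f x * eval_form \<eta> Vs x"
  using assms(2,4)
proof (induction Vs arbitrary: \<eta>)
  case Nil
  then show ?case
    by (simp add: lie_eval_Nil eval_smult lie_fun_derivation(2)[OF assms(1,3)] eval_form_smooth)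
next
  case (Cons W Ws)
  then show ?case
    by (simp add: lie_eval_Cons eval_smult insert_smult insert_vector_in eval_form_Cons[of \<eta> W] algebra_simps)
qed

lemma lie_eval_scale:
  assumes "V \<in> sections L" "\<eta> \<in> all_forms L" "set Vs \<subseteq> sections L"
  shows "lie_eval V (\<lambda>x vs. c * \<eta> x vs) Vs x = c * lie_eval V \<eta> Vs x"
proof -
  \<comment> \<open>A derivation kills constants: the product rule for 1 = 1 * 1 gives it for 1, and
    scaling by c for all constants.\<close>
  have "lie_fun L V (\<lambda>x. c) x = 0"
    using lie_fun_derivation(3)[OF assms(1), of "\<lambda>y. 1" "\<lambda>y. 1" c x]
      lie_fun_derivation(2)[OF assms(1), of "\<lambda>y. 1" "\<lambda>y. 1" x] by (simp add: smooth_fun_on_const)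
  then show ?thesis
    using lie_eval_smult[OF assms(1,2) smooth_fun_on_const[OF open_UNIV] assms(3), of c x] by simp
qed

lemma d_eval_add:
  "\<eta> \<in> all_forms L \<Longrightarrow> \<theta> \<in> all_forms L \<Longrightarrow> set Vs \<subseteq> sections L \<Longrightarrow>
    d_eval (\<lambda>x vs. \<eta> x vs + \<theta> x vs) Vs x = d_eval \<eta> Vs x + d_eval \<theta> Vs x"
proof (induction Vs arbitrary: \<eta> \<theta>)
  case (Cons V Vs)
  then show ?case
    by (simp add: d_eval_Cons all_forms_add lie_eval_add insert_add insert_vector_in)
qed (simp add: d_eval_Nil)

lemma d_eval_scale:
  "\<eta> \<in> all_forms L \<Longrightarrow> set Vs \<subseteq> sections L \<Longrightarrow>
    d_eval (\<lambda>x vs. c * \<eta> x vs) Vs x = c * d_eval \<eta> Vs x"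
proof (induction Vs arbitrary: \<eta>)
  case (Cons V Vs)
  then show ?case
    by (simp add: d_eval_Cons all_forms_scale lie_eval_scale insert_smult insert_vector_in algebra_simps)
qed (simp add: d_eval_Nil)

lemma lie_eval_section_add:
  assumes "A \<in> sections L" "B \<in> sections L" "\<eta> \<in> all_forms L" "set Ws \<subseteq> sections L"
  shows "lie_eval (sec_add L A B) \<eta> Ws x = lie_eval A \<eta> Ws x + lie_eval B \<eta> Ws x"
  using assms(3,4)
proof (induction Ws arbitrary: \<eta>)
  case Nil
  show ?case by (simp add: lie_eval_Nil lie_fun_section assms(1,2))
next
  case (Cons W Ws)
  have W: "W \<in> sections L" using Cons.prems by simp
  show ?case
    using Cons W
    by (simp add: lie_eval_Cons insert_vector_in bra_add(1)[OF assms(1,2) W] eval_form_Cons[of \<eta>]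
        insert_sec_add bra_in assms(1,2) eval_add)
qed

lemma lie_eval_slot_add:
  assumes "V \<in> sections L" "A \<in> sections L" "B \<in> sections L" "\<eta> \<in> all_forms L"
    "set Us \<subseteq> sections L" "set Ws \<subseteq> sections L"
  shows "lie_eval V \<eta> (Us @ sec_add L A B # Ws) x = lie_eval V \<eta> (Us @ A # Ws) x + lie_eval V \<eta> (Us @ B # Ws) x"
  using assms(4,5)
proof (induction Us arbitrary: \<eta>)
  case Nil
  then show ?case using assms
    by (simp add: lie_eval_Cons insert_sec_add insert_vector_in lie_eval_add bra_add(2) bra_in eval_form_Cons[of \<eta>] eval_add)
next
  case (Cons U Us)
  have e: "eval_form \<eta> (Y # Us @ sec_add L A B # Ws) x = eval_form \<eta> (Y # Us @ A # Ws) x + eval_form \<eta> (Y # Us @ B # Ws) x"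
    if "Y \<in> sections L" for Y
  proof -
    have f: "set ((Y # Us) @ A # B # Ws) \<subseteq> sections L" using that Cons.prems assms by auto
    have "set (map (\<lambda>V. V x) (Y # Us) @ A x # B x # map (\<lambda>V. V x) Ws) \<subseteq> fibre L x"
      using f sectionsD(1) by (auto simp: subset_eq)
    from alt_formsD(2)[OF all_formsD(1)[OF Cons.prems(1)] this]
    show ?thesis by (simp add: eval_form_def sec_add_def)
  qed
  show ?case
    using Cons assms by (simp add: lie_eval_Cons insert_vector_in e bra_in)
qed

lemma eval_slot_scale:
  assumes "\<eta> \<in> all_forms L" "set (Us @ A # Ws) \<subseteq> sections L"
  shows "eval_form \<eta> (Us @ sec_scale L f A # Ws) x = f x * eval_form \<eta> (Us @ A # Ws) x"
proof -
  have "set (map (\<lambda>V. V x) Us @ A x # map (\<lambda>V. V x) Ws) \<subseteq> fibre L x"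
    using assms(2) sectionsD(1) by (auto simp: subset_eq)
  from alt_formsD(3)[OF all_formsD(1)[OF assms(1)] this]
  show ?thesis by (simp add: eval_form_def sec_scale_def)
qed

text \<open>Two derivatives of f occur, one from differentiating f times the contracted form and one
  from the Leibniz rule for the bracket; they cancel.\<close>

lemma lie_eval_slot_scale:
  assumes "V \<in> sections L" "A \<in> sections L" "smooth f" "\<eta> \<in> all_forms L"
    "set Us \<subseteq> sections L" "set Ws \<subseteq> sections L"
  shows "lie_eval V \<eta> (Us @ sec_scale L f A # Ws) x = f x * lie_eval V \<eta> (Us @ A # Ws) x"
  using assms(4,5)
proof (induction Us arbitrary: \<eta>)
  case Nil
  then show ?case using assms
    by (simp add: lie_eval_Cons insert_sec_scale insert_vector_in lie_eval_smult bra_leibniz bra_in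
        eval_form_Cons[of \<eta>] insert_sec_add sec_scale_in lie_fun_smooth eval_add eval_smult, simp add: algebra_simps)
next
  case (Cons U Us)
  have e: "eval_form \<eta> (bra V U # Us @ sec_scale L f A # Ws) x = f x * eval_form \<eta> (bra V U # Us @ A # Ws) x"
    using eval_slot_scale[OF Cons.prems(1), of "bra V U # Us" A Ws f x] Cons.prems assms bra_in by simp
  show ?case
    using Cons assms by (simp add: lie_eval_Cons insert_vector_in e algebra_simps)
qed

lemma lie_eval_slot_swap:
  assumes "V \<in> sections L" "A \<in> sections L" "B \<in> sections L" "\<eta> \<in> all_forms L"
    "set Us \<subseteq> sections L" "set Ws \<subseteq> sections L"
  shows "lie_eval V \<eta> (Us @ A # B # Ws) x = - lie_eval V \<eta> (Us @ B # A # Ws) x"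
  using assms(4,5)
proof (induction Us arbitrary: \<eta>)
  case Nil
  have s: "eval_form (insert_vector X \<eta>) (Y # Ws) x = - eval_form (insert_vector Y \<eta>) (X # Ws) x" for X Y
    using alt_forms_swap[OF all_formsD(1)[OF Nil(1), of x], of "[]" "X x" "Y x"] by (simp add: eval_form_def insert_vector_def)
  have "lie_eval V (insert_vector B (insert_vector A \<eta>)) Ws x = - lie_eval V (insert_vector A (insert_vector B \<eta>)) Ws x"
    unfolding insert_swap[OF Nil(1), of B A]
    using Nil assms by (subst lie_eval_scale) (simp_all add: insert_vector_in)
  then show ?case
    using s[of A "bra V B"] s[of "bra V A" B] by (simp add: lie_eval_Cons eval_form_Cons[of \<eta>])
next
  case (Cons U Us)
  have "eval_form \<eta> (bra V U # Us @ A # B # Ws) x = - eval_form \<eta> (bra V U # Us @ B # A # Ws) x"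
    using alt_forms_swap[OF all_formsD(1)[OF Cons.prems(1), of x], of "map (\<lambda>V. V x) (bra V U # Us)" "A x" "B x"]
    by (simp add: eval_form_def)
  then show ?case
    using Cons assms by (simp add: lie_eval_Cons insert_vector_in)
qed

lemma d_eval_slot_add:
  assumes "A \<in> sections L" "B \<in> sections L" "\<eta> \<in> all_forms L"
    "set Us \<subseteq> sections L" "set Ws \<subseteq> sections L"
  shows "d_eval \<eta> (Us @ sec_add L A B # Ws) x = d_eval \<eta> (Us @ A # Ws) x + d_eval \<eta> (Us @ B # Ws) x"
  using assms(3,4)
proof (induction Us arbitrary: \<eta>)
  case Nil
  then show ?case using assms
    by (simp add: d_eval_Cons lie_eval_section_add insert_sec_add d_eval_add insert_vector_in)
next
  case (Cons U Us)
  then show ?case using assms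
    by (simp add: d_eval_Cons lie_eval_slot_add insert_vector_in)
qed

lemma d_eval_slot_swap:
  assumes "A \<in> sections L" "B \<in> sections L" "\<eta> \<in> all_forms L"
    "set Us \<subseteq> sections L" "set Ws \<subseteq> sections L"
  shows "d_eval \<eta> (Us @ A # B # Ws) x = - d_eval \<eta> (Us @ B # A # Ws) x"
  using assms(3,4)
proof (induction Us arbitrary: \<eta>)
  case Nil
  have "d_eval (insert_vector B (insert_vector A \<eta>)) Ws x = - d_eval (insert_vector A (insert_vector B \<eta>)) Ws x"
    unfolding insert_swap[OF Nil(1), of B A]
    using Nil assms by (subst d_eval_scale) (simp_all add: insert_vector_in)
  moreover have "eval_form \<eta> (bra A B # Ws) x = - eval_form \<eta> (bra B A # Ws) x"
    unfolding bra_anti[OF assms(1,2)]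
    using eval_slot_scale[OF Nil(1), of "[]" "bra B A" Ws "\<lambda>x. -1" x] bra_in assms by simp
  ultimately show ?case
    using Nil assms by (simp add: d_eval_Cons insert_vector_in lie_eval_Cons)
next
  case (Cons U Us)
  then show ?case using assms
    by (simp add: d_eval_Cons lie_eval_slot_swap[OF _ assms(1,2)] insert_vector_in)
qed

text \<open>In the first slot, \<open>C\<^sup>\<infinity>\<close>-linearity follows from that in the second slot by antisymmetry.\<close>

lemma d_eval_slot_scale:
  assumes "A \<in> sections L" "smooth f" "\<eta> \<in> all_forms L" "set (Us @ Ws) \<subseteq> sections L"
  shows "d_eval \<eta> (Us @ sec_scale L f A # Ws) x = f x * d_eval \<eta> (Us @ A # Ws) x"
  using assms(3,4)
\<comment> \<open>The induction counts the other arguments: the exchange used for the first slot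
  keeps their number but not their division into Us and Ws.\<close>
proof (induction "length (Us @ Ws)" arbitrary: \<eta> Us Ws)
  case 0
  then show ?case using assms(1,2)
    by (simp add: d_eval_Cons d_eval_Nil lie_eval_Nil lie_fun_section insert_vector_in sec_scale_in)
next
  case (Suc n)
  note fA = sec_scale_in[OF assms(2,1)]
  have tail: "d_eval \<eta> (U # Us' @ sec_scale L f A # Ws') x = f x * d_eval \<eta> (U # Us' @ A # Ws') x"
    if "Suc n = length ((U # Us') @ Ws')" "set ((U # Us') @ Ws') \<subseteq> sections L" for U Us' Ws'
  proof -
    have U: "U \<in> sections L" "set Us' \<subseteq> sections L" "set Ws' \<subseteq> sections L" using that(2) by auto
    have "d_eval (insert_vector U \<eta>) (Us' @ sec_scale L f A # Ws') x =
        f x * d_eval (insert_vector U \<eta>) (Us' @ A # Ws') x"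
      using that U by (intro Suc.hyps(1) insert_vector_in Suc.prems(1)) auto
    then show ?thesis
      using lie_eval_slot_scale[OF U(1) assms(1,2) Suc.prems(1) U(2,3), of x]
      by (simp add: d_eval_Cons[OF Suc.prems(1)] algebra_simps)
  qed
  show ?case
  proof (cases Us)
    case (Cons U Us')
    then show ?thesis using tail[of U Us' Ws] Suc.hyps(2) Suc.prems by simp
  next
    case Nil
    then obtain U Ws' where Ws: "Ws = U # Ws'" using Suc.hyps(2) by (cases Ws) auto
    have U: "U \<in> sections L" "set Ws' \<subseteq> sections L" using Suc.prems Ws by auto
    have "d_eval \<eta> (sec_scale L f A # U # Ws') x = - d_eval \<eta> (U # sec_scale L f A # Ws') x"
      using d_eval_slot_swap[OF fA U(1) Suc.prems(1), of "[]" Ws' x] U by simp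
    also have "\<dots> = - (f x * d_eval \<eta> (U # A # Ws') x)"
      using tail[of U "[]" Ws'] Suc.hyps(2) U Nil Ws by simp
    also have "\<dots> = f x * d_eval \<eta> (A # U # Ws') x"
      using d_eval_slot_swap[OF assms(1) U(1) Suc.prems(1), of "[]" Ws' x] U by simp
    finally show ?thesis using Nil Ws by simp
  qed
qed

text \<open>\<open>tensor_form\<close> provides the form required by the definite description in
  \<open>d_rho\<close>, and \<open>all_forms_eqI\<close> its uniqueness.\<close>

lemma d_rho:
  assumes \<eta>: "\<eta> \<in> all_forms L"
  shows d_rho_in: "d_rho L \<eta> \<in> all_forms L"
    and eval_d_rho: "set Vs \<subseteq> sections L \<Longrightarrow> eval_form (d_rho L \<eta>) Vs = d_eval \<eta> Vs"
proof -
  obtain \<omega> where \<omega>: "\<omega> \<in> all_forms L" "\<And>Vs. set Vs \<subseteq> sections L \<Longrightarrow> eval_form \<omega> Vs = d_eval \<eta> Vs"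
  proof (rule tensor_form[where T = "d_eval \<eta>"])
    show "smooth (d_eval \<eta> Vs)" if "set Vs \<subseteq> sections L" for Vs
      by (rule d_eval_smooth[OF \<eta> that])
    show "d_eval \<eta> (Us @ sec_add L U V # Vs) x = d_eval \<eta> (Us @ U # Vs) x + d_eval \<eta> (Us @ V # Vs) x"
      if "set (Us @ U # V # Vs) \<subseteq> sections L" for Us U V Vs x
      by (rule d_eval_slot_add[OF _ _ \<eta>]) (use that in auto)
    show "d_eval \<eta> (Us @ sec_scale L f V # Vs) x = f x * d_eval \<eta> (Us @ V # Vs) x"
      if "set (Us @ V # Vs) \<subseteq> sections L" "smooth f" for Us f V Vs x
      by (rule d_eval_slot_scale[OF _ that(2) \<eta>]) (use that(1) in auto)
    show "d_eval \<eta> (Us @ U # V # Vs) x = - d_eval \<eta> (Us @ V # U # Vs) x"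
      if "set (Us @ U # V # Vs) \<subseteq> sections L" for Us U V Vs x
      by (rule d_eval_slot_swap[OF _ _ \<eta>]) (use that in auto)
  qed blast
  have "d_rho L \<eta> \<in> all_forms L \<and> (\<forall>Vs. set Vs \<subseteq> sections L \<longrightarrow> eval_form (d_rho L \<eta>) Vs = d_eval \<eta> Vs)"
  proof -
    have "d_rho L \<eta> = (THE \<omega>. \<omega> \<in> all_forms L \<and> (\<forall>Vs. set Vs \<subseteq> sections L \<longrightarrow> eval_form \<omega> Vs = d_eval \<eta> Vs))"
      by (simp only: d_rho_def d_eval_def[abs_def])
    also have "\<dots> = \<omega>"
      by (rule the_equality) (use \<omega> in \<open>auto intro!: all_forms_eqI\<close>)
    finally show ?thesis using \<omega> by simp
  qed
  then show "d_rho L \<eta> \<in> all_forms L"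
    "set Vs \<subseteq> sections L \<Longrightarrow> eval_form (d_rho L \<eta>) Vs = d_eval \<eta> Vs"
    by auto
qed

lemma d_rho_0: "\<eta> \<in> all_forms L \<Longrightarrow> d_rho L \<eta> x [] = 0"
  using eval_d_rho[of \<eta> "[]"] by (simp add: eval_form_def d_eval_Nil fun_eq_iff)

lemma lin_op_d_rho: "lin_op (d_rho L)"
proof (rule lin_opI)
  fix \<eta> \<theta> :: "('m, 'e) form" and c x vs assume \<eta>: "\<eta> \<in> all_forms L" "\<theta> \<in> all_forms L"
  have s: "(\<lambda>x vs. \<eta> x vs + c * \<theta> x vs) \<in> all_forms L"
    by (intro all_forms_add all_forms_scale \<eta>)
  have "d_rho L (\<lambda>x vs. \<eta> x vs + c * \<theta> x vs) = (\<lambda>x vs. d_rho L \<eta> x vs + c * d_rho L \<theta> x vs)"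
  proof (rule all_forms_eqI)
    show "d_rho L (\<lambda>x vs. \<eta> x vs + c * \<theta> x vs) \<in> all_forms L" by (rule d_rho_in[OF s])
    show "(\<lambda>x vs. d_rho L \<eta> x vs + c * d_rho L \<theta> x vs) \<in> all_forms L"
      by (intro all_forms_add all_forms_scale d_rho_in \<eta>)
    fix Vs assume Vs: "set Vs \<subseteq> sections L"
    show "eval_form (d_rho L (\<lambda>x vs. \<eta> x vs + c * \<theta> x vs)) Vs =
        eval_form (\<lambda>x vs. d_rho L \<eta> x vs + c * d_rho L \<theta> x vs) Vs"
      unfolding eval_add eval_smult eval_d_rho[OF s Vs] eval_d_rho[OF \<eta>(1) Vs] eval_d_rho[OF \<eta>(2) Vs]
      using d_eval_add[OF \<eta>(1) all_forms_scale[OF \<eta>(2)] Vs] d_eval_scale[OF \<eta>(2) Vs] by auto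
  qed
  then show "d_rho L (\<lambda>x vs. \<eta> x vs + c * \<theta> x vs) x vs = d_rho L \<eta> x vs + c * d_rho L \<theta> x vs"
    by simp
qed (rule d_rho_in)

text \<open>Components are read off on lists of sections, where the recursion for
  \<open>d_eval\<close> lowers the length of the list and the degree together.\<close>

lemma has_deg_d_rho: "has_deg 1 (d_rho L)"
  unfolding has_deg_def
proof (intro ballI allI impI)
  fix \<eta> k assume \<eta>: "\<eta> \<in> all_forms L" "vanish_deg k \<eta>"
  have lie0: "lie_eval V \<theta> Vs x = 0"
    if "vanish_deg (int (length Vs)) \<theta>" "V \<in> sections L" for V \<theta> Vs x
  proof -
    have "eval_form \<theta> Ws = (\<lambda>x. 0)" if "length Ws = length Vs" for Ws
      using \<open>vanish_deg (int (length Vs)) \<theta>\<close> that by (simp add: vanish_deg_def eval_form_def)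
    then show ?thesis using lie_fun_0[OF that(2)] by (simp add: lie_eval_def)
  qed
  have d0: "d_eval \<eta> Vs x = 0" if "\<eta> \<in> all_forms L" "set Vs \<subseteq> sections L" "vanish_deg (int (length Vs) - 1) \<eta>" for \<eta> Vs x
    using that
  proof (induction Vs arbitrary: \<eta>)
    case (Cons V Vs)
    have "vanish_deg (int (length Vs) - 1) (insert_vector V \<eta>)"
      using Cons.prems(3) by (auto simp: vanish_deg_def insert_vector_def)
    then show ?case
      using Cons by (simp add: d_eval_Cons lie0 insert_vector_in)
  qed (simp add: d_eval_Nil)
  show "vanish_deg (k + 1) (d_rho L \<eta>)"
    unfolding vanish_deg_def
  proof (intro allI impI)
    fix x and vs :: "'e list" assume l: "int (length vs) = k + 1"
    show "d_rho L \<eta> x vs = 0"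
    proof (cases "set vs \<subseteq> fibre L x")
      case True
      then obtain Vs where Vs: "set Vs \<subseteq> sections L" "map (\<lambda>V. V x) Vs = vs" by (rule sections_through)
      have "length Vs = length vs" using Vs(2) by auto
      then have "d_eval \<eta> Vs x = 0" using \<eta> Vs l by (intro d0) simp_all
      then show ?thesis using fun_cong[OF eval_d_rho[OF \<eta>(1) Vs(1)], of x] Vs(2) by (simp add: eval_form_def)
    next
      case False
      then show ?thesis using alt_formsD(1)[OF all_formsD(1)[OF d_rho_in[OF \<eta>(1)]]] by simp
    qed
  qed
qed

text \<open>Cartan's formula is taken as a definition, so that L(V) belongs to the calculus of
  commutators; \<open>lie_form_eq\<close> identifies it with the Lie derivative of forms.\<close>

definition lie_op :: "('m \<Rightarrow> 'e) \<Rightarrow> ('m, 'e) form \<Rightarrow> ('m, 'e) form" where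
  "lie_op V = graded_bracket (-1) 1 (insert_vector V) (d_rho L)"

lemma lin_op_lie_op: "V \<in> sections L \<Longrightarrow> lin_op (lie_op V)"
  unfolding lie_op_def by (intro lin_op_graded_bracket lin_op_insert_vector lin_op_d_rho)

lemma eval_lie_op:
  assumes "V \<in> sections L" "\<eta> \<in> all_forms L" "set Vs \<subseteq> sections L"
  shows "eval_form (lie_op V \<eta>) Vs = lie_eval V \<eta> Vs"
proof
  fix x
  have "eval_form (lie_op V \<eta>) Vs x = eval_form (d_rho L \<eta>) (V # Vs) x + eval_form (d_rho L (insert_vector V \<eta>)) Vs x"
    by (simp add: lie_op_def graded_bracket_def powi_minus_one eval_form_def insert_vector_def)
  also have "\<dots> = lie_eval V \<eta> Vs x"
    using assms by (simp add: eval_d_rho insert_vector_in d_eval_Cons)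
  finally show "eval_form (lie_op V \<eta>) Vs x = lie_eval V \<eta> Vs x" .
qed

lemma lie_form_eq:
  assumes V: "V \<in> sections L" and \<eta>: "\<eta> \<in> all_forms L"
  shows "lie_form L V \<eta> = lie_op V \<eta>"
proof -
  have "lie_form L V \<eta> = (THE \<omega>. \<omega> \<in> all_forms L \<and> (\<forall>Vs. set Vs \<subseteq> sections L \<longrightarrow> eval_form \<omega> Vs = lie_eval V \<eta> Vs))"
    by (simp only: lie_form_def lie_eval_def[abs_def])
  also have "\<dots> = lie_op V \<eta>"
    by (rule the_equality)
       (use lin_op_closed[OF lin_op_lie_op[OF V] \<eta>] eval_lie_op[OF V \<eta>] in \<open>auto intro!: all_forms_eqI\<close>)
  finally show ?thesis .
qed

end

section \<open>Cartan calculus\<close>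

context algebroid begin

lemma lie_op_alt: "lie_op V \<eta> = graded_bracket 1 (-1) (d_rho L) (insert_vector V) \<eta>"
  by (simp add: lie_op_def graded_bracket_def powi_minus_one fun_eq_iff)

lemma lie_op_Nil:
  assumes "V \<in> sections L" "\<eta> \<in> all_forms L"
  shows "lie_op V \<eta> x [] = lie_fun L V (\<lambda>x. \<eta> x []) x"
  using fun_cong[OF eval_lie_op[OF assms, of "[]"], of x] by (simp add: eval_form_def lie_eval_Nil)

lemma bracket_lie_insert:
  assumes V: "V \<in> sections L" and W: "W \<in> sections L" and \<eta>: "\<eta> \<in> all_forms L"
  shows "graded_bracket 0 (-1) (lie_op V) (insert_vector W) \<eta> = insert_vector (bra V W) \<eta>"
proof (rule all_forms_eqI)
  show "graded_bracket 0 (-1) (lie_op V) (insert_vector W) \<eta> \<in> all_forms L"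
    by (intro lin_op_closed[OF lin_op_graded_bracket] lin_op_lie_op lin_op_insert_vector V W \<eta>)
  show "insert_vector (bra V W) \<eta> \<in> all_forms L" by (intro insert_vector_in bra_in V W \<eta>)
  fix Vs assume Vs: "set Vs \<subseteq> sections L"
  show "eval_form (graded_bracket 0 (-1) (lie_op V) (insert_vector W) \<eta>) Vs = eval_form (insert_vector (bra V W) \<eta>) Vs"
  proof
    fix x
    have "eval_form (graded_bracket 0 (-1) (lie_op V) (insert_vector W) \<eta>) Vs x =
        eval_form (lie_op V (insert_vector W \<eta>)) Vs x - eval_form (lie_op V \<eta>) (W # Vs) x"
      by (simp add: graded_bracket_def eval_form_def insert_vector_def)
    also have "\<dots> = eval_form (insert_vector (bra V W) \<eta>) Vs x"
      using V W \<eta> Vs by (simp add: eval_lie_op insert_vector_in lie_eval_Cons eval_form_Cons[of \<eta> "bra V W"])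
    finally show "eval_form (graded_bracket 0 (-1) (lie_op V) (insert_vector W) \<eta>) Vs x =
        eval_form (insert_vector (bra V W) \<eta>) Vs x" .
  qed
qed

lemma bracket_lie_smult:
  assumes V: "V \<in> sections L" and f: "smooth f" and \<eta>: "\<eta> \<in> all_forms L"
  shows "graded_bracket 0 0 (lie_op V) (smult_form f) \<eta> = smult_form (lie_fun L V f) \<eta>"
proof (rule all_forms_eqI)
  show "graded_bracket 0 0 (lie_op V) (smult_form f) \<eta> \<in> all_forms L"
    by (intro lin_op_closed[OF lin_op_graded_bracket] lin_op_lie_op lin_op_smult V f \<eta>)
  show "smult_form (lie_fun L V f) \<eta> \<in> all_forms L" by (intro all_forms_smult lie_fun_smooth V f \<eta>)
  fix Vs assume Vs: "set Vs \<subseteq> sections L"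
  show "eval_form (graded_bracket 0 0 (lie_op V) (smult_form f) \<eta>) Vs = eval_form (smult_form (lie_fun L V f) \<eta>) Vs"
  proof
    fix x
    have "eval_form (graded_bracket 0 0 (lie_op V) (smult_form f) \<eta>) Vs x =
        eval_form (lie_op V (smult_form f \<eta>)) Vs x - f x * eval_form (lie_op V \<eta>) Vs x"
      by (simp add: graded_bracket_def eval_form_def)
    also have "\<dots> = eval_form (smult_form (lie_fun L V f) \<eta>) Vs x"
      using eval_lie_op[OF V all_forms_smult[OF f \<eta>] Vs] eval_lie_op[OF V \<eta> Vs] lie_eval_smult[OF V \<eta> f Vs, of x]
      by (simp add: eval_smult)
    finally show "eval_form (graded_bracket 0 0 (lie_op V) (smult_form f) \<eta>) Vs x =
        eval_form (smult_form (lie_fun L V f) \<eta>) Vs x" .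
  qed
qed

text \<open>This is exterior multiplication by df. Its commutators with i(V) and with functions are
  all that is used, so no general exterior product of forms is introduced.\<close>

definition d_fun_op :: "('m \<Rightarrow> real) \<Rightarrow> ('m, 'e) form \<Rightarrow> ('m, 'e) form" where
  "d_fun_op f = graded_bracket 1 0 (d_rho L) (smult_form f)"

lemma lin_op_d_fun_op: "smooth f \<Longrightarrow> lin_op (d_fun_op f)"
  unfolding d_fun_op_def by (intro lin_op_graded_bracket lin_op_d_rho lin_op_smult)

lemma gcomm_smult_smult: "gcomm a 0 (smult_form f) (smult_form g)"
  by (rule gcommI) (simp add: graded_bracket_def)

lemma gcomm_smult_insert: "gcomm 0 a (smult_form f) (insert_vector V)"
  by (rule gcommI) (simp add: graded_bracket_def insert_vector_def)

lemma bracket_d_fun_op_insert: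
  assumes V: "V \<in> sections L" and f: "smooth f" and \<eta>: "\<eta> \<in> all_forms L"
  shows "graded_bracket 1 (-1) (d_fun_op f) (insert_vector V) \<eta> = smult_form (lie_fun L V f) \<eta>"
proof (intro ext)
  fix x vs
  have "graded_bracket 1 (-1) (d_fun_op f) (insert_vector V) \<eta> x vs =
      graded_bracket 0 0 (graded_bracket 1 (-1) (d_rho L) (insert_vector V)) (smult_form f) \<eta> x vs"
    unfolding d_fun_op_def
    using jacobi_left[OF lin_op_d_rho lin_op_smult[OF f] lin_op_insert_vector[OF V] \<eta> gcomm_smult_insert,
        where e = 1 and f = 0 and a = 1] by simp
  also have "\<dots> = graded_bracket 0 0 (lie_op V) (smult_form f) \<eta> x vs"
    by (simp add: graded_bracket_cong_left[OF lin_op_smult[OF f] \<eta> lie_op_alt[symmetric]])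
  finally show "graded_bracket 1 (-1) (d_fun_op f) (insert_vector V) \<eta> x vs = lie_fun L V f x * \<eta> x vs"
    by (simp add: bracket_lie_smult[OF V f \<eta>])
qed

text \<open>The commutator of [[d,f],g] with i(V) reduces to that of two multiplications, by the
  derivative of f along V and by g, which is 0; being of degree 1, the operator vanishes.\<close>

lemma gcomm_d_fun_op_smult:
  assumes f: "smooth f" and g: "smooth g"
  shows "gcomm 1 0 (d_fun_op f) (smult_form g)"
proof (rule gcommI)
  fix \<eta> x vs assume \<eta>: "\<eta> \<in> all_forms L"
  show "graded_bracket 1 0 (d_fun_op f) (smult_form g) \<eta> x vs = 0"
  proof (rule operator_eq_0[OF _ _ _ \<eta>])
    show "lin_op (graded_bracket 1 0 (d_fun_op f) (smult_form g))"
      by (intro lin_op_graded_bracket lin_op_d_fun_op lin_op_smult f g)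
    show "gcomm 1 (-1) (graded_bracket 1 0 (d_fun_op f) (smult_form g)) (insert_vector V)"
      if V: "V \<in> sections L" for V
    proof (rule gcommI)
      fix \<eta> x vs assume \<eta>: "\<eta> \<in> all_forms L"
      have "graded_bracket 1 (-1) (graded_bracket 1 0 (d_fun_op f) (smult_form g)) (insert_vector V) \<eta> x vs =
          graded_bracket 0 0 (graded_bracket 1 (-1) (d_fun_op f) (insert_vector V)) (smult_form g) \<eta> x vs"
        using jacobi_left[OF lin_op_d_fun_op[OF f] lin_op_smult[OF g] lin_op_insert_vector[OF V] \<eta> gcomm_smult_insert,
          where e = 1 and f = 0 and a = 1] by simp
      also have "\<dots> = graded_bracket 0 0 (smult_form (lie_fun L V f)) (smult_form g) \<eta> x vs"
        by (simp only: graded_bracket_cong_left[OF lin_op_smult[OF g] \<eta> bracket_d_fun_op_insert[OF V f]])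
      also have "\<dots> = 0" using gcommD[OF gcomm_smult_smult \<eta>] by simp
      finally show "graded_bracket 1 (-1) (graded_bracket 1 0 (d_fun_op f) (smult_form g)) (insert_vector V) \<eta> x vs = 0" .
    qed
    show "graded_bracket 1 0 (d_fun_op f) (smult_form g) \<eta> x [] = 0" if "\<eta> \<in> all_forms L" for \<eta> x
      using that by (simp add: graded_bracket_def d_fun_op_def d_rho_0 all_forms_smult f g)
  qed
qed

text \<open>Both sides have degree 0, so agreement on the degree 0 component has to be checked and
  is \<open>anchor_hom\<close>. That their difference commutes with i(U) is the Jacobi identity of
  the bracket of sections.\<close>

lemma bracket_lie_lie:
  assumes V: "V \<in> sections L" and W: "W \<in> sections L" and \<eta>: "\<eta> \<in> all_forms L"
  shows "graded_bracket 0 0 (lie_op V) (lie_op W) \<eta> = lie_op (bra V W) \<eta>"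
proof -
  note VW = bra_in[OF V W]
  note lV = lin_op_lie_op[OF V] and lW = lin_op_lie_op[OF W] and lVW = lin_op_lie_op[OF VW]
  let ?F = "\<lambda>\<eta> x vs. graded_bracket 0 0 (lie_op V) (lie_op W) \<eta> x vs - lie_op (bra V W) \<eta> x vs"
  note lb = lin_op_graded_bracket[OF lV lW, of 0 0]
  have "?F \<eta> x vs = 0" for x vs
  proof (rule operator_eq_0[where F = ?F and e = 0, OF _ _ _ \<eta>])
    show "lin_op ?F"
      by (rule lin_opI)
         (use lb lVW in \<open>simp_all add: lin_op_comb all_forms_diff lin_op_closed algebra_simps\<close>)
    show "gcomm 0 (-1) ?F (insert_vector U)" if U: "U \<in> sections L" for U
    proof (rule gcommI)
      fix \<eta> x vs assume \<eta>: "\<eta> \<in> all_forms L"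
      note lU = lin_op_insert_vector[OF U]
      have "graded_bracket 0 (-1) (graded_bracket 0 0 (lie_op V) (lie_op W)) (insert_vector U) \<eta> x vs =
          graded_bracket 0 (-1) (lie_op V) (graded_bracket 0 (-1) (lie_op W) (insert_vector U)) \<eta> x vs +
          graded_bracket (-1) 0 (graded_bracket 0 (-1) (lie_op V) (insert_vector U)) (lie_op W) \<eta> x vs"
        using graded_bracket_jacobi[OF lV lW lU \<eta>, of 0 0 "-1" x vs] by simp
      also have "graded_bracket 0 (-1) (lie_op V) (graded_bracket 0 (-1) (lie_op W) (insert_vector U)) \<eta> =
          graded_bracket 0 (-1) (lie_op V) (insert_vector (bra W U)) \<eta>"
        by (rule graded_bracket_cong_right[OF lV \<eta> bracket_lie_insert[OF W U]])
      also have "graded_bracket (-1) 0 (graded_bracket 0 (-1) (lie_op V) (insert_vector U)) (lie_op W) \<eta> =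
          graded_bracket (-1) 0 (insert_vector (bra V U)) (lie_op W) \<eta>"
        by (rule graded_bracket_cong_left[OF lW \<eta> bracket_lie_insert[OF V U]])
      finally have 1: "graded_bracket 0 (-1) (graded_bracket 0 0 (lie_op V) (lie_op W)) (insert_vector U) \<eta> x vs =
          insert_vector (bra V (bra W U)) \<eta> x vs - insert_vector (bra W (bra V U)) \<eta> x vs"
        using graded_bracket_anti[of "-1" 0 "insert_vector (bra V U)" "lie_op W" \<eta> x vs]
        by (simp add: bracket_lie_insert V W U bra_in \<eta>)
      have an: "insert_vector (bra A B) \<eta> x vs = - insert_vector (bra B A) \<eta> x vs"
        if "A \<in> sections L" "B \<in> sections L" for A B
        by (subst bra_anti[OF that]) (simp add: insert_sec_scale \<eta> bra_in that)
      have an2: "insert_vector (bra A (bra B C)) \<eta> x vs = - insert_vector (bra A (bra C B)) \<eta> x vs"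
        if "A \<in> sections L" "B \<in> sections L" "C \<in> sections L" for A B C
        by (subst bra_anti[OF that(2,3)]) (simp add: insert_sec_scale \<eta> bra_in that bra_scale(2))
      have "insert_vector (vzero L) \<eta> x vs = 0"
        using insert_sec_scale[OF \<eta> vzero_in, of "\<lambda>x. 0"]
        by (simp add: sec_scale_def[abs_def] vscale_0[OF fibre_closed(1)] fun_eq_iff insert_vector_def)
      then have "insert_vector (bra V (bra W U)) \<eta> x vs +
          (insert_vector (bra W (bra U V)) \<eta> x vs + insert_vector (bra U (bra V W)) \<eta> x vs) = 0"
        using bra_jacobi[OF V W U] by (simp add: insert_sec_add[OF \<eta>, symmetric, THEN fun_cong, THEN fun_cong] V W U bra_in sec_add_in)
      then have "insert_vector (bra V (bra W U)) \<eta> x vs - insert_vector (bra W (bra V U)) \<eta> x vs =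
          insert_vector (bra (bra V W) U) \<eta> x vs"
        using an2[OF W U V] an[OF U VW] by simp
      moreover have "graded_bracket 0 (-1) (lie_op (bra V W)) (insert_vector U) \<eta> x vs = insert_vector (bra (bra V W) U) \<eta> x vs"
        by (simp only: bracket_lie_insert[OF VW U \<eta>])
      moreover have "graded_bracket 0 (-1) ?F (insert_vector U) \<eta> x vs =
          graded_bracket 0 (-1) (graded_bracket 0 0 (lie_op V) (lie_op W)) (insert_vector U) \<eta> x vs -
          graded_bracket 0 (-1) (lie_op (bra V W)) (insert_vector U) \<eta> x vs"
        by (simp add: graded_bracket_def[of 0 "-1"] insert_vector_def)
      ultimately show "graded_bracket 0 (-1) ?F (insert_vector U) \<eta> x vs = 0"
        using 1 by simp
    qed
    show "?F \<eta> x [] = 0" if \<eta>: "\<eta> \<in> all_forms L" for \<eta> x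
    proof -
      have "smooth (\<lambda>x. \<eta> x [])" using eval_form_smooth[OF \<eta>, of "[]"] by (simp add: eval_form_def)
      moreover have "(\<lambda>x. lie_op A \<eta> x []) = lie_fun L A (\<lambda>x. \<eta> x [])" if "A \<in> sections L" for A
        using lie_op_Nil[OF that \<eta>] by auto
      ultimately show ?thesis
        using V W VW \<eta> by (simp add: graded_bracket_def lie_op_Nil lin_op_closed[OF lV] lin_op_closed[OF lW] anchor_hom)
    qed
  qed
  then show ?thesis by (auto simp: fun_eq_iff)
qed

text \<open>The commutator with i(W) is the difference of [L(V), L(W)] and [i({V,W}), d], both equal
  to L({V,W}). On the empty list d gives 0, so no further component remains.\<close>

lemma gcomm_lie_d:
  assumes V: "V \<in> sections L"
  shows "gcomm 0 1 (lie_op V) (d_rho L)"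
proof (rule gcommI)
  note lV = lin_op_lie_op[OF V]
  fix \<eta> x vs assume \<eta>: "\<eta> \<in> all_forms L"
  show "graded_bracket 0 1 (lie_op V) (d_rho L) \<eta> x vs = 0"
  proof (rule operator_eq_0[where e = 1, OF lin_op_graded_bracket[OF lV lin_op_d_rho] _ _ \<eta>])
    show "gcomm 1 (-1) (graded_bracket 0 1 (lie_op V) (d_rho L)) (insert_vector W)" if W: "W \<in> sections L" for W
    proof (rule gcommI)
      fix \<eta> x vs assume \<eta>: "\<eta> \<in> all_forms L"
      note lW = lin_op_insert_vector[OF W]
      have "graded_bracket 1 (-1) (graded_bracket 0 1 (lie_op V) (d_rho L)) (insert_vector W) \<eta> x vs =
          graded_bracket 0 0 (lie_op V) (graded_bracket 1 (-1) (d_rho L) (insert_vector W)) \<eta> x vs -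
          graded_bracket (-1) 1 (graded_bracket 0 (-1) (lie_op V) (insert_vector W)) (d_rho L) \<eta> x vs"
        using graded_bracket_jacobi[OF lV lin_op_d_rho lW \<eta>, of 0 1 "-1" x vs] by (simp add: powi_minus_one)
      also have "graded_bracket 0 0 (lie_op V) (graded_bracket 1 (-1) (d_rho L) (insert_vector W)) \<eta> =
          graded_bracket 0 0 (lie_op V) (lie_op W) \<eta>"
        by (rule graded_bracket_cong_right[OF lV \<eta> lie_op_alt[symmetric]])
      also have "\<dots> = lie_op (bra V W) \<eta>" by (rule bracket_lie_lie[OF V W \<eta>])
      also have "graded_bracket (-1) 1 (graded_bracket 0 (-1) (lie_op V) (insert_vector W)) (d_rho L) \<eta> =
          graded_bracket (-1) 1 (insert_vector (bra V W)) (d_rho L) \<eta>"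
        by (rule graded_bracket_cong_left[OF lin_op_d_rho \<eta> bracket_lie_insert[OF V W]])
      also have "\<dots> = lie_op (bra V W) \<eta>" by (simp add: lie_op_def)
      finally show "graded_bracket 1 (-1) (graded_bracket 0 1 (lie_op V) (d_rho L)) (insert_vector W) \<eta> x vs = 0"
        by simp
    qed
    show "graded_bracket 0 1 (lie_op V) (d_rho L) \<eta> x [] = 0" if \<eta>: "\<eta> \<in> all_forms L" for \<eta> x
      using d_rho_0[OF \<eta>] d_rho_0[OF lin_op_closed[OF lV \<eta>]]
      by (simp add: graded_bracket_def lie_op_Nil[OF V] d_rho_in \<eta> lie_fun_0[OF V])
  qed
qed

text \<open>The commutator of d o d with i(V) is d L(V) - L(V) d = 0, and forms in the image of d
  have no component of degree 0.\<close>

lemma d_rho_d_rho: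
  assumes \<eta>: "\<eta> \<in> all_forms L"
  shows "d_rho L (d_rho L \<eta>) x vs = 0"
proof (rule operator_eq_0[where F = "\<lambda>\<eta>. d_rho L (d_rho L \<eta>)" and e = 2, OF lin_op_compose[OF lin_op_d_rho lin_op_d_rho] _ _ \<eta>])
  show "gcomm 2 (-1) (\<lambda>\<eta>. d_rho L (d_rho L \<eta>)) (insert_vector V)" if V: "V \<in> sections L" for V
  proof (rule gcommI)
    fix \<eta> x vs assume \<eta>: "\<eta> \<in> all_forms L"
    have "graded_bracket 2 (-1) (\<lambda>\<eta>. d_rho L (d_rho L \<eta>)) (insert_vector V) \<eta> x vs =
        d_rho L (lie_op V \<eta>) x vs - lie_op V (d_rho L \<eta>) x vs"
      using graded_bracket_compose_left[OF lin_op_d_rho lin_op_d_rho lin_op_insert_vector[OF V] \<eta>, of 1 1 "-1" x vs]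
      by (simp add: powi_minus_one lie_op_alt)
    then show "graded_bracket 2 (-1) (\<lambda>\<eta>. d_rho L (d_rho L \<eta>)) (insert_vector V) \<eta> x vs = 0"
      using gcommD[OF gcomm_lie_d[OF V] \<eta>] by (simp add: graded_bracket_def fun_eq_iff)
  qed
qed (simp add: d_rho_0 d_rho_in)

lemma has_deg_lie_op: "V \<in> sections L \<Longrightarrow> has_deg 0 (lie_op V)"
  unfolding lie_op_def
  by (rule has_deg_bracket[OF lin_op_insert_vector lin_op_d_rho has_deg_insert_vector has_deg_d_rho]) simp_all

lemma has_deg_d_fun_op: "smooth f \<Longrightarrow> has_deg 1 (d_fun_op f)"
  unfolding d_fun_op_def
  by (rule has_deg_bracket[OF lin_op_d_rho lin_op_smult has_deg_d_rho has_deg_smult]) simp_all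

section \<open>The Schouten-Nijenhuis bracket\<close>

text \<open>Up to sign this operator is the interior product by the Lie derivative of P along W. Its
  counterpart for \<open>d_fun_op\<close> is, up to sign, the interior product by the contraction of
  P with df. These are the fields R that occur in \<open>mv_op_sn\<close>.\<close>

lemma mv_op_bracket_lie:
  assumes P: "P \<in> multivector_fields L p" and W: "W \<in> sections L"
  shows "mv_op p (graded_bracket (- p) 0 (int_prod P) (lie_op W))"
  unfolding mv_op_def
proof (intro conjI ballI allI impI)
  note p = mv_opD[OF mv_op_int_prod[OF P]] and lW = lin_op_lie_op[OF W]
  show "lin_op (graded_bracket (- p) 0 (int_prod P) (lie_op W))" by (rule lin_op_graded_bracket[OF p(1) lW])
  show "has_deg (- p) (graded_bracket (- p) 0 (int_prod P) (lie_op W))"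
    by (rule has_deg_bracket[OF p(1) lW p(2) has_deg_lie_op[OF W]]) simp
  show "gcomm (- p) (-1) (graded_bracket (- p) 0 (int_prod P) (lie_op W)) (insert_vector V)"
    if V: "V \<in> sections L" for V
  proof (rule gcommI)
    fix \<eta> x vs assume \<eta>: "\<eta> \<in> all_forms L"
    have "graded_bracket (- p) (-1) (graded_bracket (- p) 0 (int_prod P) (lie_op W)) (insert_vector V) \<eta> x vs =
        graded_bracket (- p) (-1) (int_prod P) (graded_bracket 0 (-1) (lie_op W) (insert_vector V)) \<eta> x vs"
      by (rule jacobi_right[OF p(1) lW lin_op_insert_vector[OF V] \<eta> p(3)[OF V]]) simp_all
    also have "\<dots> = graded_bracket (- p) (-1) (int_prod P) (insert_vector (bra W V)) \<eta> x vs"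
      by (simp only: graded_bracket_cong_right[OF p(1) \<eta> bracket_lie_insert[OF W V]])
    also have "\<dots> = 0" using gcommD[OF p(3)[OF bra_in[OF W V]] \<eta>] by simp
    finally show "graded_bracket (- p) (-1) (graded_bracket (- p) 0 (int_prod P) (lie_op W)) (insert_vector V) \<eta> x vs = 0" .
  qed
  show "gcomm (- p) 0 (graded_bracket (- p) 0 (int_prod P) (lie_op W)) (smult_form f)" if f: "smooth f" for f
  proof (rule gcommI)
    fix \<eta> x vs assume \<eta>: "\<eta> \<in> all_forms L"
    have "graded_bracket (- p) 0 (graded_bracket (- p) 0 (int_prod P) (lie_op W)) (smult_form f) \<eta> x vs =
        graded_bracket (- p) 0 (int_prod P) (graded_bracket 0 0 (lie_op W) (smult_form f)) \<eta> x vs"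
      by (rule jacobi_right[OF p(1) lW lin_op_smult[OF f] \<eta> p(4)[OF f]]) simp_all
    also have "\<dots> = graded_bracket (- p) 0 (int_prod P) (smult_form (lie_fun L W f)) \<eta> x vs"
      by (simp only: graded_bracket_cong_right[OF p(1) \<eta> bracket_lie_smult[OF W f]])
    also have "\<dots> = 0" using gcommD[OF p(4)[OF lie_fun_smooth[OF W f]] \<eta>] by simp
    finally show "graded_bracket (- p) 0 (graded_bracket (- p) 0 (int_prod P) (lie_op W)) (smult_form f) \<eta> x vs = 0" .
  qed
qed

lemma mv_op_bracket_d_fun_op:
  assumes P: "P \<in> multivector_fields L p" and f: "smooth f"
  shows "mv_op (p - 1) (graded_bracket (- p) 1 (int_prod P) (d_fun_op f))"
  unfolding mv_op_def
proof (intro conjI ballI allI impI)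
  note p = mv_opD[OF mv_op_int_prod[OF P]] and lf = lin_op_d_fun_op[OF f]
  show "lin_op (graded_bracket (- p) 1 (int_prod P) (d_fun_op f))" by (rule lin_op_graded_bracket[OF p(1) lf])
  show "has_deg (- (p - 1)) (graded_bracket (- p) 1 (int_prod P) (d_fun_op f))"
    by (rule has_deg_bracket[OF p(1) lf p(2) has_deg_d_fun_op[OF f]]) simp
  show "gcomm (- (p - 1)) (-1) (graded_bracket (- p) 1 (int_prod P) (d_fun_op f)) (insert_vector V)"
    if V: "V \<in> sections L" for V
  proof (rule gcommI)
    fix \<eta> x vs assume \<eta>: "\<eta> \<in> all_forms L"
    have "graded_bracket (- (p - 1)) (-1) (graded_bracket (- p) 1 (int_prod P) (d_fun_op f)) (insert_vector V) \<eta> x vs =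
        graded_bracket (- p) 0 (int_prod P) (graded_bracket 1 (-1) (d_fun_op f) (insert_vector V)) \<eta> x vs"
      by (rule jacobi_right[OF p(1) lf lin_op_insert_vector[OF V] \<eta> p(3)[OF V]]) simp_all
    also have "\<dots> = graded_bracket (- p) 0 (int_prod P) (smult_form (lie_fun L V f)) \<eta> x vs"
      by (simp only: graded_bracket_cong_right[OF p(1) \<eta> bracket_d_fun_op_insert[OF V f]])
    also have "\<dots> = 0" using gcommD[OF p(4)[OF lie_fun_smooth[OF V f]] \<eta>] by simp
    finally show "graded_bracket (- (p - 1)) (-1) (graded_bracket (- p) 1 (int_prod P) (d_fun_op f)) (insert_vector V) \<eta> x vs = 0" .
  qed
  show "gcomm (- (p - 1)) 0 (graded_bracket (- p) 1 (int_prod P) (d_fun_op f)) (smult_form g)" if g: "smooth g" for g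
    by (rule gcomm_bracket[OF p(1) lf lin_op_smult[OF g] p(4)[OF g] gcomm_d_fun_op_smult[OF f g]]) simp
qed

text \<open>The Lie derivative of forms along the multivector field P; it is the inner commutator in
  the definition of the bracket and reduces to \<open>lie_op\<close> for a section.\<close>

definition d_op :: "int \<Rightarrow> ('m, 'e) multivector_field \<Rightarrow> ('m, 'e) form \<Rightarrow> ('m, 'e) form" where
  "d_op p P = graded_bracket (- p) 1 (int_prod P) (d_rho L)"

lemma lin_op_d_op: "P \<in> multivector_fields L p \<Longrightarrow> lin_op (d_op p P)"
  unfolding d_op_def by (intro lin_op_graded_bracket lin_op_int_prod lin_op_d_rho)

text \<open>Since i(Q) commutes with i(V) and with f, the Jacobi identity moves these inside:
  [[i(P),d],i(V)] = [i(P),L(V)] and [[i(P),d],f] = [i(P),[d,f]]. Both are interior products by some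
  R, and these commute with i(Q).\<close>

lemma mv_op_sn:
  assumes P: "P \<in> multivector_fields L p" and Q: "Q \<in> multivector_fields L q"
  shows "mv_op (p + q - 1) (graded_bracket (1 - p) (- q) (d_op p P) (int_prod Q))"
  unfolding mv_op_def
proof (intro conjI ballI allI impI)
  note p = mv_opD[OF mv_op_int_prod[OF P]] and q = mv_opD[OF mv_op_int_prod[OF Q]]
  note dP = lin_op_d_op[OF P]
  let ?S = "graded_bracket (1 - p) (- q) (d_op p P) (int_prod Q)"
  show "lin_op ?S" by (rule lin_op_graded_bracket[OF dP q(1)])
  have "has_deg (1 - p) (d_op p P)"
    unfolding d_op_def by (rule has_deg_bracket[OF p(1) lin_op_d_rho p(2) has_deg_d_rho]) simp
  then show "has_deg (- (p + q - 1)) ?S"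
    by (rule has_deg_bracket[OF dP q(1) _ q(2)]) simp
  show "gcomm (- (p + q - 1)) (-1) ?S (insert_vector V)" if V: "V \<in> sections L" for V
  proof (rule gcommI)
    fix \<eta> x vs assume \<eta>: "\<eta> \<in> all_forms L"
    note lV = lin_op_insert_vector[OF V]
    obtain R where R: "R \<in> multivector_fields L p"
      "\<And>\<eta>. \<eta> \<in> all_forms L \<Longrightarrow> int_prod R \<eta> = graded_bracket (- p) 0 (int_prod P) (lie_op V) \<eta>"
      using multivector_of_operator[OF mv_op_bracket_lie[OF P V]] by blast
    have R': "graded_bracket (1 - p) (-1) (d_op p P) (insert_vector V) \<eta> = int_prod R \<eta>" if \<eta>: "\<eta> \<in> all_forms L" for \<eta>
    proof -
      have "graded_bracket (1 - p) (-1) (d_op p P) (insert_vector V) \<eta> =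
          graded_bracket (- p) 0 (int_prod P) (graded_bracket 1 (-1) (d_rho L) (insert_vector V)) \<eta>"
        unfolding d_op_def
        by (intro ext, rule jacobi_right[OF p(1) lin_op_d_rho lV \<eta> p(3)[OF V]]) simp_all
      then show ?thesis
        by (simp only: graded_bracket_cong_right[OF p(1) \<eta> lie_op_alt[symmetric]] R(2)[OF \<eta>])
    qed
    have "graded_bracket (- (p + q - 1)) (-1) ?S (insert_vector V) \<eta> x vs =
        (-1) powi (- q * -1) * graded_bracket (- p) (- q) (graded_bracket (1 - p) (-1) (d_op p P) (insert_vector V)) (int_prod Q) \<eta> x vs"
      by (rule jacobi_left[OF dP q(1) lV \<eta> q(3)[OF V]]) simp_all
    also have "\<dots> = 0"
      using graded_bracket_cong_left[OF q(1) \<eta> R'] gcommD[OF int_prod_commute[OF R(1) Q] \<eta>] by simp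
    finally show "graded_bracket (- (p + q - 1)) (-1) ?S (insert_vector V) \<eta> x vs = 0" .
  qed
  show "gcomm (- (p + q - 1)) 0 ?S (smult_form f)" if f: "smooth f" for f
  proof (rule gcommI)
    fix \<eta> x vs assume \<eta>: "\<eta> \<in> all_forms L"
    note lf = lin_op_smult[OF f]
    obtain R where R: "R \<in> multivector_fields L (p - 1)"
      "\<And>\<eta>. \<eta> \<in> all_forms L \<Longrightarrow> int_prod R \<eta> = graded_bracket (- p) 1 (int_prod P) (d_fun_op f) \<eta>"
      using multivector_of_operator[OF mv_op_bracket_d_fun_op[OF P f]] by blast
    have R': "graded_bracket (1 - p) 0 (d_op p P) (smult_form f) \<eta> = int_prod R \<eta>" if \<eta>: "\<eta> \<in> all_forms L" for \<eta>
    proof -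
      have "graded_bracket (1 - p) 0 (d_op p P) (smult_form f) \<eta> =
          graded_bracket (- p) 1 (int_prod P) (graded_bracket 1 0 (d_rho L) (smult_form f)) \<eta>"
        unfolding d_op_def
        by (intro ext, rule jacobi_right[OF p(1) lin_op_d_rho lf \<eta> p(4)[OF f]]) simp_all
      then show ?thesis
        by (simp only: d_fun_op_def[symmetric] R(2)[OF \<eta>])
    qed
    have "graded_bracket (- (p + q - 1)) 0 ?S (smult_form f) \<eta> x vs =
        (-1) powi (- q * 0) * graded_bracket (- (p - 1)) (- q) (graded_bracket (1 - p) 0 (d_op p P) (smult_form f)) (int_prod Q) \<eta> x vs"
      by (rule jacobi_left[OF dP q(1) lf \<eta> q(4)[OF f]]) simp_all
    also have "\<dots> = 0"
      using graded_bracket_cong_left[OF q(1) \<eta> R'] gcommD[OF int_prod_commute[OF R(1) Q] \<eta>] by simp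
    finally show "graded_bracket (- (p + q - 1)) 0 ?S (smult_form f) \<eta> x vs = 0" .
  qed
qed

lemma sn_bracket:
  assumes P: "P \<in> multivector_fields L p" and Q: "Q \<in> multivector_fields L q"
  shows sn_in: "sn_bracket L p q P Q \<in> multivector_fields L (p + q - 1)"
    and int_prod_sn: "\<eta> \<in> all_forms L \<Longrightarrow>
      int_prod (sn_bracket L p q P Q) \<eta> = graded_bracket (1 - p) (- q) (d_op p P) (int_prod Q) \<eta>"
proof -
  obtain R where R: "R \<in> multivector_fields L (p + q - 1)"
    "\<And>\<eta>. \<eta> \<in> all_forms L \<Longrightarrow> int_prod R \<eta> = graded_bracket (1 - p) (- q) (d_op p P) (int_prod Q) \<eta>"
    using multivector_of_operator[OF mv_op_sn[OF P Q]] by blast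
  have "sn_bracket L p q P Q = R"
    unfolding sn_bracket_def
  proof (rule the_equality, intro conjI ballI)
    show "R \<in> multivector_fields L (p + q - 1)" by (rule R(1))
    show "int_prod R \<eta> = graded_bracket (1 - p) (- q) (graded_bracket (- p) 1 (int_prod P) (d_rho L)) (int_prod Q) \<eta>"
      if "\<eta> \<in> all_forms L" for \<eta>
      using R(2)[OF that] by (simp only: d_op_def)
    fix S assume S: "S \<in> multivector_fields L (p + q - 1) \<and> (\<forall>\<eta>\<in>all_forms L. int_prod S \<eta> =
        graded_bracket (1 - p) (- q) (graded_bracket (- p) 1 (int_prod P) (d_rho L)) (int_prod Q) \<eta>)"
    show "S = R"
    proof (rule mv_eqI[OF R(1)])
      show "S x a = 0" if "a \<notin> alt_forms L x" for x a
        using mv_out[OF _ that] S by blast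
    qed (use S R(2) in \<open>simp add: d_op_def\<close>)
  qed
  with R show "sn_bracket L p q P Q \<in> multivector_fields L (p + q - 1)"
    "\<eta> \<in> all_forms L \<Longrightarrow>
      int_prod (sn_bracket L p q P Q) \<eta> = graded_bracket (1 - p) (- q) (d_op p P) (int_prod Q) \<eta>"
    by simp_all
qed

lemma sn_eqI:
  assumes P: "P \<in> multivector_fields L p" and Q: "Q \<in> multivector_fields L q"
    and S: "S \<in> multivector_fields L (p + q - 1)"
    "\<And>\<eta> x vs. \<eta> \<in> all_forms L \<Longrightarrow>
      int_prod S \<eta> x vs = graded_bracket (1 - p) (- q) (d_op p P) (int_prod Q) \<eta> x vs"
  shows "sn_bracket L p q P Q = S"
proof (rule mv_eqI[OF S(1)])
  show "sn_bracket L p q P Q x a = 0" if "a \<notin> alt_forms L x" for x a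
    by (rule mv_out[OF sn_in[OF P Q] that])
  show "int_prod (sn_bracket L p q P Q) \<eta> = int_prod S \<eta>" if "\<eta> \<in> all_forms L" for \<eta>
    by (intro ext) (simp add: int_prod_sn[OF P Q that] S(2)[OF that])
qed

section \<open>Brackets with functions and sections\<close>

lemma mv_neg_degree:
  assumes P: "P \<in> multivector_fields L p" and "p < 0"
  shows "P = zero_mv"
proof (intro ext)
  fix x a
  obtain W \<Phi> where W: "(W, \<Phi>) \<in> trivs L" "x \<in> W" by (rule triv_cover)
  obtain c :: "nat list \<Rightarrow> 'm \<Rightarrow> real" where
    "\<forall>x\<in>W. \<forall>a\<in>alt_forms L x. P x a = (\<Sum>I\<in>frame_indices_of p. c I x * a (frame_list \<Phi> x I))"
    using mv_expand[OF P W(1)] by (elim exE conjE)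
  then have "P x a = 0" if "a \<in> alt_forms L x" using W(2) that \<open>p < 0\<close> by (auto intro!: sum.neutral)
  then show "P x a = zero_mv x a" using mv_out[OF P] by (cases "a \<in> alt_forms L x") (simp_all add: zero_mv_def)
qed

lemma d_op_sec_mv: "\<eta> \<in> all_forms L \<Longrightarrow> d_op 1 (sec_mv L V) \<eta> = lie_op V \<eta>"
  unfolding d_op_def lie_op_def by (rule graded_bracket_cong_left[OF lin_op_d_rho _ int_prod_sec_mv])

lemma sn_sec_left:
  assumes V: "V \<in> sections L" and Q: "Q \<in> multivector_fields L q" and \<eta>: "\<eta> \<in> all_forms L"
  shows "int_prod (sn_bracket L 1 q (sec_mv L V) Q) \<eta> = graded_bracket 0 (- q) (lie_op V) (int_prod Q) \<eta>"
proof -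
  have "graded_bracket 0 (- q) (d_op 1 (sec_mv L V)) (int_prod Q) \<eta> = graded_bracket 0 (- q) (lie_op V) (int_prod Q) \<eta>"
    by (rule graded_bracket_cong_left[OF lin_op_int_prod[OF Q] \<eta> d_op_sec_mv])
  then show ?thesis using int_prod_sn[OF sec_mv_in[OF V] Q \<eta>] by simp
qed

text \<open>The bracket has degree -1, and no index list has negative length.\<close>

lemma sn_functions:
  assumes "smooth f" "smooth g"
  shows "sn_bracket L 0 0 (fun_mv L f) (fun_mv L g) = zero_mv"
  using sn_in[OF fun_mv_in[OF assms(1)] fun_mv_in[OF assms(2)]] by (intro mv_neg_degree[of _ "-1"]) simp_all

lemma sn_sections:
  assumes V: "V \<in> sections L" and W: "W \<in> sections L"
  shows "sn_bracket L 1 1 (sec_mv L V) (sec_mv L W) = sec_mv L (bra V W)"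
proof (rule mv_eqI[OF sec_mv_in[OF bra_in[OF V W]]])
  note VW = sec_mv_in[OF V] sec_mv_in[OF W]
  show "sn_bracket L 1 1 (sec_mv L V) (sec_mv L W) x a = 0" if "a \<notin> alt_forms L x" for x a
    by (rule mv_out[OF sn_in[OF VW] that])
  fix \<eta> assume \<eta>: "\<eta> \<in> all_forms L"
  have "int_prod (sn_bracket L 1 1 (sec_mv L V) (sec_mv L W)) \<eta> = graded_bracket 0 (-1) (lie_op V) (insert_vector W) \<eta>"
    unfolding sn_sec_left[OF V VW(2) \<eta>]
    by (rule graded_bracket_cong_right[OF lin_op_lie_op[OF V] \<eta> int_prod_sec_mv])
  then show "int_prod (sn_bracket L 1 1 (sec_mv L V) (sec_mv L W)) \<eta> = int_prod (sec_mv L (bra V W)) \<eta>"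
    by (simp add: bracket_lie_insert[OF V W \<eta>] int_prod_sec_mv[OF \<eta>])
qed

text \<open>This is (-1)^(n(n-1)/2), the sign of the permutation reversing n entries. It separates
  \<open>pairing\<close>, which keeps the order of the arguments, from \<open>int_prod\<close>,
  which reverses it.\<close>

primrec rev_sign :: "nat \<Rightarrow> real" where
  "rev_sign 0 = 1"
| "rev_sign (Suc n) = (-1) ^ n * rev_sign n"

lemma rev_sign_square: "rev_sign n * rev_sign n = 1"
  by (induction n) (simp_all add: algebra_simps)

lemma alt_rev: "a \<in> alt_forms L x \<Longrightarrow> a (rev vs) = rev_sign (length vs) * a vs"
proof (induction vs arbitrary: a)
  case (Cons v vs)
  have "a (v # rev vs) = (-1) ^ length vs * a (rev (v # vs))"
    using alt_forms_move[OF Cons.prems, of v "rev vs" "[]"] by simp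
  then have "a (rev (v # vs)) = (-1) ^ length vs * a (v # rev vs)" by simp
  also have "a (v # rev vs) = rev_sign (length vs) * a (v # vs)"
    by (rule Cons.IH[OF alt_forms_Cons[OF Cons.prems]])
  finally show ?case by simp
qed simp

text \<open>A field of degree p sees only lists of length p. The factor r serves both for the sign
  of a reversal and, in degree 0, for the value on the empty list.\<close>

lemma mv_cong:
  assumes P: "P \<in> multivector_fields L p" and a: "a \<in> alt_forms L x" "b \<in> alt_forms L x"
    and e: "\<And>vs. int (length vs) = p \<Longrightarrow> a vs = r * b vs"
  shows "P x a = r * P x b"
proof -
  obtain W \<Phi> where W: "(W, \<Phi>) \<in> trivs L" "x \<in> W" by (rule triv_cover)
  obtain c :: "nat list \<Rightarrow> 'm \<Rightarrow> real" where c: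
    "\<forall>x\<in>W. \<forall>a\<in>alt_forms L x. P x a = (\<Sum>I\<in>frame_indices_of p. c I x * a (frame_list \<Phi> x I))"
    using mv_expand[OF P W(1)] by (elim exE conjE)
  then show ?thesis using W(2) a e by (simp add: sum_distrib_left algebra_simps)
qed

lemma pairing_int_prod:
  assumes P: "P \<in> multivector_fields L p" and \<eta>: "\<eta> \<in> all_forms L"
  shows "pairing \<eta> P x = rev_sign (nat p) * int_prod P \<eta> x []"
proof -
  have "P x (\<lambda>vs. \<eta> x (rev vs)) = rev_sign (nat p) * P x (\<eta> x)"
    by (rule mv_cong[OF P alt_forms_rev[OF all_formsD(1)[OF \<eta>]] all_formsD(1)[OF \<eta>]])
       (auto simp: alt_rev[OF all_formsD(1)[OF \<eta>]])
  then show ?thesis using rev_sign_square[of "nat p"] by (simp add: pairing_def int_prod_def mult.assoc[symmetric])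
qed

text \<open>The Lie derivative of multivectors is tested on homogeneous forms only, while a form
  extending a given alternating form may have mixed degree.\<close>

lemma form_component:
  assumes "\<eta> \<in> all_forms L"
  shows "(\<lambda>x vs. if int (length vs) = q then \<eta> x vs else 0) \<in> forms L q"
proof -
  have "(\<lambda>x vs. if int (length vs) = q then \<eta> x vs else 0) \<in> all_forms L"
  proof (rule all_formsI)
    show "(\<lambda>vs. if int (length vs) = q then \<eta> x vs else 0) \<in> alt_forms L x" for x
      using alt_formsD[OF all_formsD(1)[OF assms, of x]] unfolding alt_forms_def by simp
    show "smooth_fun_on (bas L) W (\<lambda>x. if int (length (frame_list \<Phi> x js)) = q then \<eta> x (frame_list \<Phi> x js) else 0)"
      if "(W, \<Phi>) \<in> trivs L" "set js \<subseteq> {..<vb_rank L}" for W \<Phi> js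
      using all_formsD(2)[OF assms that] smooth_fun_on_const[OF trivD(1)[OF that(1)], of 0]
      by (cases "int (length js) = q") simp_all
  qed
  then show ?thesis by (simp add: forms_def)
qed

lemma mv_eq_pairingI:
  assumes R: "R \<in> multivector_fields L q" and S: "S \<in> multivector_fields L q"
    and e: "\<And>\<eta>. \<eta> \<in> forms L q \<Longrightarrow> pairing \<eta> R = pairing \<eta> S"
  shows "R = S"
proof (intro ext)
  fix x a
  show "R x a = S x a"
  proof (cases "a \<in> alt_forms L x")
    case True
    obtain \<eta> where \<eta>: "\<eta> \<in> all_forms L" "\<eta> x = a" by (rule form_through[OF True])
    let ?\<theta> = "\<lambda>x vs. if int (length vs) = q then \<eta> x vs else 0"
    note t = form_component[OF \<eta>(1), of q]
    have ta: "?\<theta> x \<in> alt_forms L x" using t all_formsD(1)[of ?\<theta> x] by (simp add: forms_def)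
    have "T x a = pairing ?\<theta> T x" if "T \<in> multivector_fields L q" for T
      using mv_cong[OF that True ta, of 1] \<eta>(2) by (simp add: pairing_def)
    from this[OF R] this[OF S] show ?thesis using e[OF t] by simp
  qed (simp add: mv_out[OF R] mv_out[OF S])
qed

lemma mv_degree_0:
  assumes Q: "Q \<in> multivector_fields L 0"
  obtains f where "smooth f" "Q = fun_mv L f" "pairing (\<lambda>x vs. if vs = [] then 1 else 0) Q = f"
proof
  let ?one = "\<lambda>x vs. if vs = [] then 1 else 0 :: real"
  let ?f = "pairing ?one Q"
  have one: "?one x \<in> alt_forms L x" for x by (simp add: alt_forms_def)
  have fi: "frame_indices_of 0 = {[]}" by (auto simp: frame_indices_def)
  have val: "Q x a = ?f x * a []" if a: "a \<in> alt_forms L x" for x a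
    using mv_cong[OF Q a one, of "a []"] by (simp add: pairing_def)
  show "Q = fun_mv L ?f"
    using val mv_out[OF Q] by (auto simp: fun_eq_iff fun_mv_def decomposable_def)
  show "smooth ?f"
  proof (rule smooth_fun_on_local[OF open_UNIV])
    fix x
    obtain W \<Phi> where W: "(W, \<Phi>) \<in> trivs L" "x \<in> W" by (rule triv_cover)
    obtain c :: "nat list \<Rightarrow> 'm \<Rightarrow> real" where c: "\<forall>I. smooth_fun_on (bas L) W (c I)"
      "\<forall>x\<in>W. \<forall>a\<in>alt_forms L x. Q x a = (\<Sum>I\<in>frame_indices_of 0. c I x * a (frame_list \<Phi> x I))"
      using mv_expand[OF Q W(1)] by (elim exE conjE)
    have "c [] y = ?f y" if "y \<in> W" for y
      using c(2)[rule_format, OF that one] fi by (simp add: pairing_def)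
    then have "smooth_fun_on (bas L) W ?f"
      by (rule smooth_fun_on_cong[OF trivD(1)[OF W(1)] c(1)[rule_format]])
    then show "\<exists>T. open T \<and> x \<in> T \<and> smooth_fun_on (bas L) (UNIV \<inter> T) ?f"
      using W(2) trivD(1)[OF W(1)] by auto
  qed
qed simp

text \<open>Up to \<open>rev_sign\<close>, a constant that passes through the derivative, the
  pairing is the degree 0 component of i(Q) \<eta>. On that component [L(V), i(Q)] \<eta> is the
  defining expression of the Lie derivative of Q. Degree 0 is treated apart because
  \<open>lie_mv\<close> has its own clause for it.\<close>

lemma sn_lie_mv:
  assumes V: "V \<in> sections L" and Q: "Q \<in> multivector_fields L q"
  shows "sn_bracket L 1 q (sec_mv L V) Q = lie_mv L q V Q"
proof (cases "q = 0")
  case True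
  obtain f where f: "smooth f" "Q = fun_mv L f" "pairing (\<lambda>x vs. if vs = [] then 1 else 0) Q = f"
    using mv_degree_0 Q True by blast
  have "sn_bracket L 1 0 (sec_mv L V) Q = fun_mv L (lie_fun L V f)"
  proof (rule mv_eqI[OF fun_mv_in[OF lie_fun_smooth[OF V f(1)]]])
    note Q0 = fun_mv_in[OF f(1)]
    show "sn_bracket L 1 0 (sec_mv L V) Q x a = 0" if "a \<notin> alt_forms L x" for x a
      unfolding f(2) by (rule mv_out[OF sn_in[OF sec_mv_in[OF V] Q0] that])
    fix \<eta> assume \<eta>: "\<eta> \<in> all_forms L"
    have "int_prod (sn_bracket L 1 0 (sec_mv L V) Q) \<eta> = graded_bracket 0 0 (lie_op V) (smult_form f) \<eta>"
      unfolding f(2) sn_sec_left[OF V Q0 \<eta>]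
      unfolding minus_zero by (rule graded_bracket_cong_right[OF lin_op_lie_op[OF V] \<eta> int_prod_fun_mv])
    then show "int_prod (sn_bracket L 1 0 (sec_mv L V) Q) \<eta> = int_prod (fun_mv L (lie_fun L V f)) \<eta>"
      by (simp only: bracket_lie_smult[OF V f(1) \<eta>] int_prod_fun_mv[OF \<eta>])
  qed
  then show ?thesis using True f(3) by (simp add: lie_mv_def)
next
  case False
  let ?R = "sn_bracket L 1 q (sec_mv L V) Q"
  have R: "?R \<in> multivector_fields L q" using sn_in[OF sec_mv_in[OF V] Q] by simp
  have e: "pairing \<eta> ?R = (\<lambda>x. lie_fun L V (pairing \<eta> Q) x - pairing (lie_form L V \<eta>) Q x)"
    if "\<eta> \<in> forms L q" for \<eta>
  proof
    fix x
    have \<eta>: "\<eta> \<in> all_forms L" using that by (simp add: forms_def)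
    note iQ = lin_op_closed[OF lin_op_int_prod[OF Q] \<eta>]
    let ?s = "rev_sign (nat q)"
    have sm: "smooth (\<lambda>x. int_prod Q \<eta> x [])" using eval_form_smooth[OF iQ, of "[]"] by (simp add: eval_form_def)
    have "pairing \<eta> ?R x = ?s * (lie_op V (int_prod Q \<eta>) x [] - int_prod Q (lie_op V \<eta>) x [])"
      by (simp add: pairing_int_prod[OF R \<eta>] sn_sec_left[OF V Q \<eta>] graded_bracket_def)
    also have "\<dots> = lie_fun L V (\<lambda>x. ?s * int_prod Q \<eta> x []) x - ?s * int_prod Q (lie_op V \<eta>) x []"
      by (simp add: lie_op_Nil[OF V iQ] lie_fun_derivation(3)[OF V sm sm] algebra_simps)
    also have "\<dots> = lie_fun L V (pairing \<eta> Q) x - pairing (lie_form L V \<eta>) Q x"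
    proof -
      have "pairing \<eta> Q = (\<lambda>x. ?s * int_prod Q \<eta> x [])" using pairing_int_prod[OF Q \<eta>] by auto
      then show ?thesis
        by (simp add: lie_form_eq[OF V \<eta>] pairing_int_prod[OF Q lin_op_closed[OF lin_op_lie_op[OF V] \<eta>]])
    qed
    finally show "pairing \<eta> ?R x = lie_fun L V (pairing \<eta> Q) x - pairing (lie_form L V \<eta>) Q x" .
  qed
  have "(THE R. R \<in> multivector_fields L q \<and> (\<forall>\<eta> \<in> forms L q.
      pairing \<eta> R = (\<lambda>x. lie_fun L V (pairing \<eta> Q) x - pairing (lie_form L V \<eta>) Q x))) = ?R"
  proof (rule the_equality, intro conjI ballI R e)
    fix S assume "S \<in> multivector_fields L q \<and> (\<forall>\<eta> \<in> forms L q.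
      pairing \<eta> S = (\<lambda>x. lie_fun L V (pairing \<eta> Q) x - pairing (lie_form L V \<eta>) Q x))"
    then show "S = ?R" by (intro mv_eq_pairingI[OF _ R]) (simp_all add: e)
  qed
  then show ?thesis using False by (simp add: lie_mv_def)
qed

text \<open>As i(P) and i(Q) commute, [[i(P),d],i(Q)] = [i(P),[d,i(Q)]]; reversing the inner and the
  outer commutator gives the bracket with P and Q exchanged. The signs combine because pq + p + q
  and (p-1)(q-1) have opposite parity.\<close>

lemma sn_anti:
  assumes P: "P \<in> multivector_fields L p" and Q: "Q \<in> multivector_fields L q"
  shows "sn_bracket L p q P Q = scale_mv (- ((-1) powi ((p - 1) * (q - 1)))) (sn_bracket L q p Q P)"
proof (rule sn_eqI[OF P Q])
  have "q + p - 1 = p + q - 1" by simp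
  from scale_mv_in[OF sn_in[OF Q P], unfolded this]
  show "scale_mv (- ((-1) powi ((p - 1) * (q - 1)))) (sn_bracket L q p Q P) \<in> multivector_fields L (p + q - 1)" .
  fix \<eta> x vs assume \<eta>: "\<eta> \<in> all_forms L"
  note lP = lin_op_int_prod[OF P] and lQ = lin_op_int_prod[OF Q]
  let ?b = "graded_bracket (1 - q) (- p) (d_op q Q) (int_prod P) \<eta> x vs"
  define s :: real where "s = - ((-1) powi (- q))"
  have an: "graded_bracket 1 (- q) (d_rho L) (int_prod Q) = (\<lambda>\<eta> x vs. s * d_op q Q \<eta> x vs)"
    using graded_bracket_anti[of 1 "- q" "d_rho L" "int_prod Q"] by (simp add: d_op_def s_def fun_eq_iff)
  have "graded_bracket (1 - p) (- q) (d_op p P) (int_prod Q) \<eta> x vs =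
      graded_bracket (- p) (1 - q) (int_prod P) (graded_bracket 1 (- q) (d_rho L) (int_prod Q)) \<eta> x vs"
    unfolding d_op_def by (rule jacobi_right[OF lP lin_op_d_rho lQ \<eta> int_prod_commute[OF P Q]]) simp_all
  also have "\<dots> = - ((-1) powi (- p * (1 - q))) * graded_bracket (1 - q) (- p) (graded_bracket 1 (- q) (d_rho L) (int_prod Q)) (int_prod P) \<eta> x vs"
    by (rule graded_bracket_anti)
  also have "graded_bracket (1 - q) (- p) (graded_bracket 1 (- q) (d_rho L) (int_prod Q)) (int_prod P) \<eta> x vs = s * ?b"
    unfolding an
    by (simp add: graded_bracket_def lin_op_scale[OF lP lin_op_closed[OF lin_op_d_op[OF Q] \<eta>]] right_diff_distrib)
  also have "- ((-1) powi (- p * (1 - q))) * (s * ?b) = - ((-1) powi ((p - 1) * (q - 1))) * ?b"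
    by (cases "even p"; cases "even q") (simp_all add: powi_minus_one s_def)
  finally show "int_prod (scale_mv (- ((-1) powi ((p - 1) * (q - 1)))) (sn_bracket L q p Q P)) \<eta> x vs =
      graded_bracket (1 - p) (- q) (d_op p P) (int_prod Q) \<eta> x vs"
    by (simp add: int_prod_scale_mv int_prod_sn[OF Q P \<eta>])
qed

lemma sn_add_right:
  assumes P: "P \<in> multivector_fields L p" and Q: "Q\<^sub>1 \<in> multivector_fields L q" "Q\<^sub>2 \<in> multivector_fields L q"
  shows "sn_bracket L p q P (add_mv Q\<^sub>1 Q\<^sub>2) = add_mv (sn_bracket L p q P Q\<^sub>1) (sn_bracket L p q P Q\<^sub>2)"
proof (rule sn_eqI[OF P add_mv_in[OF Q] add_mv_in[OF sn_in[OF P Q(1)] sn_in[OF P Q(2)]]])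
  fix \<eta> x vs assume \<eta>: "\<eta> \<in> all_forms L"
  note dP = lin_op_d_op[OF P] and c = lin_op_closed[OF lin_op_int_prod[OF Q(1)] \<eta>] lin_op_closed[OF lin_op_int_prod[OF Q(2)] \<eta>]
  show "int_prod (add_mv (sn_bracket L p q P Q\<^sub>1) (sn_bracket L p q P Q\<^sub>2)) \<eta> x vs =
      graded_bracket (1 - p) (- q) (d_op p P) (int_prod (add_mv Q\<^sub>1 Q\<^sub>2)) \<eta> x vs"
    by (simp add: int_prod_add_mv int_prod_sn[OF P Q(1) \<eta>] int_prod_sn[OF P Q(2) \<eta>] graded_bracket_def
        lin_op_add[OF dP c] algebra_simps)
qed

lemma sn_scale_right:
  assumes P: "P \<in> multivector_fields L p" and Q: "Q \<in> multivector_fields L q"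
  shows "sn_bracket L p q P (scale_mv c Q) = scale_mv c (sn_bracket L p q P Q)"
proof (rule sn_eqI[OF P scale_mv_in[OF Q] scale_mv_in[OF sn_in[OF P Q]]])
  fix \<eta> x vs assume \<eta>: "\<eta> \<in> all_forms L"
  show "int_prod (scale_mv c (sn_bracket L p q P Q)) \<eta> x vs =
      graded_bracket (1 - p) (- q) (d_op p P) (int_prod (scale_mv c Q)) \<eta> x vs"
    by (simp add: int_prod_scale_mv int_prod_sn[OF P Q \<eta>] graded_bracket_def
        lin_op_scale[OF lin_op_d_op[OF P] lin_op_closed[OF lin_op_int_prod[OF Q] \<eta>]] algebra_simps)
qed

text \<open>An exterior product becomes a composition of interior products, and the graded
  commutator with the fixed operator [i(P),d] is a derivation of composition. The sign comes from
  the degree 1 - p of this operator and the degree of i(\<open>Q\<^sub>1\<close>).\<close>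

lemma sn_wedge:
  assumes P: "P \<in> multivector_fields L p" and Q: "Q\<^sub>1 \<in> multivector_fields L q\<^sub>1" "Q\<^sub>2 \<in> multivector_fields L q\<^sub>2"
  shows "sn_bracket L p (q\<^sub>1 + q\<^sub>2) P (wedge_mv L Q\<^sub>1 Q\<^sub>2) =
    add_mv (wedge_mv L (sn_bracket L p q\<^sub>1 P Q\<^sub>1) Q\<^sub>2)
      (scale_mv ((-1) powi ((p - 1) * q\<^sub>1)) (wedge_mv L Q\<^sub>1 (sn_bracket L p q\<^sub>2 P Q\<^sub>2)))"
proof (rule sn_eqI[OF P wedge_mv_in[OF Q]])
  note S1 = sn_in[OF P Q(1)] and S2 = sn_in[OF P Q(2)]
  have d: "p + q\<^sub>1 - 1 + q\<^sub>2 = p + (q\<^sub>1 + q\<^sub>2) - 1" "q\<^sub>1 + (p + q\<^sub>2 - 1) = p + (q\<^sub>1 + q\<^sub>2) - 1" by simp_all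
  show "add_mv (wedge_mv L (sn_bracket L p q\<^sub>1 P Q\<^sub>1) Q\<^sub>2)
      (scale_mv ((-1) powi ((p - 1) * q\<^sub>1)) (wedge_mv L Q\<^sub>1 (sn_bracket L p q\<^sub>2 P Q\<^sub>2)))
      \<in> multivector_fields L (p + (q\<^sub>1 + q\<^sub>2) - 1)"
    using wedge_mv_in[OF S1 Q(2)] wedge_mv_in[OF Q(1) S2] unfolding d by (intro add_mv_in scale_mv_in)
  fix \<eta> x vs assume \<eta>: "\<eta> \<in> all_forms L"
  note l1 = lin_op_int_prod[OF Q(1)] and l2 = lin_op_int_prod[OF Q(2)] and dP = lin_op_d_op[OF P]
  have "graded_bracket (1 - p) (- (q\<^sub>1 + q\<^sub>2)) (d_op p P) (int_prod (wedge_mv L Q\<^sub>1 Q\<^sub>2)) \<eta> =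
      graded_bracket (1 - p) (- q\<^sub>1 + - q\<^sub>2) (d_op p P) (\<lambda>\<eta>. int_prod Q\<^sub>1 (int_prod Q\<^sub>2 \<eta>)) \<eta>"
    unfolding minus_add_distrib[of q\<^sub>1 q\<^sub>2] add.commute[of "- q\<^sub>2"]
    by (rule graded_bracket_cong_right[OF dP \<eta> int_prod_wedge_mv])
  moreover have "(1 - p) * - q\<^sub>1 = (p - 1) * q\<^sub>1" by (simp add: algebra_simps)
  ultimately show "int_prod (add_mv (wedge_mv L (sn_bracket L p q\<^sub>1 P Q\<^sub>1) Q\<^sub>2)
      (scale_mv ((-1) powi ((p - 1) * q\<^sub>1)) (wedge_mv L Q\<^sub>1 (sn_bracket L p q\<^sub>2 P Q\<^sub>2)))) \<eta> x vs =
      graded_bracket (1 - p) (- (q\<^sub>1 + q\<^sub>2)) (d_op p P) (int_prod (wedge_mv L Q\<^sub>1 Q\<^sub>2)) \<eta> x vs"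
    using graded_bracket_compose_right[OF dP l1 l2 \<eta>, of "1 - p" "- q\<^sub>1" "- q\<^sub>2" x vs]
    by (simp only: int_prod_add_mv int_prod_scale_mv int_prod_wedge_mv[OF \<eta>]
        int_prod_sn[OF P Q(1) lin_op_closed[OF l2 \<eta>]] int_prod_sn[OF P Q(2) \<eta>])
qed

text \<open>Since \<open>d\<^sub>\<rho> \<circ> d\<^sub>\<rho> = 0\<close>, the map \<open>P \<mapsto> [i(P), d\<^sub>\<rho>]\<close> sends the bracket to the graded commutator.\<close>

lemma d_op_sn:
  assumes P: "P \<in> multivector_fields L p" and Q: "Q \<in> multivector_fields L q" and \<eta>: "\<eta> \<in> all_forms L"
  shows "d_op (p + q - 1) (sn_bracket L p q P Q) \<eta> = graded_bracket (1 - p) (1 - q) (d_op p P) (d_op q Q) \<eta>"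
proof (intro ext)
  fix x vs
  note dP = lin_op_d_op[OF P] and lP = lin_op_int_prod[OF P] and lQ = lin_op_int_prod[OF Q]
  have dd: "d_rho L (d_rho L \<theta>) = (\<lambda>x vs. 0)" if "\<theta> \<in> all_forms L" for \<theta>
    using d_rho_d_rho[OF that] by (simp add: fun_eq_iff)
  \<comment> \<open>In [[i(P),d],d] the terms with d o d vanish, and d i(P) d occurs twice with
    opposite signs.\<close>
  have "gcomm (1 - p) 1 (d_op p P) (d_rho L)"
  proof (rule gcommI)
    fix \<theta> y ws assume \<theta>: "\<theta> \<in> all_forms L"
    note c = lin_op_closed[OF lP] d_rho_in
    have "d_rho L (\<lambda>x vs. int_prod P (d_rho L \<theta>) x vs - (-1) powi (- p) * d_rho L (int_prod P \<theta>) x vs) =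
        (\<lambda>x vs. d_rho L (int_prod P (d_rho L \<theta>)) x vs - (-1) powi (- p) * d_rho L (d_rho L (int_prod P \<theta>)) x vs)"
      by (rule lin_op_diff[OF lin_op_d_rho]) (simp_all add: c \<theta>)
    then show "graded_bracket (1 - p) 1 (d_op p P) (d_rho L) \<theta> y ws = 0"
      by (simp add: graded_bracket_def d_op_def dd \<theta> c lin_op_0[OF lP] powi_minus_one)
  qed
  from gcommD[OF this] have z: "graded_bracket (1 - p + 1) (- q) (graded_bracket (1 - p) 1 (d_op p P) (d_rho L)) (int_prod Q) \<eta> x vs = 0"
    by (intro graded_bracket_0_left[OF lQ \<eta>])
  have "d_op (p + q - 1) (sn_bracket L p q P Q) \<eta> x vs =
      graded_bracket (1 - p + - q) 1 (graded_bracket (1 - p) (- q) (d_op p P) (int_prod Q)) (d_rho L) \<eta> x vs"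
  proof -
    have "d_op (p + q - 1) (sn_bracket L p q P Q) \<eta> =
        graded_bracket (- (p + q - 1)) 1 (graded_bracket (1 - p) (- q) (d_op p P) (int_prod Q)) (d_rho L) \<eta>"
      unfolding d_op_def[of "p + q - 1"] by (rule graded_bracket_cong_left[OF lin_op_d_rho \<eta> int_prod_sn[OF P Q]])
    then show ?thesis by (simp add: algebra_simps)
  qed
  also have "\<dots> = graded_bracket (1 - p) (- q + 1) (d_op p P) (graded_bracket (- q) 1 (int_prod Q) (d_rho L)) \<eta> x vs"
    using graded_bracket_jacobi[OF dP lQ lin_op_d_rho \<eta>, of "1 - p" "- q" 1 x vs] z by simp
  finally show "d_op (p + q - 1) (sn_bracket L p q P Q) \<eta> x vs = graded_bracket (1 - p) (1 - q) (d_op p P) (d_op q Q) \<eta> x vs"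
    by (simp add: d_op_def)
qed

text \<open>In this Leibniz form the claim is the Jacobi identity of commutators for [i(P),d],
  [i(Q),d] and i(R), because [i([P,Q]),d] is the commutator of the first two.\<close>

lemma sn_jacobi_left:
  assumes P: "P \<in> multivector_fields L p" and Q: "Q \<in> multivector_fields L q" and R: "R \<in> multivector_fields L r"
  shows "sn_bracket L (p + q - 1) r (sn_bracket L p q P Q) R =
    add_mv (sn_bracket L p (q + r - 1) P (sn_bracket L q r Q R))
      (scale_mv (- ((-1) powi ((p - 1) * (q - 1)))) (sn_bracket L q (p + r - 1) Q (sn_bracket L p r P R)))"
proof (rule sn_eqI[OF sn_in[OF P Q] R])
  note S1 = sn_in[OF P sn_in[OF Q R]] and S2 = sn_in[OF Q sn_in[OF P R]]
  have d: "p + (q + r - 1) - 1 = p + q - 1 + r - 1" "q + (p + r - 1) - 1 = p + q - 1 + r - 1" by simp_all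
  show "add_mv (sn_bracket L p (q + r - 1) P (sn_bracket L q r Q R))
      (scale_mv (- ((-1) powi ((p - 1) * (q - 1)))) (sn_bracket L q (p + r - 1) Q (sn_bracket L p r P R)))
      \<in> multivector_fields L (p + q - 1 + r - 1)"
    using S1 S2 unfolding d by (intro add_mv_in scale_mv_in)
  fix \<eta> x vs assume \<eta>: "\<eta> \<in> all_forms L"
  note dP = lin_op_d_op[OF P] and dQ = lin_op_d_op[OF Q] and lR = lin_op_int_prod[OF R]
  have "graded_bracket (1 - (p + q - 1)) (- r) (d_op (p + q - 1) (sn_bracket L p q P Q)) (int_prod R) \<eta> x vs =
      graded_bracket (1 - p + (1 - q)) (- r) (graded_bracket (1 - p) (1 - q) (d_op p P) (d_op q Q)) (int_prod R) \<eta> x vs"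
  proof -
    have "graded_bracket (1 - (p + q - 1)) (- r) (d_op (p + q - 1) (sn_bracket L p q P Q)) (int_prod R) \<eta> =
        graded_bracket (1 - (p + q - 1)) (- r) (graded_bracket (1 - p) (1 - q) (d_op p P) (d_op q Q)) (int_prod R) \<eta>"
      by (rule graded_bracket_cong_left[OF lR \<eta> d_op_sn[OF P Q]])
    then show ?thesis by (simp add: algebra_simps)
  qed
  also have "\<dots> = graded_bracket (1 - p) (1 - q + - r) (d_op p P) (graded_bracket (1 - q) (- r) (d_op q Q) (int_prod R)) \<eta> x vs +
      (-1) powi ((1 - q) * - r) * graded_bracket (1 - p + - r) (1 - q) (graded_bracket (1 - p) (- r) (d_op p P) (int_prod R)) (d_op q Q) \<eta> x vs"
    by (rule graded_bracket_jacobi[OF dP dQ lR \<eta>])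
  also have "graded_bracket (1 - p) (1 - q + - r) (d_op p P) (graded_bracket (1 - q) (- r) (d_op q Q) (int_prod R)) \<eta> =
      int_prod (sn_bracket L p (q + r - 1) P (sn_bracket L q r Q R)) \<eta>"
  proof -
    have "graded_bracket (1 - p) (- (q + r - 1)) (d_op p P) (int_prod (sn_bracket L q r Q R)) \<eta> =
        graded_bracket (1 - p) (- (q + r - 1)) (d_op p P) (graded_bracket (1 - q) (- r) (d_op q Q) (int_prod R)) \<eta>"
      by (rule graded_bracket_cong_right[OF dP \<eta> int_prod_sn[OF Q R]])
    moreover have "1 - q + - r = - (q + r - 1)" by simp
    ultimately show ?thesis by (simp only: int_prod_sn[OF P sn_in[OF Q R] \<eta>])
  qed
  also have "graded_bracket (1 - p + - r) (1 - q) (graded_bracket (1 - p) (- r) (d_op p P) (int_prod R)) (d_op q Q) \<eta> =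
      graded_bracket (- (p + r - 1)) (1 - q) (int_prod (sn_bracket L p r P R)) (d_op q Q) \<eta>"
  proof -
    have "graded_bracket (- (p + r - 1)) (1 - q) (int_prod (sn_bracket L p r P R)) (d_op q Q) \<eta> =
        graded_bracket (- (p + r - 1)) (1 - q) (graded_bracket (1 - p) (- r) (d_op p P) (int_prod R)) (d_op q Q) \<eta>"
      by (rule graded_bracket_cong_left[OF dQ \<eta> int_prod_sn[OF P R]])
    moreover have "1 - p + - r = - (p + r - 1)" by simp
    ultimately show ?thesis by (simp only:)
  qed
  also have "graded_bracket (- (p + r - 1)) (1 - q) (int_prod (sn_bracket L p r P R)) (d_op q Q) \<eta> x vs =
      - ((-1) powi (- (p + r - 1) * (1 - q))) * int_prod (sn_bracket L q (p + r - 1) Q (sn_bracket L p r P R)) \<eta> x vs"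
    unfolding int_prod_sn[OF Q sn_in[OF P R] \<eta>] by (rule graded_bracket_anti)
  finally show "int_prod (add_mv (sn_bracket L p (q + r - 1) P (sn_bracket L q r Q R))
      (scale_mv (- ((-1) powi ((p - 1) * (q - 1)))) (sn_bracket L q (p + r - 1) Q (sn_bracket L p r P R)))) \<eta> x vs =
      graded_bracket (1 - (p + q - 1)) (- r) (d_op (p + q - 1) (sn_bracket L p q P Q)) (int_prod R) \<eta> x vs"
    by (cases "even p"; cases "even q"; cases "even r") (simp_all add: int_prod_add_mv int_prod_scale_mv powi_minus_one)
qed

text \<open>Antisymmetry turns the cyclic form into the Leibniz form: [[Q,R],P] is reversed once and
  [[R,P],Q] twice, after which the terms [P,[Q,R]] and [Q,[P,R]] cancel in each case of
  parities.\<close>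

lemma sn_jacobi:
  assumes P: "P \<in> multivector_fields L p" and Q: "Q \<in> multivector_fields L q" and R: "R \<in> multivector_fields L r"
  shows "add_mv (scale_mv ((-1) powi ((p - 1) * (r - 1))) (sn_bracket L (p + q - 1) r (sn_bracket L p q P Q) R))
    (add_mv (scale_mv ((-1) powi ((q - 1) * (p - 1))) (sn_bracket L (q + r - 1) p (sn_bracket L q r Q R) P))
      (scale_mv ((-1) powi ((r - 1) * (q - 1))) (sn_bracket L (r + p - 1) q (sn_bracket L r p R P) Q))) = zero_mv"
proof -
  have d: "r + p - 1 = p + r - 1" by simp
  have "sn_bracket L (r + p - 1) q (sn_bracket L r p R P) Q =
      scale_mv (- ((-1) powi ((p + r - 1 - 1) * (q - 1))))
        (scale_mv (- ((-1) powi ((r - 1) * (p - 1)))) (sn_bracket L q (p + r - 1) Q (sn_bracket L p r P R)))"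
    using sn_anti[OF sn_in[OF R P] Q] sn_scale_right[OF Q sn_in[OF P R]]
    unfolding sn_anti[OF R P] d by simp
  then show ?thesis
    unfolding sn_jacobi_left[OF P Q R] sn_anti[OF sn_in[OF Q R] P]
    by (cases "even p"; cases "even q"; cases "even r")
       (simp_all add: add_mv_def scale_mv_def zero_mv_def powi_minus_one)
qed

end

theorem proposition5p4p9:
  fixes L :: "('m :: {t2_space, second_countable_topology}, 'e) lie_algebroid"
  assumes "is_lie_algebroid L"
  shows
    "(\<forall>f \<in> smooth_funs (bas L). \<forall>g \<in> smooth_funs (bas L).
        sn_bracket L 0 0 (fun_mv L f) (fun_mv L g) = zero_mv) \<and>
     (\<forall>V \<in> sections L. \<forall>q. \<forall>Q \<in> multivector_fields L q.
        sn_bracket L 1 q (sec_mv L V) Q = lie_mv L q V Q) \<and>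
     (\<forall>V \<in> sections L. \<forall>W \<in> sections L.
        sn_bracket L 1 1 (sec_mv L V) (sec_mv L W) = sec_mv L (lie_bracket L V W)) \<and>
     (\<forall>p q. \<forall>P \<in> multivector_fields L p. \<forall>Q \<in> multivector_fields L q.
        sn_bracket L p q P Q =
          scale_mv (- ((-1) powi ((p - 1) * (q - 1)))) (sn_bracket L q p Q P)) \<and>
     (\<forall>p. \<forall>P \<in> multivector_fields L p.
        (\<forall>q. \<forall>Q \<in> multivector_fields L q.
           sn_bracket L p q P Q \<in> multivector_fields L (q + (p - 1))) \<and>
        (\<forall>q. \<forall>Q\<^sub>1 \<in> multivector_fields L q. \<forall>Q\<^sub>2 \<in> multivector_fields L q.
           sn_bracket L p q P (add_mv Q\<^sub>1 Q\<^sub>2) =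
             add_mv (sn_bracket L p q P Q\<^sub>1) (sn_bracket L p q P Q\<^sub>2)) \<and>
        (\<forall>q c. \<forall>Q \<in> multivector_fields L q.
           sn_bracket L p q P (scale_mv c Q) = scale_mv c (sn_bracket L p q P Q)) \<and>
        (\<forall>q\<^sub>1 q\<^sub>2. \<forall>Q\<^sub>1 \<in> multivector_fields L q\<^sub>1. \<forall>Q\<^sub>2 \<in> multivector_fields L q\<^sub>2.
           sn_bracket L p (q\<^sub>1 + q\<^sub>2) P (wedge_mv L Q\<^sub>1 Q\<^sub>2) =
             add_mv (wedge_mv L (sn_bracket L p q\<^sub>1 P Q\<^sub>1) Q\<^sub>2)
               (scale_mv ((-1) powi ((p - 1) * q\<^sub>1))
                 (wedge_mv L Q\<^sub>1 (sn_bracket L p q\<^sub>2 P Q\<^sub>2))))) \<and>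
     (\<forall>p q r. \<forall>P \<in> multivector_fields L p. \<forall>Q \<in> multivector_fields L q.
      \<forall>R \<in> multivector_fields L r.
        add_mv
          (scale_mv ((-1) powi ((p - 1) * (r - 1)))
            (sn_bracket L (p + q - 1) r (sn_bracket L p q P Q) R))
          (add_mv
            (scale_mv ((-1) powi ((q - 1) * (p - 1)))
              (sn_bracket L (q + r - 1) p (sn_bracket L q r Q R) P))
            (scale_mv ((-1) powi ((r - 1) * (q - 1)))
              (sn_bracket L (r + p - 1) q (sn_bracket L r p R P) Q))) = zero_mv)"
proof -
  interpret algebroid L by unfold_locales (rule assms)
  show ?thesis
  proof (intro conjI allI ballI)
    fix p q P Q assume P: "P \<in> multivector_fields L p" and Q: "Q \<in> multivector_fields L q"
    \<comment> \<open>Written as q + (p - 1), the degree exhibits the bracket with P as a map of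
      degree p - 1.\<close>
    have "p + q - 1 = q + (p - 1)" by simp
    from sn_in[OF P Q, unfolded this]
    show "sn_bracket L p q P Q \<in> multivector_fields L (q + (p - 1))" .
  qed (simp_all only: mem_Collect_eq sn_functions sn_lie_mv sn_sections sn_add_right sn_scale_right
      sn_wedge sn_jacobi, rule sn_anti)
qed

end
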